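(* Let $(X,d)$ be a doubling metric space equipped with a doubling Borel measure $\mu$. Then for every $\eta\in[0,1)$ there exists on $(X,d,\mu)$ a basis of wavelets with exponential localization that is Hölder-continuous of exponent $\eta$.
   Context: $B(x,r)=\{y\in X:d(x,y)<r\}$. A (nonempty) metric space $(X,d)$ is doubling if there is a constant $M$ such that every ball $B(x,r)$ can be covered by at most $M$ balls of radius $r/2$. A Borel measure $\mu$ is doubling if there is a constant $C$ such that $\mu(B(x,2r))\le C\mu(B(x,r))$ for all $x\in X$, $r>0$, with $0<\mu(B(x,r))<\infty$ for all balls. A family of functions $\psi^k_\alpha:X\to\mathbb{R}$ is a basis of wavelets with $\varrho$-localization, where $\varrho:[0,\infty)\to[0,1]$ is non-increasing, if for some points $y^k_\alpha\in X$ and constants $\delta\in(0,1)$, $C>0$: (vanishing mean) $\int_X\psi^k_\alpha\,d\mu=0$; (localization) $|\psi^k_\alpha(x)|\le\frac{C}{\sqrt{\mu(B(y^k_\alpha,\delta^k))}}\,\varrho\big(\frac{d(x,y^k_\alpha)}{\delta^k}\big)$ for all $x\in X$; and the functions $\psi^k_\alpha$ form an orthonormal basis of $L^2_0(\mu)$, where $L^2_0(\mu)=L^2(\mu)$ if $X$ is unbounded and $L^2_0(\mu)=\{f\in L^2(\mu):\int_Xf\,d\mu=0\}$ if $X$ is bounded. Here $k$ runs over $\mathbb{Z}$ if $X$ is unbounded and over $\{k\in\mathbb{Z}:k\ge k_0\}$ for some $k_0\in\mathbb{Z}$ if $X$ is bounded; for each $k$, $\alpha$ runs over a countable (possibly finite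 or empty; finite if $X$ is bounded) index set. The wavelets are Hölder-continuous of exponent $\eta$ if, with the same $\varrho$, $\delta$ and points $y^k_\alpha$ and some constant $C$, $$|\psi^k_\alpha(x)-\psi^k_\alpha(y)|\le\frac{C}{\sqrt{\mu(B(y^k_\alpha,\delta^k))}}\,\varrho\Big(\frac{d(x,y^k_\alpha)}{\delta^k}\Big)\Big(\frac{d(x,y)}{\delta^k}\Big)^\eta\quad\text{whenever } d(x,y)\le\delta^k,$$ for all $k,\alpha$. Exponential localization means $\varrho(t)=\exp(-\gamma t)$ for some $\gamma>0$. *)

theory Defs
  imports "HOL-Analysis.Analysis"
begin

text \<open>
  The metric space X is the universe of a type of class \<open>metric_space\<close>; in particular it is
  nonempty.
\<close>

definition doubling_space :: "'a::metric_space itself \<Rightarrow> bool" where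
  "doubling_space _ \<longleftrightarrow>
    (\<exists>N::nat. \<forall>(x::'a) r. r > 0 \<longrightarrow>
      (\<exists>S. finite S \<and> card S \<le> N \<and> ball x r \<subseteq> (\<Union>s\<in>S. ball s (r / 2))))"

definition doubling_measure :: "'a::metric_space measure \<Rightarrow> bool" where
  "doubling_measure M \<longleftrightarrow>
    sets M = sets borel \<and>
    (\<forall>x r. r > 0 \<longrightarrow> 0 < emeasure M (ball x r) \<and> emeasure M (ball x r) < \<infinity>) \<and>
    (\<exists>C::real. \<forall>x r. r > 0 \<longrightarrow>
      emeasure M (ball x (2 * r)) \<le> ennreal C * emeasure M (ball x r))"

text \<open>
  Elements of \<open>L\<^sup>2\<close> are represented by functions, without passing to classes modulo
  null sets.
\<close>

definition L2_functions :: "'a measure \<Rightarrow> ('a \<Rightarrow> real) set" where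
  "L2_functions M = {f \<in> borel_measurable M. integrable M (\<lambda>x. (f x)\<^sup>2)}"

text \<open>
  For bounded X a doubling measure is finite, so every square-integrable function is integrable and
  asking for \<open>has_bochner_integral\<close> instead of a vanishing integral is no additional restriction.
\<close>

definition L20_functions :: "'a::metric_space measure \<Rightarrow> ('a \<Rightarrow> real) set" where
  "L20_functions M =
    (if bounded (UNIV :: 'a set) then {f \<in> L2_functions M. has_bochner_integral M f 0}
     else L2_functions M)"

text \<open>
  An orthonormal family in \<open>L\<^sup>2\<^sub>0\<close> whose finite linear combinations are dense there with
  respect to the \<open>L\<^sup>2\<close> norm.
\<close>

definition orthonormal_basis_L20 ::
    "'a::metric_space measure \<Rightarrow> 'i set \<Rightarrow> ('i \<Rightarrow> 'a \<Rightarrow> real) \<Rightarrow> bool" where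
  "orthonormal_basis_L20 M I e \<longleftrightarrow>
    (\<forall>i\<in>I. e i \<in> L20_functions M) \<and>
    (\<forall>i\<in>I. \<forall>j\<in>I. (\<integral>x. e i x * e j x \<partial>M) = (if i = j then 1 else 0)) \<and>
    (\<forall>f\<in>L20_functions M. \<forall>\<epsilon>>0. \<exists>J c. finite J \<and> J \<subseteq> I \<and>
      sqrt (\<integral>x. (f x - (\<Sum>i\<in>J. c i * e i x))\<^sup>2 \<partial>M) < \<epsilon>)"

text \<open>
  \<open>K\<close> is the set of scales and \<open>A k\<close> the index set at scale \<open>k\<close>; countable index sets are taken to
  be sets of natural numbers. The vanishing mean condition includes integrability of the wavelets,
  since the library integral of a non-integrable function is 0.
\<close>

definition wavelet_basis ::
    "'a::metric_space measure \<Rightarrow> (real \<Rightarrow> real) \<Rightarrow> real \<Rightarrow> int set \<Rightarrow> (int \<Rightarrow> nat set) \<Rightarrow>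
      (int \<Rightarrow> nat \<Rightarrow> 'a) \<Rightarrow> (int \<Rightarrow> nat \<Rightarrow> 'a \<Rightarrow> real) \<Rightarrow> bool" where
  "wavelet_basis M \<rho> \<delta> K A y \<psi> \<longleftrightarrow>
    (\<forall>t\<ge>0. 0 \<le> \<rho> t \<and> \<rho> t \<le> 1) \<and> antimono_on {0..} \<rho> \<and>
    0 < \<delta> \<and> \<delta> < 1 \<and>
    (if bounded (UNIV :: 'a set) then (\<exists>k0. K = {k0..}) \<and> (\<forall>k\<in>K. finite (A k))
     else K = UNIV) \<and>
    (\<forall>k\<in>K. \<forall>\<alpha>\<in>A k. has_bochner_integral M (\<psi> k \<alpha>) 0) \<and>
    (\<exists>C>0. \<forall>k\<in>K. \<forall>\<alpha>\<in>A k. \<forall>x.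
      \<bar>\<psi> k \<alpha> x\<bar> \<le> C / sqrt (measure M (ball (y k \<alpha>) (\<delta> powi k))) *
        \<rho> (dist x (y k \<alpha>) / \<delta> powi k)) \<and>
    orthonormal_basis_L20 M (Sigma K A) (\<lambda>(k, \<alpha>). \<psi> k \<alpha>)"

text \<open>
  In the case \<open>\<eta> = 0\<close>, \<open>x = x'\<close> the convention \<open>0 powr 0 = 0\<close> is harmless: the left-hand side is 0.
\<close>

definition hoelder_wavelets ::
    "'a::metric_space measure \<Rightarrow> (real \<Rightarrow> real) \<Rightarrow> real \<Rightarrow> int set \<Rightarrow> (int \<Rightarrow> nat set) \<Rightarrow>
      (int \<Rightarrow> nat \<Rightarrow> 'a) \<Rightarrow> (int \<Rightarrow> nat \<Rightarrow> 'a \<Rightarrow> real) \<Rightarrow> real \<Rightarrow> bool" where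
  "hoelder_wavelets M \<rho> \<delta> K A y \<psi> \<eta> \<longleftrightarrow>
    (\<exists>C>0. \<forall>k\<in>K. \<forall>\<alpha>\<in>A k. \<forall>x x'. dist x x' \<le> \<delta> powi k \<longrightarrow>
      \<bar>\<psi> k \<alpha> x - \<psi> k \<alpha> x'\<bar> \<le> C / sqrt (measure M (ball (y k \<alpha>) (\<delta> powi k))) *
        \<rho> (dist x (y k \<alpha>) / \<delta> powi k) * (dist x x' / \<delta> powi k) powr \<eta>)"

definition exponential_localization :: "(real \<Rightarrow> real) \<Rightarrow> bool" where
  "exponential_localization \<rho> \<longleftrightarrow> (\<exists>\<gamma>>0. \<forall>t\<ge>0. \<rho> t = exp (- \<gamma> * t))"

end

theory Submission
  imports Defs
begin

text \<open>
  Fix a small scale ratio \<open>\<delta>\<close> and, for every k, a maximal \<open>\<delta> powi k\<close>-separated set. Averaging a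
  function against a Lipschitz partition of unity subordinate to such a net multiplies its Lipschitz
  constant by at most a factor independent of the scale. Iterating the averages over finer and finer
  scales therefore yields refinable splines that are Hoelder-continuous of any exponent
  \<open>\<eta> < 1\<close>, provided \<open>\<delta>\<close> is small enough in terms of \<open>\<eta>\<close>. Near its own net point every
  spline equals 1, so the splines of level k, together with those splines of level k + 1 whose net
  point is not the chosen child of a point of level k, form a Riesz family spanning the (k + 1)-st
  space of a multiresolution analysis. Orthogonalising the new splines, first against level k and then
  against each other along an arbitrary enumeration, gives the wavelets. Each orthogonalisation is a
  Neumann iteration in which supports grow linearly while corrections decay geometrically in
  \<open>L\<^sup>2\<close>, and this gives the exponential localisation.
\<close>

section \<open>Square-integrable functions and closed spans\<close>

text \<open>An average over the next finer scale may enlarge Lipschitz constants by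
  \<open>clip\<close>, but it moves information only over a distance that is smaller by \<delta>.
  The increments of the iteration therefore contract by \<open>clip * \<delta>\<close>, and
  \<open>clip * \<delta> \<le> \<delta> powr \<eta>\<close> converts this into the exponent \<eta>.
  Since \<open>clip\<close> exceeds 1, the exponent 1 is out of reach and \<delta> must depend on
  \<eta>. Nets of different scales are unrelated. In place of nestedness, each coarse point picks a
  nearby fine point, and a coarse spline is constant near every fine net point. Evaluating a
  combination at fine points then gives a triangular system, whence the Riesz bound. The residual
  estimates hold for every index subset, with constants independent of the subset and of the scale;
  hence infinitely many splines can be orthogonalised in any order without loss of decay. At the
  coarse end two cases remain. In an unbounded space the coarse components must vanish in the limit,
  which rests on infinite total mass; in a bounded space the coarsest level consists of constants,
  which the mean-zero condition removes.\<close>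

abbreviation L2 :: "'a measure \<Rightarrow> ('a \<Rightarrow> real) set" where "L2 \<equiv> L2_functions"

definition l2n :: "'a measure \<Rightarrow> ('a \<Rightarrow> real) \<Rightarrow> real" where
  "l2n M f = sqrt (\<integral>x. (f x)\<^sup>2 \<partial>M)"

lemma L2_measurable: "f \<in> L2 M \<Longrightarrow> f \<in> borel_measurable M"
  and L2_square: "f \<in> L2 M \<Longrightarrow> integrable M (\<lambda>x. (f x)\<^sup>2)"
  by (auto simp: L2_functions_def)

lemma L2_I:
  assumes "f \<in> borel_measurable M" "integrable M (\<lambda>x. (f x)\<^sup>2)"
  shows "f \<in> L2 M"
  using assms by (auto simp: L2_functions_def)

lemma L2_bound:
  assumes "g \<in> L2 M" "f \<in> borel_measurable M" "\<And>x. \<bar>f x\<bar> \<le> \<bar>g x\<bar>"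
  shows "f \<in> L2 M"
proof (rule L2_I[OF assms(2)])
  show "integrable M (\<lambda>x. (f x)\<^sup>2)"
  proof (rule Bochner_Integration.integrable_bound[OF L2_square[OF assms(1)]])
    show "AE x in M. norm ((f x)\<^sup>2) \<le> norm ((g x)\<^sup>2)"
      using assms(3) by (auto simp: abs_le_square_iff)
  qed (use assms(2) in measurable)
qed

lemma L2_mult_integrable:
  assumes "f \<in> L2 M" "g \<in> L2 M"
  shows "integrable M (\<lambda>x. f x * g x)"
proof (rule Bochner_Integration.integrable_bound)
  show "integrable M (\<lambda>x. (f x)\<^sup>2 + (g x)\<^sup>2)"
    using assms by (intro Bochner_Integration.integrable_add L2_square)
  show "(\<lambda>x. f x * g x) \<in> borel_measurable M"
    using assms[THEN L2_measurable] by measurable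
  have "\<bar>a * b\<bar> \<le> a\<^sup>2 + b\<^sup>2" for a b :: real
  proof -
    have "2 * \<bar>a\<bar> * \<bar>b\<bar> \<le> a\<^sup>2 + b\<^sup>2"
      using sum_squares_bound[of "\<bar>a\<bar>" "\<bar>b\<bar>"] by simp
    moreover have "0 \<le> \<bar>a\<bar> * \<bar>b\<bar>" by simp
    ultimately show ?thesis unfolding abs_mult by linarith
  qed
  then show "AE x in M. norm (f x * g x) \<le> norm ((f x)\<^sup>2 + (g x)\<^sup>2)"
    by auto
qed

lemma L2_zero [simp]: "(\<lambda>x. 0) \<in> L2 M"
  by (auto intro: L2_I)

lemma L2_cmult:
  assumes "f \<in> L2 M"
  shows "(\<lambda>x. c * f x) \<in> L2 M"
proof (rule L2_I)
  show "(\<lambda>x. c * f x) \<in> borel_measurable M"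
    using L2_measurable[OF assms] by measurable
qed (use L2_square[OF assms] in \<open>simp add: power_mult_distrib\<close>)

lemma L2_add:
  assumes "f \<in> L2 M" "g \<in> L2 M"
  shows "(\<lambda>x. f x + g x) \<in> L2 M"
proof (rule L2_I)
  show "(\<lambda>x. f x + g x) \<in> borel_measurable M"
    using assms[THEN L2_measurable] by measurable
  have "(\<lambda>x. (f x + g x)\<^sup>2) = (\<lambda>x. (f x)\<^sup>2 + 2 * (f x * g x) + (g x)\<^sup>2)"
    by (auto simp: power2_eq_square algebra_simps)
  then show "integrable M (\<lambda>x. (f x + g x)\<^sup>2)"
    using assms by (simp add: L2_square L2_mult_integrable)
qed

lemma L2_diff:
  assumes "f \<in> L2 M" "g \<in> L2 M"
  shows "(\<lambda>x. f x - g x) \<in> L2 M"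
  using L2_add[OF assms(1) L2_cmult[OF assms(2), of "-1"]] by simp

lemma L2_sum:
  assumes "\<And>i. i \<in> J \<Longrightarrow> f i \<in> L2 M"
  shows "(\<lambda>x. \<Sum>i\<in>J. c i * f i x) \<in> L2 M"
  using assms by (induction J rule: infinite_finite_induct) (auto intro!: L2_add L2_cmult)

lemma l2n_nonneg [simp]: "0 \<le> l2n M f"
  by (simp add: l2n_def)

lemma l2n_square: "(l2n M f)\<^sup>2 = (\<integral>x. (f x)\<^sup>2 \<partial>M)"
  by (simp add: l2n_def)

lemma L2_CS2:
  assumes f: "f \<in> L2 M" and g: "g \<in> L2 M"
  shows "(\<integral>x. f x * g x \<partial>M)\<^sup>2 \<le> (\<integral>x. (f x)\<^sup>2 \<partial>M) * (\<integral>x. (g x)\<^sup>2 \<partial>M)"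
proof -
  let ?a = "\<integral>x. (f x)\<^sup>2 \<partial>M" and ?b = "\<integral>x. f x * g x \<partial>M" and ?c = "\<integral>x. (g x)\<^sup>2 \<partial>M"
  have q: "0 \<le> ?a + 2 * t * ?b + t\<^sup>2 * ?c" for t
  proof -
    have "0 \<le> (\<integral>x. (f x + t * g x)\<^sup>2 \<partial>M)" by simp
    also have "(\<lambda>x. (f x + t * g x)\<^sup>2) = (\<lambda>x. (f x)\<^sup>2 + (2 * t) * (f x * g x) + t\<^sup>2 * (g x)\<^sup>2)"
      by (auto simp: power2_eq_square algebra_simps)
    also have "(\<integral>x. (f x)\<^sup>2 + (2 * t) * (f x * g x) + t\<^sup>2 * (g x)\<^sup>2 \<partial>M) = ?a + 2 * t * ?b + t\<^sup>2 * ?c"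
      using f g by (simp add: L2_square L2_mult_integrable)
    finally show ?thesis .
  qed
  have c0: "?c \<ge> 0" and a0: "?a \<ge> 0" by simp_all
  show ?thesis
  proof (cases "?c = 0")
    case True
    have "?b = 0"
    proof (rule ccontr)
      assume b: "?b \<noteq> 0"
      \<comment> \<open>With \<open>?c = 0\<close> the quadratic is affine in \<open>t\<close>, and
        this choice of \<open>t\<close> gives it the negative value \<open>- ?a - 2\<close>.\<close>
      have "0 \<le> ?a + 2 * (- (?a + 1) / ?b) * ?b" using q[of "- (?a + 1) / ?b"] True by simp
      also have "\<dots> = ?a - 2 * (?a + 1)" using b by simp
      finally show False using a0 by simp
    qed
    then show ?thesis using True by simp
  next
    case False
    then have c: "?c > 0" using c0 by (metis order_le_imp_less_or_eq)
    have "0 \<le> ?a + 2 * (- ?b / ?c) * ?b + (- ?b / ?c)\<^sup>2 * ?c" by (rule q)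
    also have "\<dots> = ?a - ?b\<^sup>2 / ?c"
      using c by (simp add: power2_eq_square field_simps)
    finally show ?thesis using c by (simp add: field_simps)
  qed
qed

lemma L2_CS:
  assumes f: "f \<in> L2 M" and g: "g \<in> L2 M"
  shows "\<bar>\<integral>x. f x * g x \<partial>M\<bar> \<le> l2n M f * l2n M g"
proof -
  have "(\<integral>x. f x * g x \<partial>M)\<^sup>2 \<le> (l2n M f * l2n M g)\<^sup>2"
    using L2_CS2[OF f g] by (simp add: power_mult_distrib l2n_square)
  then show ?thesis using abs_le_square_iff[of "\<integral>x. f x * g x \<partial>M" "l2n M f * l2n M g"] by simp
qed

lemma integral_square_add:
  assumes f: "f \<in> L2 M" and g: "g \<in> L2 M"
  shows "(\<integral>x. (f x + c * g x)\<^sup>2 \<partial>M)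
    = (\<integral>x. (f x)\<^sup>2 \<partial>M) + 2 * c * (\<integral>x. f x * g x \<partial>M) + c\<^sup>2 * (\<integral>x. (g x)\<^sup>2 \<partial>M)"
proof -
  have "(\<lambda>x. (f x + c * g x)\<^sup>2) = (\<lambda>x. (f x)\<^sup>2 + (2 * c) * (f x * g x) + c\<^sup>2 * (g x)\<^sup>2)"
    by (auto simp: power2_eq_square algebra_simps)
  then show ?thesis using f g by (simp add: L2_square L2_mult_integrable)
qed

lemma l2n_triangle:
  assumes f: "f \<in> L2 M" and g: "g \<in> L2 M"
  shows "l2n M (\<lambda>x. f x + g x) \<le> l2n M f + l2n M g"
proof (rule power2_le_imp_le)
  have "(l2n M (\<lambda>x. f x + g x))\<^sup>2 = (l2n M f)\<^sup>2 + 2 * (\<integral>x. f x * g x \<partial>M) + (l2n M g)\<^sup>2"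
    using integral_square_add[OF f g, of 1] by (simp add: l2n_square)
  also have "\<dots> \<le> (l2n M f + l2n M g)\<^sup>2"
    using L2_CS[OF f g] by (simp add: power2_eq_square algebra_simps)
  finally show "(l2n M (\<lambda>x. f x + g x))\<^sup>2 \<le> (l2n M f + l2n M g)\<^sup>2" .
qed simp

lemma l2n_cmult: "l2n M (\<lambda>x. c * f x) = \<bar>c\<bar> * l2n M f"
  by (simp add: l2n_def power_mult_distrib real_sqrt_mult)

lemma l2n_minus_commute: "l2n M (\<lambda>x. f x - g x) = l2n M (\<lambda>x. g x - f x)"
  by (simp add: l2n_def power2_commute)

lemma l2n_triangle_diff:
  assumes "f \<in> L2 M" "g \<in> L2 M" "h \<in> L2 M"
  shows "l2n M (\<lambda>x. f x - h x) \<le> l2n M (\<lambda>x. f x - g x) + l2n M (\<lambda>x. g x - h x)"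
  using l2n_triangle[OF L2_diff[OF assms(1,2)] L2_diff[OF assms(2,3)]] by simp

lemma integral_sum_mult:
  assumes "\<And>i. i \<in> J \<Longrightarrow> f i \<in> L2 M" "g \<in> L2 M"
  shows "(\<integral>x. (\<Sum>i\<in>J. c i * f i x) * g x \<partial>M) = (\<Sum>i\<in>J. c i * (\<integral>x. f i x * g x \<partial>M))"
proof -
  have "(\<integral>x. (\<Sum>i\<in>J. c i * f i x) * g x \<partial>M) = (\<integral>x. (\<Sum>i\<in>J. c i * (f i x * g x)) \<partial>M)"
    by (simp add: sum_distrib_right mult.assoc)
  also have "\<dots> = (\<Sum>i\<in>J. \<integral>x. c i * (f i x * g x) \<partial>M)"
    using assms by (intro Bochner_Integration.integral_sum integrable_mult_right L2_mult_integrable) auto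
  finally show ?thesis by simp
qed

text \<open>Closed linear spans, given inductively so that inclusions and orthogonality relations
  follow by rule induction.\<close>

inductive_set cspan :: "'a measure \<Rightarrow> ('a \<Rightarrow> real) set \<Rightarrow> ('a \<Rightarrow> real) set"
  for M :: "'a measure" and F :: "('a \<Rightarrow> real) set" where
  base: "f \<in> F \<Longrightarrow> f \<in> cspan M F"
| zero: "(\<lambda>x. 0) \<in> cspan M F"
| add: "g \<in> cspan M F \<Longrightarrow> h \<in> cspan M F \<Longrightarrow> (\<lambda>x. g x + c * h x) \<in> cspan M F"
| lim: "g \<in> L2 M \<Longrightarrow> \<forall>e>0. \<exists>h. h \<in> cspan M F \<and> l2n M (\<lambda>x. g x - h x) < e \<Longrightarrow>
    g \<in> cspan M F"

lemma cspan_L2: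
  assumes "F \<subseteq> L2 M" "g \<in> cspan M F"
  shows "g \<in> L2 M"
  using assms(2) by induction (use assms(1) in \<open>auto intro: L2_add L2_cmult\<close>)

lemma cspan_mono:
  assumes "F \<subseteq> cspan M G" "g \<in> cspan M F"
  shows "g \<in> cspan M G"
  using assms(2)
proof induction
  case (lim g)
  then show ?case by (intro cspan.lim) blast+
qed (use assms(1) in \<open>auto intro: cspan.zero cspan.add\<close>)

lemma cspan_sum:
  assumes "\<And>i. i \<in> J \<Longrightarrow> f i \<in> cspan M F"
  shows "(\<lambda>x. \<Sum>i\<in>J. c i * f i x) \<in> cspan M F"
  using assms
proof (induction J rule: infinite_finite_induct)
  case (insert i J)
  have "(\<lambda>x. (\<Sum>i\<in>J. c i * f i x) + c i * f i x) \<in> cspan M F"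
    using insert by (intro cspan.add) auto
  then show ?case using insert by (simp add: add.commute)
qed (auto intro: cspan.zero)

lemma cspan_cmult:
  assumes "f \<in> cspan M F"
  shows "(\<lambda>x. c * f x) \<in> cspan M F"
  using cspan.add[OF cspan.zero assms, of c] by simp

lemma cspan_diff:
  assumes "f \<in> cspan M F" "g \<in> cspan M F"
  shows "(\<lambda>x. f x - g x) \<in> cspan M F"
  using cspan.add[OF assms, of "-1"] by simp

text \<open>The annihilator of \<psi> is a closed subspace: the rule \<open>add\<close> is handled
  by linearity, the rule \<open>lim\<close> by Cauchy--Schwarz.\<close>

lemma cspan_orthogonal:
  assumes F: "F \<subseteq> L2 M" and g: "g \<in> cspan M F" and \<psi>: "\<psi> \<in> L2 M"
    and orth: "\<And>f. f \<in> F \<Longrightarrow> (\<integral>x. \<psi> x * f x \<partial>M) = 0"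
  shows "(\<integral>x. \<psi> x * g x \<partial>M) = 0"
  using g
proof induction
  case (add g h c)
  have "(\<integral>x. \<psi> x * (g x + c * h x) \<partial>M) = (\<integral>x. \<psi> x * g x + c * (\<psi> x * h x) \<partial>M)"
    by (simp add: algebra_simps)
  also have "\<dots> = (\<integral>x. \<psi> x * g x \<partial>M) + c * (\<integral>x. \<psi> x * h x \<partial>M)"
    using L2_mult_integrable[OF \<psi> cspan_L2[OF F]] add.hyps by simp
  finally show ?case using add.IH by simp
next
  case (lim g)
  have "\<bar>\<integral>x. \<psi> x * g x \<partial>M\<bar> \<le> 0 + e" if e: "e > 0" for e
  proof -
    \<comment> \<open>The added 1 keeps the quotient meaningful when \<psi> has norm 0.\<close>
    have "e / (l2n M \<psi> + 1) > 0" using e by (intro divide_pos_pos) (auto intro: add_nonneg_pos)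
    then obtain h where h: "h \<in> cspan M F" "(\<integral>x. \<psi> x * h x \<partial>M) = 0"
        "l2n M (\<lambda>x. g x - h x) < e / (l2n M \<psi> + 1)"
      using lim(2) by blast
    have hL: "h \<in> L2 M" using cspan_L2[OF F h(1)] .
    have "(\<integral>x. \<psi> x * g x \<partial>M) = (\<integral>x. \<psi> x * (g x - h x) \<partial>M)"
      using L2_mult_integrable[OF \<psi> lim(1)] L2_mult_integrable[OF \<psi> hL] h(2)
      by (simp add: right_diff_distrib)
    then have "\<bar>\<integral>x. \<psi> x * g x \<partial>M\<bar> \<le> l2n M \<psi> * l2n M (\<lambda>x. g x - h x)"
      using L2_CS[OF \<psi> L2_diff[OF lim(1) hL]] by simp
    also have "\<dots> \<le> (l2n M \<psi> + 1) * (e / (l2n M \<psi> + 1))"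
      using h(3) by (intro mult_mono) (auto intro: less_imp_le)
    also have "\<dots> = e"
      using l2n_nonneg[of M \<psi>] by (simp add: add_nonneg_eq_0_iff)
    finally show ?thesis by simp
  qed
  then have "\<bar>\<integral>x. \<psi> x * g x \<partial>M\<bar> \<le> 0" by (rule field_le_epsilon)
  then show ?case by simp
qed (auto simp: orth)

text \<open>Leads from the inductive closed span to the density clause of
  \<open>orthonormal_basis_L20\<close>. The generators are indexed, not collected in a set, because
  coefficients are attached to indices.\<close>

lemma cspan_finite_combination:
  fixes f :: "'i \<Rightarrow> 'a \<Rightarrow> real"
  assumes F: "\<And>i. i \<in> I \<Longrightarrow> f i \<in> L2 M" and g: "g \<in> cspan M (f ` I)" and e: "e > 0"
  obtains J c where "finite J" "J \<subseteq> I" "l2n M (\<lambda>x. g x - (\<Sum>i\<in>J. c i * f i x)) < e"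
proof -
  have FL: "f ` I \<subseteq> L2 M" using F by auto
  have "\<forall>e>0. \<exists>J c. finite J \<and> J \<subseteq> I \<and> l2n M (\<lambda>x. g x - (\<Sum>i\<in>J. c i * f i x)) < e"
    using g
  proof induction
    case (base g)
    then obtain i where i: "i \<in> I" "g = f i" by auto
    show ?case
      by (intro allI impI exI[of _ "{i}"] exI[of _ "\<lambda>_. 1"]) (use i in \<open>simp add: l2n_def\<close>)
  next
    case zero
    show ?case
      by (intro allI impI exI[of _ "{}"]) (simp add: l2n_def)
  next
    case (add g h c)
    show ?case
    proof (intro allI impI)
      fix e :: real assume e: "e > 0"
      obtain J a where J: "finite J" "J \<subseteq> I" "l2n M (\<lambda>x. g x - (\<Sum>i\<in>J. a i * f i x)) < e / 2"
        using add.IH(1) e by (meson half_gt_zero)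
      have "e / (2 * (\<bar>c\<bar> + 1)) > 0" using e by (simp add: add_nonneg_pos)
      then obtain J' b where J': "finite J'" "J' \<subseteq> I"
          "l2n M (\<lambda>x. h x - (\<Sum>i\<in>J'. b i * f i x)) < e / (2 * (\<bar>c\<bar> + 1))"
        using add.IH(2) by meson
      \<comment> \<open>Both combinations are padded with zero coefficients so that they run over
        the common index set \<open>J \<union> J'\<close>.\<close>
      define a' where "a' i = (if i \<in> J then a i else 0)" for i
      define b' where "b' i = (if i \<in> J' then b i else 0)" for i
      have eq1: "(\<Sum>i\<in>J. a i * f i x) = (\<Sum>i\<in>J \<union> J'. a' i * f i x)" for x
        unfolding a'_def using J J' by (intro sum.mono_neutral_cong_left) auto
      have eq2: "(\<Sum>i\<in>J'. b i * f i x) = (\<Sum>i\<in>J \<union> J'. b' i * f i x)" for x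
        unfolding b'_def using J J' by (intro sum.mono_neutral_cong_left) auto
      have gL: "g \<in> L2 M" "h \<in> L2 M"
        using add.hyps by (auto intro: cspan_L2[OF FL])
      have d1: "(\<lambda>x. g x - (\<Sum>i\<in>J. a i * f i x)) \<in> L2 M"
        using J F gL by (intro L2_diff L2_sum) auto
      have d2: "(\<lambda>x. c * (h x - (\<Sum>i\<in>J'. b i * f i x))) \<in> L2 M"
        using J' F gL by (intro L2_cmult L2_diff L2_sum) auto
      have "l2n M (\<lambda>x. (g x + c * h x) - (\<Sum>i\<in>J \<union> J'. (a' i + c * b' i) * f i x))
          = l2n M (\<lambda>x. (g x - (\<Sum>i\<in>J. a i * f i x)) + c * (h x - (\<Sum>i\<in>J'. b i * f i x)))"
        unfolding eq1 eq2
        by (simp add: algebra_simps sum.distrib sum_distrib_left)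
      also have "\<dots> \<le> l2n M (\<lambda>x. g x - (\<Sum>i\<in>J. a i * f i x)) + \<bar>c\<bar> * l2n M (\<lambda>x. h x - (\<Sum>i\<in>J'. b i * f i x))"
        using l2n_triangle[OF d1 d2] by (simp add: l2n_cmult)
      also have "\<dots> < e / 2 + (\<bar>c\<bar> + 1) * (e / (2 * (\<bar>c\<bar> + 1)))"
        using J(3) J'(3) by (intro add_less_le_mono mult_mono) auto
      also have "\<dots> = e"
      proof -
        have "\<bar>c\<bar> + 1 \<noteq> 0" using abs_ge_zero[of c] by linarith
        then show ?thesis by (simp add: field_simps)
      qed
      finally show "\<exists>J c'. finite J \<and> J \<subseteq> I \<and> l2n M (\<lambda>x. (g x + c * h x) - (\<Sum>i\<in>J. c' i * f i x)) < e"
        using J J' by (intro exI[of _ "J \<union> J'"] exI[of _ "\<lambda>i. a' i + c * b' i"]) auto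
    qed
  next
    case (lim g)
    show ?case
    proof (intro allI impI)
      fix e :: real assume e: "e > 0"
      then obtain h where h: "h \<in> cspan M (f ` I)" "l2n M (\<lambda>x. g x - h x) < e / 2"
          "\<forall>e>0. \<exists>J c. finite J \<and> J \<subseteq> I \<and> l2n M (\<lambda>x. h x - (\<Sum>i\<in>J. c i * f i x)) < e"
        using lim(2) by (meson half_gt_zero)
      then obtain J c where J: "finite J" "J \<subseteq> I" "l2n M (\<lambda>x. h x - (\<Sum>i\<in>J. c i * f i x)) < e / 2"
        using e by (meson half_gt_zero)
      have "h \<in> L2 M" using cspan_L2[OF FL h(1)] .
      then have "l2n M (\<lambda>x. g x - (\<Sum>i\<in>J. c i * f i x)) < e"
        using l2n_triangle_diff[OF lim(1), of h "\<lambda>x. \<Sum>i\<in>J. c i * f i x"] h(2) J F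
        by (fastforce intro!: L2_sum)
      then show "\<exists>J c. finite J \<and> J \<subseteq> I \<and> l2n M (\<lambda>x. g x - (\<Sum>i\<in>J. c i * f i x)) < e"
        using J by blast
    qed
  qed
  then show ?thesis using e that by blast
qed

lemma l2n_tendsto_zero:
  assumes G: "G \<in> L2 M" and g: "\<And>n. g n \<in> borel_measurable M"
    and lim: "\<And>x. x \<in> space M \<Longrightarrow> (\<lambda>n. g n x) \<longlonglongrightarrow> h x" and dom: "\<And>n x. \<bar>g n x\<bar> \<le> G x"
  shows "(\<lambda>n. l2n M (\<lambda>x. h x - g n x)) \<longlonglongrightarrow> 0" "h \<in> L2 M"
proof -
  have hm: "h \<in> borel_measurable M"
    using g lim by (rule borel_measurable_LIMSEQ_real[rotated])
  have hG: "\<bar>h x\<bar> \<le> G x" if "x \<in> space M" for x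
    using tendsto_rabs[OF lim[OF that]] dom by (auto intro: LIMSEQ_le_const2)
  have "(\<lambda>n. \<integral>x. (h x - g n x)\<^sup>2 \<partial>M) \<longlonglongrightarrow> (\<integral>x. 0 \<partial>M)"
  proof (rule integral_dominated_convergence[where w = "\<lambda>x. (2 * G x)\<^sup>2"])
    show "integrable M (\<lambda>x. (2 * G x)\<^sup>2)"
      using L2_square[OF L2_cmult[OF G, of 2]] .
    show "AE x in M. (\<lambda>i. (h x - g i x)\<^sup>2) \<longlonglongrightarrow> 0"
    proof (rule AE_I2)
      fix x assume "x \<in> space M"
      then have "(\<lambda>i. (h x - g i x)\<^sup>2) \<longlonglongrightarrow> (h x - h x)\<^sup>2"
        by (intro tendsto_intros lim)
      then show "(\<lambda>i. (h x - g i x)\<^sup>2) \<longlonglongrightarrow> 0" by simp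
    qed
    show "AE x in M. norm ((h x - g i x)\<^sup>2) \<le> (2 * G x)\<^sup>2" for i
    proof (rule AE_I2)
      fix x assume x: "x \<in> space M"
      have "\<bar>h x - g i x\<bar> \<le> 2 * G x" using hG[OF x] dom[of i x] by linarith
      then show "norm ((h x - g i x)\<^sup>2) \<le> (2 * G x)\<^sup>2"
        using power_mono[of "\<bar>h x - g i x\<bar>" "2 * G x" 2] by simp
    qed
  qed (use hm g in measurable)
  then show "(\<lambda>n. l2n M (\<lambda>x. h x - g n x)) \<longlonglongrightarrow> 0"
    unfolding l2n_def using tendsto_real_sqrt by fastforce
  show "h \<in> L2 M"
  proof (rule L2_I[OF hm])
    show "integrable M (\<lambda>x. (h x)\<^sup>2)"
    proof (rule Bochner_Integration.integrable_bound[OF L2_square[OF G]])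
      show "AE x in M. norm ((h x)\<^sup>2) \<le> norm ((G x)\<^sup>2)"
      proof (rule AE_I2)
        fix x assume "x \<in> space M"
        from hG[OF this] show "norm ((h x)\<^sup>2) \<le> norm ((G x)\<^sup>2)"
          using power_mono[of "\<bar>h x\<bar>" "G x" 2] by simp
      qed
    qed (use hm in measurable)
  qed
qed

text \<open>Serves all density arguments: pointwise convergence under one square-integrable majorant
  replaces norm estimates.\<close>

lemma cspan_dominated_limit:
  assumes F: "F \<subseteq> L2 M" and g: "\<And>n. g n \<in> cspan M F" and G: "G \<in> L2 M"
    and lim: "\<And>x. x \<in> space M \<Longrightarrow> (\<lambda>n. g n x) \<longlonglongrightarrow> h x" and dom: "\<And>n x. \<bar>g n x\<bar> \<le> G x"
  shows "h \<in> cspan M F"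
proof (rule cspan.lim)
  have gm: "g n \<in> borel_measurable M" for n using L2_measurable[OF cspan_L2[OF F g]] .
  note * = l2n_tendsto_zero[OF G gm lim dom]
  show "h \<in> L2 M" by (rule *(2))
  show "\<forall>e>0. \<exists>k. k \<in> cspan M F \<and> l2n M (\<lambda>x. h x - k x) < e"
  proof (intro allI impI)
    fix e :: real assume "e > 0"
    then have "eventually (\<lambda>n. l2n M (\<lambda>x. h x - g n x) < e) sequentially"
      using order_tendstoD(2)[OF *(1)] by blast
    then obtain n where "l2n M (\<lambda>x. h x - g n x) < e"
      using eventually_happens'[OF sequentially_bot] by blast
    then show "\<exists>k. k \<in> cspan M F \<and> l2n M (\<lambda>x. h x - k x) < e" using g by blast
  qed
qed

section \<open>Nets and Lipschitz partitions of unity\<close>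

definition is_net :: "real \<Rightarrow> 'a::metric_space set \<Rightarrow> bool" where
  "is_net r X \<longleftrightarrow> (\<forall>x\<in>X. \<forall>y\<in>X. x \<noteq> y \<longrightarrow> r \<le> dist x y) \<and> (\<forall>x. \<exists>y\<in>X. dist x y < r)"

text \<open>Zorn yields a maximal separated set, and maximality gives the covering: a point at
  distance at least \<open>r\<close> from the whole set could be added to it.\<close>

lemma is_net_exists:
  assumes r: "r > 0"
  shows "\<exists>X :: 'a::metric_space set. is_net r X"
proof -
  let ?A = "{X :: 'a set. \<forall>x\<in>X. \<forall>y\<in>X. x \<noteq> y \<longrightarrow> r \<le> dist x y}"
  have "\<Union>C \<in> ?A" if C: "subset.chain ?A C" for C
  proof -
    have C': "X \<in> ?A" if "X \<in> C" for X using C that unfolding subset_chain_def by (meson subsetD)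
    have "r \<le> dist x y" if xy: "x \<in> \<Union>C" "y \<in> \<Union>C" "x \<noteq> y" for x y
    proof -
      obtain X Y where XY: "x \<in> X" "X \<in> C" "y \<in> Y" "Y \<in> C" using xy by auto
      then have "X \<subseteq> Y \<or> Y \<subseteq> X" using C unfolding subset_chain_def by metis
      then obtain Z where "Z \<in> C" "x \<in> Z" "y \<in> Z" using XY by auto
      then show ?thesis using C'[of Z] xy(3) by simp
    qed
    then show ?thesis by simp
  qed
  then obtain X where X: "X \<in> ?A" "\<And>Y. Y \<in> ?A \<Longrightarrow> X \<subseteq> Y \<Longrightarrow> Y = X"
    by (metis (no_types, lifting) subset_Zorn'[of ?A])
  have "\<exists>y\<in>X. dist x y < r" for x
  proof (rule ccontr)
    assume "\<not> (\<exists>y\<in>X. dist x y < r)"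
    then have far: "r \<le> dist x y" if "y \<in> X" for y using that by force
    then have "insert x X \<in> ?A" using X(1) by (auto simp: dist_commute)
    then have "insert x X = X" by (rule X(2)) auto
    then show False using far[of x] r by auto
  qed
  then show ?thesis using X(1) unfolding is_net_def by blast
qed

section \<open>Volume growth and nets under a doubling measure\<close>

locale doubling =
  fixes M :: "'a::metric_space measure" and p :: nat
  assumes sets_M: "sets M = sets borel"
    and emeasure_ball_finite: "emeasure M (ball x r) < \<infinity>"
    and ball_pos: "r > 0 \<Longrightarrow> 0 < measure M (ball x r)"
    and ball_double: "r > 0 \<Longrightarrow> measure M (ball x (2 * r)) \<le> 2 ^ p * measure M (ball x r)"
begin

lemma space_M [simp]: "space M = UNIV"
  using sets_eq_imp_space_eq[OF sets_M] by simp

abbreviation vol :: "'a \<Rightarrow> real \<Rightarrow> real" where "vol x r \<equiv> measure M (ball x r)"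

abbreviation ip :: "('a \<Rightarrow> real) \<Rightarrow> ('a \<Rightarrow> real) \<Rightarrow> real" where
  "ip g h \<equiv> (\<integral>x. g x * h x \<partial>M)"

abbreviation sq :: "('a \<Rightarrow> real) \<Rightarrow> real" where "sq g \<equiv> (\<integral>x. (g x)\<^sup>2 \<partial>M)"

lemma ball_sets [measurable, simp]: "ball x r \<in> sets M"
  by (simp add: sets_M)

lemma borel_measurable_M: "borel_measurable M = borel_measurable borel"
  by (rule measurable_cong_sets) (simp_all add: sets_M)

lemma ball_fmeasurable [simp]: "ball x r \<in> fmeasurable M"
  using emeasure_ball_finite by (intro fmeasurableI) auto

lemma ball_mono:
  assumes "dist x y + s \<le> t"
  shows "vol y s \<le> vol x t"
proof (rule measure_mono_fmeasurable)
  show "ball y s \<subseteq> ball x t"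
  proof
    fix z assume "z \<in> ball y s"
    then show "z \<in> ball x t" using dist_triangle[of x z y] assms by simp
  qed
qed auto

lemma ball_pow2:
  assumes "t > 0"
  shows "vol x (2 ^ j * t) \<le> (2 ^ j) ^ p * vol x t"
proof (induction j)
  case (Suc j)
  have "vol x (2 ^ Suc j * t) \<le> 2 ^ p * vol x (2 ^ j * t)"
    using ball_double[of "2 ^ j * t" x] assms by (simp add: mult.assoc)
  also have "\<dots> \<le> 2 ^ p * ((2 ^ j) ^ p * vol x t)"
    using Suc by (intro mult_left_mono) auto
  finally show ?case by (simp add: power_mult_distrib mult.assoc)
qed simp

text \<open>With the doubling constant written as \<open>2 ^ p\<close>, the number \<open>p\<close>
  becomes a growth exponent, and comparing balls with different centres costs a polynomial factor.
  The factor 2 comes from rounding \<open>l\<close> up to a power of 2.\<close>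

lemma ball_growth:
  assumes t: "t > 0" and l: "l \<ge> 1" and d: "dist x y + s \<le> l * t"
  shows "vol y s \<le> (2 * l) ^ p * vol x t"
proof -
  define j where "j = (LEAST j. l \<le> (2::real) ^ j)"
  have ex: "\<exists>j. l \<le> (2::real) ^ j"
    using real_arch_pow[of 2 l] by (auto intro: less_imp_le)
  have j1: "l \<le> 2 ^ j" unfolding j_def using ex by (rule LeastI_ex)
  have j2: "2 ^ j \<le> 2 * l"
  proof (cases j)
    case 0 then show ?thesis using l by simp
  next
    case (Suc i)
    then have "\<not> l \<le> 2 ^ i" using not_less_Least[of i "\<lambda>j. l \<le> (2::real) ^ j"] j_def by simp
    then show ?thesis using Suc by simp
  qed
  have "vol y s \<le> vol x (2 ^ j * t)"
  proof (rule ball_mono)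
    have "l * t \<le> 2 ^ j * t" using j1 t by simp
    then show "dist x y + s \<le> 2 ^ j * t" using d by linarith
  qed
  also have "\<dots> \<le> (2 ^ j) ^ p * vol x t" by (rule ball_pow2[OF t])
  also have "\<dots> \<le> (2 * l) ^ p * vol x t"
    using j2 by (intro mult_right_mono power_mono) auto
  finally show ?thesis .
qed

text \<open>One net is chosen independently for each radius, so nets of different radii are in
  general not nested.\<close>

definition net :: "real \<Rightarrow> 'a set" where
  "net r = (SOME X. is_net r X)"

lemma
  fixes x y :: "'a"
  assumes "r > 0"
  shows net_separated: "x \<in> net r \<Longrightarrow> y \<in> net r \<Longrightarrow> x \<noteq> y \<Longrightarrow> r \<le> dist x y"
    and net_cover: "\<exists>y\<in>net r. dist x y < r"
proof -
  have "is_net r (net r :: 'a set)"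
    unfolding net_def using someI_ex[OF is_net_exists[OF assms]] .
  then show "x \<in> net r \<Longrightarrow> y \<in> net r \<Longrightarrow> x \<noteq> y \<Longrightarrow> r \<le> dist x y"
    and "\<exists>y\<in>net r. dist x y < r" unfolding is_net_def by blast+
qed

definition near :: "real \<Rightarrow> real \<Rightarrow> 'a \<Rightarrow> 'a set" where
  "near r R x = {a \<in> net r. dist x a < R}"

lemma near_subset_net: "near r R x \<subseteq> net r" by (auto simp: near_def)

text \<open>Weights whose normalisation is a Lipschitz partition of unity, each member of which equals 1
  near its own net point.\<close>

definition wt :: "real \<Rightarrow> 'a \<Rightarrow> 'a \<Rightarrow> real" where
  "wt r a x = max 0 (infdist x (net r) + r / 2 - dist x a)"

text \<open>The cutoff \<open>2 * r\<close> exceeds the support radius \<open>3 / 2 * r\<close> of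
  the weights: the sum is finite and no nonzero weight is lost.\<close>

definition wts :: "real \<Rightarrow> 'a \<Rightarrow> real" where
  "wts r x = (\<Sum>a\<in>near r (2 * r) x. wt r a x)"

definition pu :: "real \<Rightarrow> 'a \<Rightarrow> 'a \<Rightarrow> real" where
  "pu r a x = wt r a x / wts r x"

text \<open>Only the values of \<open>h\<close> on the net enter, so every average is a locally
  finite combination of the functions \<open>pu r a\<close>. This is the origin of
  refinability.\<close>

definition avg :: "real \<Rightarrow> ('a \<Rightarrow> real) \<Rightarrow> 'a \<Rightarrow> real" where
  "avg r h x = (\<Sum>a\<in>near r (2 * r) x. h a * pu r a x)"

text \<open>Packing: the balls of radius \<open>r / 2\<close> around \<open>F\<close> are disjoint,
  lie in \<open>ball x ((R + 1/2) * r)\<close>, and each has a fixed fraction of its volume. The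
  constant is \<open>ball_growth\<close> with \<open>l = 4 * R + 1\<close>.\<close>

lemma card_separated:
  assumes r: "r > 0" and R: "R \<ge> 1" and F: "finite F" "\<And>a. a \<in> F \<Longrightarrow> dist x a < R * r"
    and sep: "\<And>a b :: 'a. a \<in> F \<Longrightarrow> b \<in> F \<Longrightarrow> a \<noteq> b \<Longrightarrow> r \<le> dist a b"
  shows "real (card F) \<le> (8 * R + 2) ^ p"
proof -
  let ?m = "vol x ((R + 1/2) * r)"
  have m: "?m > 0" using r R by (intro ball_pos mult_pos_pos) auto
  have "real (card F) * ?m = (\<Sum>a\<in>F. ?m)" by simp
  also have "\<dots> \<le> (\<Sum>a\<in>F. (2 * (4 * R + 1)) ^ p * vol a (r / 2))"
  proof (intro sum_mono ball_growth)
    fix a assume "a \<in> F"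
    from F(2)[OF this] show "dist a x + (R + 1/2) * r \<le> (4 * R + 1) * (r / 2)"
      by (simp add: dist_commute field_simps)
  qed (use r R in auto)
  also have "\<dots> = (8 * R + 2) ^ p * (\<Sum>a\<in>F. vol a (r / 2))"
    by (simp flip: sum_distrib_left)
  also have "(\<Sum>a\<in>F. vol a (r / 2)) = measure M (\<Union>a\<in>F. ball a (r / 2))"
  proof (rule measure_UNION'[symmetric])
    show "pairwise (\<lambda>i j. disjnt (ball i (r / 2)) (ball j (r / 2))) F"
    proof (rule pairwiseI)
      fix i j assume ij: "i \<in> F" "j \<in> F" "i \<noteq> j"
      have False if "dist i z < r / 2" "dist j z < r / 2" for z
        using sep[OF ij] dist_triangle2[of i j z] that by linarith
      then show "disjnt (ball i (r / 2)) (ball j (r / 2))" by (auto simp: disjnt_iff)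
    qed
  qed (use F in auto)
  also have "\<dots> \<le> ?m"
  proof (rule measure_mono_fmeasurable)
    show "(\<Union>a\<in>F. ball a (r / 2)) \<subseteq> ball x ((R + 1/2) * r)"
    proof clarify
      fix a z assume a: "a \<in> F" "z \<in> ball a (r / 2)"
      then show "z \<in> ball x ((R + 1/2) * r)"
        using F(2)[OF a(1)] dist_triangle[of x z a] by (simp add: field_simps)
    qed
  qed (use F in auto)
  finally have "real (card F) * ?m \<le> (8 * R + 2) ^ p * ?m"
    using R by simp
  then show ?thesis using m by simp
qed

lemma
  assumes r: "r > 0" and R: "R \<ge> 1"
  shows finite_near': "finite (near r (R * r) x)"
    and card_near: "real (card (near r (R * r) x)) \<le> (8 * R + 2) ^ p"
proof -
  have *: "real (card F) \<le> (8 * R + 2) ^ p" if "finite F" "F \<subseteq> near r (R * r) x" for F :: "'a set"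
    using that r R by (intro card_separated[of r R F x]) (auto simp: near_def intro: net_separated[OF r])
  show fin: "finite (near r (R * r) x)"
  proof (rule ccontr)
    assume "infinite (near r (R * r) x)"
    then obtain F where "finite F" "card F = Suc (nat \<lceil>(8 * R + 2) ^ p\<rceil>)" "F \<subseteq> near r (R * r) x"
      using infinite_arbitrarily_large by blast
    then show False using * by (smt (verit) of_nat_Suc real_nat_ceiling_ge)
  qed
  show "real (card (near r (R * r) x)) \<le> (8 * R + 2) ^ p"
    using fin by (intro *) auto
qed

lemma finite_near [simp]:
  assumes "r > 0"
  shows "finite (near r R x)"
proof (rule finite_subset)
  have "R \<le> max 1 (R / r) * r"
    using assms mult_right_mono[of "R / r" "max 1 (R / r)" r] by simp
  then show "near r R x \<subseteq> near r (max 1 (R / r) * r) x" by (auto simp: near_def)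
qed (use assms in \<open>auto intro!: finite_near'\<close>)

lemma countable_net:
  assumes "r > 0"
  shows "countable (net r :: 'a set)"
proof -
  fix x0 :: 'a
  have "net r \<subseteq> (\<Union>n. near r (real n) x0)"
    using reals_Archimedean2 by (auto simp: near_def)
  moreover have "countable (\<Union>n. near r (real n) x0)"
    using assms by (intro countable_UN) (auto intro: countable_finite)
  ultimately show ?thesis by (rule countable_subset)
qed

section \<open>Lipschitz bounds for the partition of unity and for averages\<close>

context
  fixes r :: real
  assumes r: "r > 0"
begin

lemma infdist_net: "infdist x (net r) < r"
  using net_cover[OF r, of x] infdist_le by (metis le_less_trans)

lemma wt_nonneg: "0 \<le> wt r a x" by (simp add: wt_def)

lemma wt_zero: "3 / 2 * r \<le> dist x a \<Longrightarrow> wt r a x = 0"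
  using infdist_net[of x] by (simp add: wt_def)

lemma sum_wt:
  assumes "finite F" "near r (2 * r) x \<subseteq> F" "F \<subseteq> net r"
  shows "(\<Sum>a\<in>F. wt r a x) = wts r x"
  unfolding wts_def
proof (rule sum.mono_neutral_right)
  show "\<forall>i\<in>F - near r (2 * r) x. wt r i x = 0"
  proof
    fix i assume "i \<in> F - near r (2 * r) x"
    then have "2 * r \<le> dist x i" using assms(3) by (auto simp: near_def)
    then show "wt r i x = 0" using r by (intro wt_zero) auto
  qed
qed (use assms in auto)

text \<open>A net point whose distance from \<open>x\<close> is within \<open>r / 4\<close> of the
  infimum already has weight at least \<open>r / 4\<close>.\<close>

lemma wts_ge: "r / 4 \<le> wts r x"
proof -
  have ne: "net r \<noteq> ({} :: 'a set)" using net_cover[OF r] by blast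
  have "\<exists>a\<in>net r. dist x a < infdist x (net r) + r / 4"
  proof (rule ccontr)
    assume "\<not> (\<exists>a\<in>net r. dist x a < infdist x (net r) + r / 4)"
    then have "infdist x (net r) + r / 4 \<le> (INF a\<in>net r. dist x a)"
      by (intro cINF_greatest ne) force
    then show False using r infdist_notempty[OF ne, of x] by simp
  qed
  then obtain a where a: "a \<in> net r" "dist x a < infdist x (net r) + r / 4" by blast
  then have "a \<in> near r (2 * r) x" using infdist_net[of x] r by (auto simp: near_def)
  then have "wt r a x \<le> wts r x"
    unfolding wts_def using r by (intro member_le_sum) (auto simp: wt_nonneg)
  then show ?thesis using a(2) by (simp add: wt_def)
qed

lemma wts_pos: "0 < wts r x" using wts_ge[of x] r by linarith

lemma pu_nonneg: "0 \<le> pu r a x"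
  using wt_nonneg[of a x] wts_pos[of x] by (simp add: pu_def)

lemma pu_zero: "3 / 2 * r \<le> dist x a \<Longrightarrow> pu r a x = 0"
  by (simp add: pu_def wt_zero)

lemma sum_pu:
  assumes "finite F" "near r (2 * r) x \<subseteq> F" "F \<subseteq> net r"
  shows "(\<Sum>a\<in>F. pu r a x) = 1"
  using sum_wt[OF assms] wts_pos[of x] by (simp add: pu_def flip: sum_divide_distrib)

lemma sum_pu_le_1:
  assumes "finite F" "F \<subseteq> net r"
  shows "(\<Sum>a\<in>F. pu r a x) \<le> 1"
proof -
  have "(\<Sum>a\<in>F. pu r a x) \<le> (\<Sum>a\<in>F \<union> near r (2 * r) x. pu r a x)"
    using assms r by (intro sum_mono2) (auto simp: pu_nonneg)
  also have "\<dots> = 1"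
    using assms near_subset_net[of r "2 * r" x] r by (intro sum_pu) auto
  finally show ?thesis .
qed

lemma pu_le_1: "a \<in> net r \<Longrightarrow> pu r a x \<le> 1"
  using sum_pu_le_1[of "{a}" x] by simp

text \<open>Explains the summand \<open>r / 2\<close> in \<open>wt\<close>: by separation
  \<open>b\<close> is at least \<open>3 / 4 * r\<close> away from \<open>x\<close>, whereas the
  weights vanish beyond \<open>infdist x (net r) + r / 2\<close>, which is below
  \<open>3 / 4 * r\<close>.\<close>

lemma pu_other:
  assumes a: "a \<in> net r" "dist x a < r / 4" and b: "b \<in> net r" "b \<noteq> a"
  shows "pu r b x = 0"
proof -
  have "r \<le> dist b a" using net_separated[OF r] a b by blast
  moreover have "infdist x (net r) \<le> dist x a" using a(1) by (rule infdist_le)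
  moreover have "dist b a \<le> dist x b + dist x a" by (metis dist_commute dist_triangle)
  ultimately have "infdist x (net r) + r / 2 - dist x b \<le> 0" using a(2) by linarith
  then show ?thesis by (simp add: pu_def wt_def)
qed

lemma pu_one:
  assumes a: "a \<in> net r" "dist x a < r / 4"
  shows "pu r a x = 1"
proof -
  have mem: "a \<in> near r (2 * r) x" using a r by (auto simp: near_def)
  have "1 = (\<Sum>b\<in>near r (2 * r) x. pu r b x)" using r near_subset_net by (intro sum_pu[symmetric]) auto
  also have "\<dots> = (\<Sum>b\<in>{a}. pu r b x)"
    using mem r near_subset_net by (intro sum.mono_neutral_right) (auto intro!: pu_other[OF a])
  finally show ?thesis by simp
qed

lemma wt_lipschitz: "\<bar>wt r a x - wt r a y\<bar> \<le> 2 * dist x y"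
proof -
  have "\<bar>infdist x (net r) - infdist y (net r)\<bar> \<le> dist x y" by (rule infdist_triangle_abs)
  moreover have "\<bar>dist x a - dist y a\<bar> \<le> dist x y"
    by (smt (verit) dist_commute dist_triangle)
  ultimately show ?thesis unfolding wt_def by linarith
qed

definition cpu :: real where "cpu = 8 * (26 ^ p + 1)"

lemma cpu_ge: "16 \<le> cpu" by (simp add: cpu_def)

lemma card_near3: "real (card (near r (3 * r) x)) \<le> 26 ^ p"
  using card_near[OF r, of 3 x] by simp

lemma near_subset_near:
  assumes "dist x y \<le> s"
  shows "near r R y \<subseteq> near r (R + s) x"
proof
  fix a assume "a \<in> near r R y"
  then show "a \<in> near r (R + s) x" using assms dist_triangle[of x a y] by (auto simp: near_def)
qed

text \<open>A quotient rule with the denominator bounded below by \<open>r / 4\<close>. Up to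
  distance \<open>r\<close> all active net points of \<open>x\<close> and \<open>y\<close> lie in
  the ball of radius \<open>3 * r\<close>, which contains at most \<open>26 ^ p\<close> of them;
  beyond that distance the bound is trivial.\<close>

lemma pu_lipschitz:
  assumes a: "a \<in> net r"
  shows "\<bar>pu r a x - pu r a y\<bar> \<le> cpu / r * dist x y"
proof (cases "dist x y < r")
  case False
  have "\<bar>pu r a x - pu r a y\<bar> \<le> 1"
    using pu_nonneg[of a x] pu_nonneg[of a y] pu_le_1[OF a, of x] pu_le_1[OF a, of y] by linarith
  also have "\<dots> \<le> dist x y / r" using False r by simp
  also have "\<dots> \<le> cpu * (dist x y / r)" using cpu_ge r mult_right_mono[of 1 cpu "dist x y / r"] by simp
  finally show ?thesis by simp
next
  case True
  let ?F = "near r (3 * r) x" and ?d = "dist x y"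
  have F: "finite ?F" "near r (2 * r) x \<subseteq> ?F" "near r (2 * r) y \<subseteq> ?F" "?F \<subseteq> net r"
    using r near_subset_near[of x y r "2 * r"] near_subset_near[of x x r "2 * r"] True near_subset_net
    by simp_all
  have "\<bar>wts r x - wts r y\<bar> = \<bar>\<Sum>a\<in>?F. wt r a x - wt r a y\<bar>"
    using sum_wt[of ?F x] sum_wt[of ?F y] F by (simp add: sum_subtractf)
  also have "\<dots> \<le> (\<Sum>a\<in>?F. 2 * ?d)"
    by (rule order_trans[OF sum_abs]) (intro sum_mono wt_lipschitz)
  also have "\<dots> \<le> 26 ^ p * (2 * ?d)"
    using card_near3[of x] mult_right_mono[of "real (card ?F)" "26 ^ p" "2 * ?d"] by simp
  finally have W: "\<bar>wts r x - wts r y\<bar> \<le> 26 ^ p * (2 * ?d)" .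
  have Wx: "wts r x > 0" "wts r y > 0" by (rule wts_pos)+
  have eq: "pu r a x - pu r a y
      = ((wt r a x - wt r a y) + pu r a y * (wts r y - wts r x)) / wts r x"
    using Wx by (simp add: pu_def field_simps)
  have "\<bar>pu r a x - pu r a y\<bar>
      \<le> (\<bar>wt r a x - wt r a y\<bar> + \<bar>pu r a y * (wts r y - wts r x)\<bar>) / wts r x"
    unfolding eq abs_divide using Wx by (simp add: divide_right_mono)
  also have "\<dots> \<le> (2 * ?d + 1 * (26 ^ p * (2 * ?d))) / wts r x"
  proof (intro divide_right_mono add_mono wt_lipschitz)
    show "\<bar>pu r a y * (wts r y - wts r x)\<bar> \<le> 1 * (26 ^ p * (2 * ?d))"
      unfolding abs_mult using W pu_nonneg[of a y] pu_le_1[OF a, of y]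
      by (intro mult_mono) (auto simp: abs_minus_commute)
  qed (use Wx in auto)
  also have "\<dots> \<le> (2 * ?d + 1 * (26 ^ p * (2 * ?d))) / (r / 4)"
    using r Wx wts_ge[of x] by (intro divide_left_mono mult_pos_pos) auto
  also have "\<dots> = cpu / r * ?d" using r by (simp add: cpu_def field_simps)
  finally show ?thesis .
qed

lemma avg_eq:
  assumes "finite F" "near r (2 * r) x \<subseteq> F" "F \<subseteq> net r"
  shows "avg r h x = (\<Sum>a\<in>F. h a * pu r a x)"
  unfolding avg_def
proof (rule sum.mono_neutral_left)
  show "\<forall>i\<in>F - near r (2 * r) x. h i * pu r i x = 0"
  proof
    fix i assume "i \<in> F - near r (2 * r) x"
    then have "2 * r \<le> dist x i" using assms(3) by (auto simp: near_def)
    then show "h i * pu r i x = 0" using r pu_zero[of x i] by auto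
  qed
qed (use assms in auto)

lemma avg_close:
  assumes "\<And>y. dist x y < 2 * r \<Longrightarrow> \<bar>h y - c\<bar> \<le> e"
  shows "\<bar>avg r h x - c\<bar> \<le> e"
proof -
  let ?F = "near r (2 * r) x"
  have s: "(\<Sum>a\<in>?F. pu r a x) = 1" using r near_subset_net by (intro sum_pu) auto
  have "avg r h x - c = (\<Sum>a\<in>?F. h a * pu r a x) - c * (\<Sum>a\<in>?F. pu r a x)"
    unfolding s by (simp add: avg_def)
  also have "\<dots> = (\<Sum>a\<in>?F. (h a - c) * pu r a x)"
    by (simp add: sum_distrib_left sum_subtractf left_diff_distrib)
  finally have "\<bar>avg r h x - c\<bar> \<le> (\<Sum>a\<in>?F. \<bar>(h a - c) * pu r a x\<bar>)"
    by (simp add: sum_abs)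
  also have "\<dots> \<le> (\<Sum>a\<in>?F. e * pu r a x)"
    using assms by (intro sum_mono) (auto simp: abs_mult near_def abs_of_nonneg[OF pu_nonneg] pu_nonneg intro!: mult_right_mono)
  also have "\<dots> = e" using s by (simp flip: sum_distrib_left)
  finally show ?thesis .
qed

lemma avg_const:
  assumes "\<And>y. dist x y < 2 * r \<Longrightarrow> h y = c"
  shows "avg r h x = c"
  using avg_close[of x h c 0] assms by simp

lemma avg_sum: "avg r (\<lambda>x. \<Sum>j\<in>J. c j * h j x) = (\<lambda>x. \<Sum>j\<in>J. c j * avg r (h j) x)"
proof
  fix x
  have "avg r (\<lambda>x. \<Sum>j\<in>J. c j * h j x) x = (\<Sum>a\<in>near r (2 * r) x. \<Sum>j\<in>J. c j * (h j a * pu r a x))"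
    by (simp add: avg_def sum_distrib_right mult.assoc)
  also have "\<dots> = (\<Sum>j\<in>J. \<Sum>a\<in>near r (2 * r) x. c j * (h j a * pu r a x))" by (rule sum.swap)
  finally show "avg r (\<lambda>x. \<Sum>j\<in>J. c j * h j x) x = (\<Sum>j\<in>J. c j * avg r (h j) x)"
    by (simp add: avg_def sum_distrib_left)
qed

definition clip :: real where "clip = 3 * 26 ^ p * cpu + 5"

lemma clip_ge: "5 \<le> clip" using cpu_ge by (simp add: clip_def)

text \<open>The Lipschitz constant grows by a factor independent of the scale r.\<close>

lemma avg_lipschitz:
  assumes L: "L \<ge> 0" and h: "\<And>x y. \<bar>h x - h y\<bar> \<le> L * dist x y"
  shows "\<bar>avg r h x - avg r h y\<bar> \<le> clip * L * dist x y"
proof (cases "dist x y < r")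
  case False
  have close: "\<bar>avg r h z - h z\<bar> \<le> L * (2 * r)" for z
  proof (rule avg_close)
    fix y assume "dist z y < 2 * r"
    then show "\<bar>h y - h z\<bar> \<le> L * (2 * r)"
      using h[of y z] L mult_left_mono[of "dist y z" "2 * r" L] by (simp add: dist_commute)
  qed
  have "L * r \<le> L * dist x y" using False L by (intro mult_left_mono) auto
  then have "\<bar>avg r h x - avg r h y\<bar> \<le> 5 * (L * dist x y)"
    using close[of x] close[of y] h[of x y] by linarith
  also have "\<dots> \<le> clip * (L * dist x y)" using clip_ge L by (intro mult_right_mono) auto
  finally show ?thesis by simp
next
  case True
  let ?F = "near r (3 * r) x" and ?d = "dist x y"
  have F: "finite ?F" "near r (2 * r) x \<subseteq> ?F" "near r (2 * r) y \<subseteq> ?F" "?F \<subseteq> net r"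
    using r near_subset_near[of x y r "2 * r"] near_subset_near[of x x r "2 * r"] True near_subset_net
    by simp_all
  have s: "(\<Sum>a\<in>?F. pu r a x) = 1" "(\<Sum>a\<in>?F. pu r a y) = 1" using sum_pu F by blast+
  \<comment> \<open>Both partitions sum to 1, so a multiple of \<open>h x\<close> can be subtracted
    for free. The differences \<open>h a - h x\<close> are then of order \<open>L * r\<close>, which
    cancels the factor \<open>1 / r\<close> of \<open>pu_lipschitz\<close> and makes
    \<open>clip\<close> independent of the scale.\<close>
  have "avg r h x - avg r h y = (\<Sum>a\<in>?F. h a * pu r a x) - (\<Sum>a\<in>?F. h a * pu r a y)
      - h x * ((\<Sum>a\<in>?F. pu r a x) - (\<Sum>a\<in>?F. pu r a y))"
    unfolding s using avg_eq F by simp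
  also have "\<dots> = (\<Sum>a\<in>?F. (h a - h x) * (pu r a x - pu r a y))"
    by (simp add: sum_distrib_left sum_subtractf sum.distrib algebra_simps)
  finally have "\<bar>avg r h x - avg r h y\<bar> \<le> (\<Sum>a\<in>?F. \<bar>(h a - h x) * (pu r a x - pu r a y)\<bar>)"
    by (simp add: sum_abs)
  also have "\<dots> \<le> (\<Sum>a\<in>?F. L * (3 * r) * (cpu / r * ?d))"
    unfolding abs_mult
  proof (intro sum_mono mult_mono)
    fix a assume a: "a \<in> ?F"
    then show "\<bar>h a - h x\<bar> \<le> L * (3 * r)"
      using h[of a x] L mult_left_mono[of "dist a x" "3 * r" L] by (simp add: near_def dist_commute)
    show "\<bar>pu r a x - pu r a y\<bar> \<le> cpu / r * ?d" using a by (intro pu_lipschitz) (auto simp: near_def)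
  qed (use L r in auto)
  also have "\<dots> = real (card ?F) * (3 * cpu * L * ?d)" using r by simp
  also have "\<dots> \<le> 26 ^ p * (3 * cpu * L * ?d)"
    using card_near3[of x] cpu_ge L by (intro mult_right_mono) auto
  also have "\<dots> \<le> clip * L * ?d"
    using L by (simp add: clip_def algebra_simps)
  finally show ?thesis .
qed

end

end

section \<open>Splines by infinite subdivision\<close>

text \<open>Used for the splines and again for the residuals; phrased with \<open>lim\<close>
  because both are defined as pointwise limits.\<close>

lemma geometric_increments:
  fixes a :: "nat \<Rightarrow> real"
  assumes q: "0 \<le> q" "q < 1" and a: "\<And>n. \<bar>a (Suc n) - a n\<bar> \<le> c * q ^ n"
  shows "a \<longlonglongrightarrow> lim a" "\<bar>lim a - a n\<bar> \<le> c * q ^ n / (1 - q)"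
proof -
  define b where "b n = a (Suc n) - a n" for n
  have sq: "summable (\<lambda>n. c * q ^ n)" using q by (intro summable_mult summable_geometric) auto
  have sb: "summable b" by (rule summable_comparison_test'[OF sq, of 0]) (use a in \<open>auto simp: b_def\<close>)
  have an: "(\<Sum>i<n. b i) = a n - a 0" for n
    by (induction n) (auto simp: b_def)
  have "(\<lambda>n. (\<Sum>i<n. b i) + a 0) \<longlonglongrightarrow> suminf b + a 0"
    by (intro tendsto_intros summable_LIMSEQ sb)
  then have l: "a \<longlonglongrightarrow> suminf b + a 0" by (simp add: an)
  then show "a \<longlonglongrightarrow> lim a" by (simp add: limI)
  have "lim a - a n = (\<Sum>i. b (i + n))"
    using limI[OF l] suminf_split_initial_segment[OF sb, of n] an[of n] by simp
  also have "\<bar>\<dots>\<bar> \<le> (\<Sum>i. c * q ^ (i + n))"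
  proof (rule order_trans[OF summable_rabs])
    show s: "summable (\<lambda>i. \<bar>b (i + n)\<bar>)"
      by (rule summable_comparison_test'[OF summable_ignore_initial_segment[OF sq], of 0])
        (use a in \<open>auto simp: b_def\<close>)
    show "(\<Sum>i. \<bar>b (i + n)\<bar>) \<le> (\<Sum>i. c * q ^ (i + n))"
      by (rule suminf_le[OF _ s summable_ignore_initial_segment[OF sq]]) (use a in \<open>auto simp: b_def\<close>)
  qed
  also have "(\<Sum>i. c * q ^ (i + n)) = (\<Sum>i. (c * q ^ n) * q ^ i)"
    by (simp add: power_add mult_ac)
  also have "\<dots> = c * q ^ n / (1 - q)"
    using q by (subst suminf_mult) (auto simp: suminf_geometric summable_geometric)
  finally show "\<bar>lim a - a n\<bar> \<le> c * q ^ n / (1 - q)" .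
qed

lemma power_bracket:
  fixes d t :: real
  assumes d: "0 < d" "d < 1" and t: "0 < t" "t \<le> 1"
  obtains n where "d ^ Suc n < t" "t \<le> d ^ n"
proof -
  have ex: "\<exists>n. d ^ n < t" using real_arch_pow_inv[OF t(1) d(2)] .
  define m where "m = (LEAST n. d ^ n < t)"
  have m: "d ^ m < t" unfolding m_def using ex by (rule LeastI_ex)
  then obtain n where n: "m = Suc n" using t by (cases m) auto
  then have "\<not> d ^ n < t" using not_less_Least[of n "\<lambda>n. d ^ n < t"] m_def by simp
  then show ?thesis using m n that by auto
qed

definition lip :: "('a::metric_space \<Rightarrow> real) \<Rightarrow> real \<Rightarrow> bool" where
  "lip h L \<longleftrightarrow> 0 \<le> L \<and> (\<forall>x y. \<bar>h x - h y\<bar> \<le> L * dist x y)"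

lemma lip_continuous:
  assumes "lip h L"
  shows "continuous_on UNIV h"
  unfolding continuous_on_iff
proof (intro ballI allI impI)
  fix x :: 'a and e :: real assume e: "0 < e"
  have L: "L \<ge> 0" using assms by (simp add: lip_def)
  have "dist (h x') (h x) < e" if "dist x' x < e / (L + 1)" for x'
  proof -
    have "\<bar>h x' - h x\<bar> \<le> L * dist x' x" using assms by (simp add: lip_def)
    also have "\<dots> \<le> (L + 1) * dist x' x" by (intro mult_right_mono) auto
    also have "\<dots> < e" using that L by (simp add: field_simps)
    finally show ?thesis by (simp add: dist_real_def)
  qed
  moreover have "e / (L + 1) > 0" using e L by (intro divide_pos_pos) auto
  ultimately show "\<exists>d>0. \<forall>x'\<in>UNIV. dist x' x < d \<longrightarrow> dist (h x') (h x) < e" by blast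
qed

text \<open>The bound \<open>1 / 64\<close> makes the total displacement caused by all finer
  averages small against the current scale and keeps a child close to its parent. The last
  assumption is the one that fixes the Hoelder exponent.\<close>

locale spline = doubling M p for M :: "'a::metric_space measure" and p :: nat +
  fixes \<delta> \<eta> :: real
  assumes \<delta>: "0 < \<delta>" "\<delta> \<le> 1 / 64" and \<eta>: "0 < \<eta>" "\<eta> < 1" and clip_\<delta>: "clip * \<delta> \<le> \<delta> powr \<eta>"
begin

definition rr :: "int \<Rightarrow> real" where "rr k = \<delta> powi k"

lemmas cpu16 = cpu_ge[OF zero_less_one] and clip5 = clip_ge[OF zero_less_one]

lemma rr_pos [simp]: "0 < rr k" using \<delta> by (simp add: rr_def)

lemma rr_add: "rr (k + int n) = \<delta> ^ n * rr k"
  using \<delta> by (simp add: rr_def power_int_add)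

lemma rr_Suc: "rr (k + 1) = \<delta> * rr k"
  using rr_add[of k 1] by simp

lemma rr_Suc_le: "rr (k + 1) \<le> rr k / 64"
  unfolding rr_Suc using mult_right_mono[OF \<delta>(2), of "rr k"] rr_pos[of k] by simp

section \<open>Iterated averages and their limits\<close>

primrec iter :: "int \<Rightarrow> nat \<Rightarrow> ('a \<Rightarrow> real) \<Rightarrow> 'a \<Rightarrow> real" where
  "iter k 0 h = h"
| "iter k (Suc n) h = avg (rr (k + 1 + int n)) (iter k n h)"

definition lims :: "int \<Rightarrow> ('a \<Rightarrow> real) \<Rightarrow> 'a \<Rightarrow> real" where
  "lims k h x = lim (\<lambda>n. iter k n h x)"

definition spl :: "int \<Rightarrow> 'a \<Rightarrow> 'a \<Rightarrow> real" where
  "spl k a = lims k (pu (rr k) a)"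

definition q :: real where "q = clip * \<delta>"

lemma q: "0 < q" "q < 1" "q \<le> \<delta> powr \<eta>"
proof -
  show "0 < q" unfolding q_def using clip5 \<delta> by (intro mult_pos_pos) auto
  show "q \<le> \<delta> powr \<eta>" using clip_\<delta> by (simp add: q_def)
  moreover have "\<delta> powr \<eta> < 1" using powr_less_mono2[of \<eta> \<delta> 1] \<delta> \<eta> by simp
  ultimately show "q < 1" by simp
qed

lemma iter_lip:
  assumes "lip h L"
  shows "lip (iter k n h) (clip ^ n * L)"
proof (induction n)
  case (Suc n)
  have "\<bar>iter k (Suc n) h x - iter k (Suc n) h y\<bar> \<le> clip * (clip ^ n * L) * dist x y" for x y
    using Suc by (simp only: iter.simps, intro avg_lipschitz) (auto simp: lip_def)
  moreover have "0 \<le> clip * (clip ^ n * L)" using assms clip5 by (simp add: lip_def)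
  ultimately show ?case by (auto simp: lip_def mult.assoc)
qed (use assms in simp)

lemma iter_step:
  assumes h: "lip h L"
  shows "\<bar>iter k (Suc n) h x - iter k n h x\<bar> \<le> (2 * \<delta> * rr k * L) * q ^ n"
proof -
  have L: "L \<ge> 0" using h by (simp add: lip_def)
  have "\<bar>iter k (Suc n) h x - iter k n h x\<bar> \<le> (clip ^ n * L) * (2 * rr (k + 1 + int n))"
    unfolding iter.simps
  proof (rule avg_close)
    fix y assume y: "dist x y < 2 * rr (k + 1 + int n)"
    have "\<bar>iter k n h y - iter k n h x\<bar> \<le> (clip ^ n * L) * dist x y"
      using iter_lip[OF h, of k n] unfolding lip_def by (metis dist_commute)
    also have "\<dots> \<le> (clip ^ n * L) * (2 * rr (k + 1 + int n))"
      using y L clip5 by (intro mult_left_mono) auto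
    finally show "\<bar>iter k n h y - iter k n h x\<bar> \<le> (clip ^ n * L) * (2 * rr (k + 1 + int n))" .
  qed simp
  also have "\<dots> = (2 * \<delta> * rr k * L) * q ^ n"
    by (simp add: rr_add rr_Suc q_def power_mult_distrib)
  finally show ?thesis .
qed

lemma
  assumes "lip h L"
  shows iter_lims: "(\<lambda>n. iter k n h x) \<longlonglongrightarrow> lims k h x"
    and lims_tail: "\<bar>lims k h x - iter k n h x\<bar> \<le> (2 * \<delta> * rr k * L) * q ^ n / (1 - q)"
  using geometric_increments[of q "\<lambda>n. iter k n h x", OF _ _ iter_step[OF assms]] q
  by (auto simp: lims_def)

lemma iter_sum: "iter k n (\<lambda>x. \<Sum>j\<in>J. c j * h j x) = (\<lambda>x. \<Sum>j\<in>J. c j * iter k n (h j) x)"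
  by (induction n) (auto simp: avg_sum)

lemma lims_sum:
  assumes "\<And>j. j \<in> J \<Longrightarrow> lip (h j) (L j)"
  shows "lims k (\<lambda>x. \<Sum>j\<in>J. c j * h j x) x = (\<Sum>j\<in>J. c j * lims k (h j) x)"
  unfolding lims_def[of k "\<lambda>x. \<Sum>j\<in>J. c j * h j x"] iter_sum
  by (intro limI tendsto_sum tendsto_mult tendsto_const iter_lims) (rule assms)

lemma lims_const:
  assumes "\<And>y. dist x y < rr k / 8 \<Longrightarrow> h y = c"
  shows "lims k h x = c"
proof -
  \<comment> \<open>The radius starts at \<open>rr k / 8\<close> and never falls below
    \<open>rr k / 16\<close>. Passing from \<open>n\<close> to \<open>Suc n\<close> costs a
    displacement of \<open>2 * \<delta> * \<delta> ^ n * rr k\<close>, which fits into the decrease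
    of \<open>\<delta> ^ n / 16\<close> because \<open>33 * \<delta> \<le> 1\<close>.\<close>
  have "iter k n h y = c" if "dist x y < rr k * (1 / 16 + \<delta> ^ n / 16)" for n y
    using that
  proof (induction n arbitrary: y)
    case 0 then show ?case using assms by simp
  next
    case (Suc n)
    show ?case unfolding iter.simps
    proof (rule avg_const)
      fix z assume "dist y z < 2 * rr (k + 1 + int n)"
      then have z: "dist y z < 2 * \<delta> * \<delta> ^ n * rr k" by (simp add: rr_add rr_Suc mult_ac)
      have "2 * \<delta> + \<delta> / 16 \<le> 1 / 16" using \<delta> by simp
      then have "(2 * \<delta> + \<delta> / 16) * (\<delta> ^ n * rr k) \<le> 1 / 16 * (\<delta> ^ n * rr k)"
        using \<delta> less_imp_le[OF rr_pos[of k]] by (intro mult_right_mono) auto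
      then show "iter k n h z = c"
        using z Suc.prems dist_triangle[of x z y] by (intro Suc.IH) (simp add: algebra_simps)
    qed simp
  qed
  from this[of x] show ?thesis unfolding lims_def using \<delta> by (simp add: add_pos_nonneg)
qed

lemma iter_shift: "iter k (Suc n) h = iter (k + 1) n (avg (rr (k + 1)) h)"
  by (induction n) (auto simp: algebra_simps)

text \<open>Dropping the first average does not change the limit; this is the source of the
  two-scale relation.\<close>

lemma lims_avg:
  assumes "lip h L"
  shows "lims (k + 1) (avg (rr (k + 1)) h) x = lims k h x"
  using LIMSEQ_Suc[OF iter_lims[OF assms, of k x]] unfolding lims_def[of "k + 1"] iter_shift
  by (rule limI)

lemma pu_lip:
  assumes "a \<in> net (rr k)"
  shows "lip (pu (rr k) a) (cpu / rr k)"
  using assms cpu16 pu_lipschitz[of "rr k"] less_imp_le[OF rr_pos[of k]] by (auto simp: lip_def)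

section \<open>Properties of a single spline\<close>

context
  fixes k :: int and a :: 'a
  assumes a: "a \<in> net (rr k)"
begin

lemma spl_bounds: "0 \<le> spl k a x" "spl k a x \<le> 1"
proof -
  \<comment> \<open>In this centred form \<open>avg_close\<close> propagates the lower and the upper
    bound together.\<close>
  have it: "\<bar>iter k n (pu (rr k) a) x - 1 / 2\<bar> \<le> 1 / 2" for n x
  proof (induction n arbitrary: x)
    case 0
    show ?case using pu_nonneg[of "rr k" a x] pu_le_1[of "rr k" a x] a by (simp add: abs_if)
  next
    case (Suc n)
    then show ?case unfolding iter.simps by (intro avg_close) auto
  qed
  have l: "(\<lambda>n. iter k n (pu (rr k) a) x) \<longlonglongrightarrow> spl k a x"
    unfolding spl_def by (rule iter_lims[OF pu_lip[OF a]])
  have *: "0 \<le> iter k n (pu (rr k) a) x" "iter k n (pu (rr k) a) x \<le> 1" for n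
    using it[of n x] by (simp_all add: abs_if split: if_splits)
  show "0 \<le> spl k a x" "spl k a x \<le> 1"
    using LIMSEQ_le_const[OF l] LIMSEQ_le_const2[OF l] * by blast+
qed

lemma spl_abs: "\<bar>spl k a x\<bar> \<le> 1"
  using spl_bounds by simp

lemma spl_one:
  assumes "dist x a < rr k / 8"
  shows "spl k a x = 1"
  unfolding spl_def
proof (rule lims_const)
  fix y assume "dist x y < rr k / 8"
  then show "pu (rr k) a y = 1"
    using assms dist_triangle3[of y a x] a by (intro pu_one) auto
qed

lemma spl_other:
  assumes "dist x a < rr k / 8" "b \<in> net (rr k)" "b \<noteq> a"
  shows "spl k b x = 0"
  unfolding spl_def
proof (rule lims_const)
  fix y assume "dist x y < rr k / 8"
  then show "pu (rr k) b y = 0"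
    using assms dist_triangle3[of y a x] a by (intro pu_other[of "rr k" a]) auto
qed

lemma spl_zero:
  assumes "2 * rr k \<le> dist x a"
  shows "spl k a x = 0"
  unfolding spl_def
proof (rule lims_const)
  fix y assume "dist x y < rr k / 8"
  then show "pu (rr k) a y = 0"
    using assms dist_triangle[of x a y] rr_pos[of k] by (intro pu_zero) (auto simp del: rr_pos)
qed

text \<open>The first finer average of \<open>pu (rr k) a\<close> is a finite combination of the
  finer \<open>pu\<close>, with its own point values as coefficients; \<open>lims\<close> is linear
  and ignores the shift by one level. \<open>G\<close> may be any large enough finite set, so that
  points can be added to it.\<close>

lemma spl_refine:
  assumes G: "finite G" "G \<subseteq> net (rr (k + 1))" "near (rr (k + 1)) (2 * rr k) a \<subseteq> G"
  shows "spl k a x = (\<Sum>b\<in>G. pu (rr k) a b * spl (k + 1) b x)"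
proof -
  have zero: "pu (rr k) a b = 0" if "b \<in> net (rr (k + 1))" "b \<notin> G" for b
  proof -
    have "2 * rr k \<le> dist a b" using that G(3) by (auto simp: near_def)
    then show ?thesis using rr_pos[of k] by (intro pu_zero) (auto simp: dist_commute simp del: rr_pos)
  qed
  have "avg (rr (k + 1)) (pu (rr k) a) = (\<lambda>x. \<Sum>b\<in>G. pu (rr k) a b * pu (rr (k + 1)) b x)"
  proof
    fix x
    have "avg (rr (k + 1)) (pu (rr k) a) x
        = (\<Sum>b\<in>G \<union> near (rr (k + 1)) (2 * rr (k + 1)) x. pu (rr k) a b * pu (rr (k + 1)) b x)"
      using G near_subset_net by (intro avg_eq) auto
    also have "\<dots> = (\<Sum>b\<in>G. pu (rr k) a b * pu (rr (k + 1)) b x)"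
      using G near_subset_net[THEN subsetD] zero by (intro sum.mono_neutral_right) auto
    finally show "avg (rr (k + 1)) (pu (rr k) a) x = (\<Sum>b\<in>G. pu (rr k) a b * pu (rr (k + 1)) b x)" .
  qed
  then have "spl k a x = lims (k + 1) (\<lambda>x. \<Sum>b\<in>G. pu (rr k) a b * pu (rr (k + 1)) b x) x"
    unfolding spl_def using lims_avg[OF pu_lip[OF a], of k x] by simp
  also have "\<dots> = (\<Sum>b\<in>G. pu (rr k) a b * lims (k + 1) (pu (rr (k + 1)) b) x)"
    using G by (intro lims_sum) (auto intro: pu_lip)
  finally show ?thesis by (simp add: spl_def)
qed

definition hoe :: real where "hoe = 5 * cpu / (1 - q)"

lemma hoe_ge: "1 \<le> hoe"
proof -
  have "1 \<le> 5 * cpu" using cpu16 by simp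
  also have "\<dots> \<le> 5 * cpu / (1 - q)"
    using q cpu16 mult_mono[of "5 * cpu" "5 * cpu" "1 - q" 1] by (simp add: field_simps)
  finally show ?thesis by (simp add: hoe_def)
qed

text \<open>Interpolation between two estimates at the level \<open>n\<close> with \<open>t\<close>
  about \<open>\<delta> ^ n\<close>: the n-th iterate is Lipschitz with constant of order
  \<open>clip ^ n\<close>, and the limit differs from it by order \<open>q ^ n\<close>.\<close>

lemma spl_hoelder: "\<bar>spl k a x - spl k a y\<bar> \<le> hoe * (dist x y / rr k) powr \<eta>"
proof -
  define t where "t = dist x y / rr k"
  consider "x = y" | "t > 1" | "0 < t" "t \<le> 1" by (force simp: t_def)
  then have "\<bar>spl k a x - spl k a y\<bar> \<le> hoe * t powr \<eta>"
  proof cases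
    case 1
    then show ?thesis using hoe_ge by simp
  next
    case 2
    have "\<bar>spl k a x - spl k a y\<bar> \<le> 1 * 1" using spl_bounds[of x] spl_bounds[of y] by simp
    also have "\<dots> \<le> hoe * t powr \<eta>"
      using 2 \<eta> hoe_ge by (intro mult_mono ge_one_powr_ge_zero) auto
    finally show "\<bar>spl k a x - spl k a y\<bar> \<le> hoe * t powr \<eta>" .
  next
    case 3
    obtain n where n: "\<delta> ^ Suc n < t" "t \<le> \<delta> ^ n" using power_bracket[of \<delta> t] \<delta> 3 by auto
    let ?h = "pu (rr k) a"
    have h: "lip ?h (cpu / rr k)" using a by (rule pu_lip)
    have tail: "\<bar>spl k a z - iter k n ?h z\<bar> \<le> 2 * cpu / (1 - q) * (\<delta> * q ^ n)" for z
      using lims_tail[OF h, of k z n] rr_pos[of k] by (simp add: spl_def mult_ac)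
    have "\<bar>iter k n ?h x - iter k n ?h y\<bar> \<le> clip ^ n * (cpu / rr k) * dist x y"
      using iter_lip[OF h, of k n] by (simp add: lip_def)
    also have "\<dots> = cpu * (clip ^ n * t)" by (simp add: t_def)
    finally have mid: "\<bar>iter k n ?h x - iter k n ?h y\<bar> \<le> cpu * (clip ^ n * t)" .
    have dp: "\<delta> ^ n = \<delta> powr real n" for n using \<delta> by (simp add: powr_realpow)
    have qn: "q ^ n \<le> \<delta> powr (\<eta> * n)"
      using power_mono[OF q(3), of n] q(1) \<delta> by (simp add: powr_power mult.commute)
    \<comment> \<open>Split off \<open>t powr (1 - \<eta>)\<close> and bound it by the upper bracket
      \<open>t \<le> \<delta> ^ n\<close>; what remains is
      \<open>q ^ n * \<delta> powr (- (\<eta> * n))\<close>, at most 1.\<close>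
    have e1: "clip ^ n * t \<le> t powr \<eta>"
    proof -
      have "clip ^ n * t = clip ^ n * (t powr (1 - \<eta>) * t powr \<eta>)"
        using 3 by (simp flip: powr_add)
      also have "\<dots> \<le> clip ^ n * ((\<delta> ^ n) powr (1 - \<eta>) * t powr \<eta>)"
        using n 3 \<eta> clip5 by (intro mult_left_mono mult_right_mono powr_mono2) auto
      also have "(\<delta> ^ n) powr (1 - \<eta>) = \<delta> ^ n * \<delta> powr (- (\<eta> * n))"
        unfolding dp powr_powr by (simp flip: powr_add add: algebra_simps)
      also have "clip ^ n * (\<delta> ^ n * \<delta> powr (- (\<eta> * n)) * t powr \<eta>)
          = q ^ n * \<delta> powr (- (\<eta> * n)) * t powr \<eta>"
        by (simp add: q_def power_mult_distrib)
      also have "\<dots> \<le> \<delta> powr (\<eta> * n) * \<delta> powr (- (\<eta> * n)) * t powr \<eta>"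
        using qn by (intro mult_right_mono) auto
      also have "\<dots> = t powr \<eta>" using \<delta> by (simp flip: powr_add)
      finally show ?thesis .
    qed
    \<comment> \<open>Here the lower bracket \<open>\<delta> ^ Suc n < t\<close> is used; the factor
      \<delta> in front supplies the missing power.\<close>
    have e2: "\<delta> * q ^ n \<le> t powr \<eta>"
    proof -
      have "\<delta> * q ^ n \<le> \<delta> powr \<eta> * \<delta> powr (\<eta> * n)"
      proof (intro mult_mono qn)
        show "\<delta> \<le> \<delta> powr \<eta>" using \<delta> \<eta> powr_mono'[of \<eta> 1 \<delta>] by simp
      qed (use q in auto)
      also have "\<dots> = (\<delta> ^ Suc n) powr \<eta>"
        unfolding dp powr_powr by (simp flip: powr_add add: algebra_simps)
      also have "\<dots> \<le> t powr \<eta>" using n \<delta> \<eta> by (intro powr_mono2) (auto simp del: power_Suc)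
      finally show ?thesis .
    qed
    have c0: "0 \<le> 2 * cpu / (1 - q)" using cpu16 q by simp
    \<comment> \<open>One Lipschitz term \<open>cpu\<close> and two tails
      \<open>2 * cpu / (1 - q)\<close>; as \<open>cpu \<le> cpu / (1 - q)\<close>, this explains the
      5 in \<open>hoe\<close>.\<close>
    have "\<bar>spl k a x - spl k a y\<bar> \<le> cpu * (clip ^ n * t) + 2 * (2 * cpu / (1 - q) * (\<delta> * q ^ n))"
      using mid tail[of x] tail[of y] by linarith
    also have "\<dots> \<le> cpu * t powr \<eta> + 2 * (2 * cpu / (1 - q) * t powr \<eta>)"
      using e1 e2 c0 cpu16 by (intro add_mono mult_left_mono) auto
    also have "\<dots> = (cpu + 4 * cpu / (1 - q)) * t powr \<eta>" by (simp add: algebra_simps)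
    also have "\<dots> \<le> hoe * t powr \<eta>"
    proof (intro mult_right_mono)
      have "cpu \<le> cpu / (1 - q)"
        using q cpu16 mult_mono[of "cpu" "cpu" "1 - q" 1] by (simp add: field_simps)
      then show "cpu + 4 * cpu / (1 - q) \<le> hoe" by (simp add: hoe_def)
    qed simp
    finally show "\<bar>spl k a x - spl k a y\<bar> \<le> hoe * t powr \<eta>" .
  qed
  then show ?thesis by (simp add: t_def)
qed

lemma spl_measurable: "spl k a \<in> borel_measurable M"
proof (rule borel_measurable_LIMSEQ_real)
  show "(\<lambda>n. iter k n (pu (rr k) a) x) \<longlonglongrightarrow> spl k a x" for x
    unfolding spl_def by (rule iter_lims[OF pu_lip[OF a]])
  show "iter k n (pu (rr k) a) \<in> borel_measurable M" for n
    unfolding borel_measurable_M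
    by (rule borel_measurable_continuous_onI[OF lip_continuous[OF iter_lip[OF pu_lip[OF a]]]])
qed

end

lemma spl_sum:
  assumes F: "finite F" "F \<subseteq> net (rr k)" "near (rr k) (2 * rr k) x \<subseteq> F"
  shows "(\<Sum>a\<in>F. spl k a x) = 1"
proof -
  let ?F = "F \<union> near (rr k) (3 * rr k) x"
  have sub: "?F \<subseteq> net (rr k)" using F near_subset_net by auto
  have "(\<Sum>a\<in>F. spl k a x) = (\<Sum>a\<in>?F. spl k a x)"
  proof (rule sum.mono_neutral_left)
    show "\<forall>i\<in>?F - F. spl k i x = 0"
    proof
      fix i assume i: "i \<in> ?F - F"
      then have "2 * rr k \<le> dist x i" using sub F(3) by (auto simp: near_def)
      then show "spl k i x = 0" using i sub by (intro spl_zero) auto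
    qed
  qed (use F in auto)
  also have "\<dots> = (\<Sum>a\<in>?F. 1 * lims k (pu (rr k) a) x)"
    by (simp add: spl_def)
  also have "\<dots> = lims k (\<lambda>y. \<Sum>a\<in>?F. 1 * pu (rr k) a y) x"
    using sub by (intro lims_sum[symmetric, where L = "\<lambda>_. cpu / rr k"] pu_lip) auto
  also have "\<dots> = 1"
  proof (rule lims_const)
    fix y assume y: "dist x y < rr k / 8"
    then have "near (rr k) (2 * rr k) y \<subseteq> ?F"
      using near_subset_near[of "rr k" x y "rr k" "2 * rr k"] rr_pos[of k] by auto
    then show "(\<Sum>a\<in>?F. 1 * pu (rr k) a y) = 1"
      using F sub by (simp add: sum_pu)
  qed
  finally show ?thesis .
qed

text \<open>Near a fine net point only its own fine spline survives in the refinement relation, so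
  the coarse spline is constant there. The Riesz lower bound is read off from these constant
  values.\<close>

lemma spl_near_child:
  assumes a: "a \<in> net (rr k)" and \<gamma>: "\<gamma> \<in> net (rr (k + 1))" "dist x \<gamma> < rr (k + 1) / 8"
  shows "spl k a x = pu (rr k) a \<gamma>"
proof -
  let ?G = "insert \<gamma> (near (rr (k + 1)) (2 * rr k) a)"
  have G: "finite ?G" "?G \<subseteq> net (rr (k + 1))" using \<gamma> near_subset_net by auto
  have "spl k a x = (\<Sum>b\<in>?G. pu (rr k) a b * spl (k + 1) b x)"
    using G by (intro spl_refine[OF a]) auto
  also have "\<dots> = (\<Sum>b\<in>{\<gamma>}. pu (rr k) a b * spl (k + 1) b x)"
    using G by (intro sum.mono_neutral_right) (auto simp: spl_other[OF \<gamma>])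
  finally show ?thesis by (simp add: spl_one[OF \<gamma>])
qed

end

section \<open>Localised Gram--Schmidt for Riesz families\<close>

text \<open>Induction on \<open>p\<close> for all ratios at once: writing \<open>x = s * s\<close>,
  one factor \<open>s ^ n\<close> absorbs a linear factor and the other is left to the induction
  hypothesis.\<close>

lemma polynomial_times_geometric_bounded:
  fixes x :: real
  assumes "0 \<le> x" "x < 1" "0 \<le> a" "0 \<le> b"
  shows "\<exists>K>0. \<forall>n. (a * real n + b) ^ p * x ^ n \<le> K"
  using assms(1,2)
proof (induction p arbitrary: x)
  case 0
  then show ?case by (intro exI[of _ 1]) (auto intro: power_le_one)
next
  case (Suc p)
  define s where "s = sqrt x"
  have s: "0 \<le> s" "s < 1" "s * s = x" using Suc.prems by (auto simp: s_def real_sqrt_lt_1_iff)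
  obtain K where K: "K > 0" "\<And>n. (a * real n + b) ^ p * s ^ n \<le> K" using Suc.IH s by blast
  have "(\<lambda>n. a * (real n * s ^ n) + b * s ^ n) \<longlonglongrightarrow> a * 0 + b * 0"
    using s by (intro tendsto_intros powser_times_n_limit_0 LIMSEQ_power_zero) auto
  then have "Bseq (\<lambda>n. a * (real n * s ^ n) + b * s ^ n)"
    by (intro convergent_imp_Bseq convergentI)
  then obtain L where L: "L > 0" "\<And>n. norm (a * (real n * s ^ n) + b * s ^ n) \<le> L"
    by (auto elim: BseqE)
  have "(a * real n + b) ^ Suc p * x ^ n \<le> K * L" for n
  proof -
    have "(a * real n + b) ^ Suc p * x ^ n
        = ((a * real n + b) ^ p * s ^ n) * (a * (real n * s ^ n) + b * s ^ n)"
      by (simp add: s(3)[symmetric] power_mult_distrib algebra_simps)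
    also have "\<dots> \<le> K * L"
      using K L(2)[of n] L(1) assms s by (intro mult_mono) auto
    finally show ?thesis .
  qed
  then show ?case using K L by (intro exI[of _ "K * L"]) auto
qed

lemma l2n_mono:
  assumes "g \<in> L2 M" "f \<in> borel_measurable M" "\<And>x. \<bar>f x\<bar> \<le> \<bar>g x\<bar>"
  shows "l2n M f \<le> l2n M g"
  unfolding l2n_def
proof (intro real_sqrt_le_mono integral_mono)
  show "integrable M (\<lambda>x. (f x)\<^sup>2)" using L2_square[OF L2_bound[OF assms]] .
qed (use assms L2_square in \<open>auto simp: abs_le_square_iff\<close>)

section \<open>Square-integrability of localised functions\<close>

context doubling
begin

lemma ball_indicator_L2: "(\<lambda>x. c * indicator (ball y R) x) \<in> L2 M"
proof (rule L2_cmult, rule L2_I)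
  have "(\<lambda>x. (indicator (ball y R) x)\<^sup>2) = (indicator (ball y R) :: 'a \<Rightarrow> real)"
    by (auto simp: indicator_def)
  then show "integrable M (\<lambda>x. (indicator (ball y R) x :: real)\<^sup>2)"
    using emeasure_ball_finite by simp
qed measurable

lemma
  assumes f: "f \<in> borel_measurable M" and C: "\<And>x. \<bar>f x\<bar> \<le> C" and supp: "\<And>x. R \<le> dist x y \<Longrightarrow> f x = 0"
  shows bounded_support_L2: "f \<in> L2 M"
    and bounded_support_integral: "sq f \<le> C\<^sup>2 * vol y R"
proof -
  have le: "\<bar>f x\<bar> \<le> \<bar>C * indicator (ball y R) x\<bar>" for x
    using C[of x] supp[of x] by (cases "x \<in> ball y R") (auto simp: dist_commute abs_mult)
  show "f \<in> L2 M" using L2_bound[OF ball_indicator_L2 f le] .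
  have sq: "(\<lambda>x. (C * indicator (ball y R) x)\<^sup>2) = (\<lambda>x. C\<^sup>2 * indicator (ball y R) x)"
    by (auto simp: indicator_def)
  have "(l2n M f)\<^sup>2 \<le> (l2n M (\<lambda>x. C * indicator (ball y R) x))\<^sup>2"
    using l2n_mono[OF ball_indicator_L2 f le] by (intro power_mono) auto
  then show "sq f \<le> C\<^sup>2 * vol y R"
    unfolding l2n_square sq by simp
qed

lemma integrable_exp_dist:
  assumes c: "c > 0"
  shows "integrable M (\<lambda>x. exp (- c * dist x y))"
proof (rule integrableI_nonneg)
  show "(\<lambda>x. exp (- c * dist x y)) \<in> borel_measurable M"
    unfolding borel_measurable_M by (intro borel_measurable_continuous_onI continuous_intros)
  \<comment> \<open>Half of the exponential decay absorbs the polynomial growth of the balls, the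
    other half makes the series over integer radii converge.\<close>
  define s where "s = exp (- c / 2)"
  have s: "0 \<le> s" "s < 1" "s * s = exp (- c)" using c by (auto simp: s_def mult_exp_exp)
  obtain K where K: "K > 0" "\<And>n. (2 * real n + 2) ^ p * s ^ n \<le> K"
    using polynomial_times_geometric_bounded[of s 2 2 p] s by auto
  define v where "v = vol y 1"
  have v: "v \<ge> 0" by (simp add: v_def)
  have "(\<integral>\<^sup>+x. ennreal (exp (- c * dist x y)) \<partial>M)
      \<le> (\<integral>\<^sup>+x. (\<Sum>n. ennreal (exp (- c) ^ n) * indicator (ball y (real n + 1)) x) \<partial>M)"
  proof (rule nn_integral_mono)
    fix x
    define n where "n = nat \<lfloor>dist x y\<rfloor>"
    have n: "real n \<le> dist x y" "dist x y < real n + 1" by (auto simp: n_def)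
    have "exp (- c * dist x y) \<le> exp (- c) ^ n"
      using n(1) c by (simp flip: exp_of_nat_mult)
    then have "ennreal (exp (- c * dist x y)) \<le> ennreal (exp (- c) ^ n) * indicator (ball y (real n + 1)) x"
      using n(2) by (simp add: dist_commute ennreal_leI)
    also have "\<dots> \<le> (\<Sum>n. ennreal (exp (- c) ^ n) * indicator (ball y (real n + 1)) x)"
    proof -
      have "g n \<le> suminf g" for g :: "nat \<Rightarrow> ennreal"
        using sum_le_suminf[of g "{n}"] by simp
      then show ?thesis .
    qed
    finally show "ennreal (exp (- c * dist x y))
      \<le> (\<Sum>n. ennreal (exp (- c) ^ n) * indicator (ball y (real n + 1)) x)" .
  qed
  also have "\<dots> = (\<Sum>n. \<integral>\<^sup>+x. ennreal (exp (- c) ^ n) * indicator (ball y (real n + 1)) x \<partial>M)"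
    by (rule nn_integral_suminf) measurable
  also have "\<dots> = (\<Sum>n. ennreal (exp (- c) ^ n * vol y (real n + 1)))"
    by (intro suminf_cong) (simp add: nn_integral_cmult emeasure_eq_measure2 ennreal_mult' del: ennreal_power)
  also have "\<dots> \<le> (\<Sum>n. ennreal (K * v * s ^ n))"
  proof (intro suminf_le ennreal_leI)
    fix n
    have "vol y (real n + 1) \<le> (2 * (real n + 1)) ^ p * v"
      unfolding v_def by (intro ball_growth) auto
    then have "exp (- c) ^ n * vol y (real n + 1) \<le> (s * s) ^ n * ((2 * real n + 2) ^ p * v)"
      unfolding s(3) by (intro mult_left_mono) (auto simp: algebra_simps)
    also have "\<dots> = ((2 * real n + 2) ^ p * s ^ n) * (v * s ^ n)" by (simp add: power_mult_distrib mult_ac)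
    also have "\<dots> \<le> K * (v * s ^ n)" using K v s by (intro mult_right_mono) auto
    finally show "exp (- c) ^ n * vol y (real n + 1) \<le> K * v * s ^ n" by (simp add: mult.assoc)
  qed auto
  also have "\<dots> = ennreal (\<Sum>n. K * v * s ^ n)"
    using K v s by (intro suminf_ennreal2 summable_mult summable_geometric) auto
  also have "\<dots> < \<infinity>" by simp
  finally show "(\<integral>\<^sup>+x. ennreal (exp (- c * dist x y)) \<partial>M) < \<infinity>" .
qed simp

end

text \<open>A normalised family living at a single scale \<open>r\<close>. The scale enters none of
  the constants \<open>A\<close>, \<open>B\<close>, \<open>N\<close>, so what is derived from them
  is uniform over all levels.\<close>

locale riesz = doubling M p for M :: "'a::metric_space measure" and p :: nat +
  fixes A B N \<eta> r :: real and I :: "'i set" and z :: "'i \<Rightarrow> 'a" and f :: "'i \<Rightarrow> 'a \<Rightarrow> real"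
  assumes A: "A > 0" and B: "B \<ge> 1" and N: "N \<ge> 1" and r: "r > 0"
    and f_measurable: "i \<in> I \<Longrightarrow> f i \<in> borel_measurable M"
    and f_bound: "i \<in> I \<Longrightarrow> \<bar>f i x\<bar> \<le> B / sqrt (vol (z i) r)"
    and f_support: "i \<in> I \<Longrightarrow> 2 * r \<le> dist x (z i) \<Longrightarrow> f i x = 0"
    and f_hoelder: "i \<in> I \<Longrightarrow>
      \<bar>f i x - f i y\<bar> \<le> B / sqrt (vol (z i) r) * (dist x y / r) powr \<eta>"
    and finite_centres: "finite {i \<in> I. dist x (z i) < R}"
    and card_centres: "real (card {i \<in> I. dist x (z i) < 5 * r}) \<le> N"
    and riesz_lower: "finite J \<Longrightarrow> J \<subseteq> I \<Longrightarrow>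
      A * (\<Sum>i\<in>J. (c i)\<^sup>2) \<le> (\<integral>x. (\<Sum>i\<in>J. c i * f i x)\<^sup>2 \<partial>M)"
begin

text \<open>An upper Riesz bound, used as the inverse step length of the Richardson iteration. The
  summand \<open>A\<close> ensures \<open>A < bes\<close>, so that the contraction factor \<theta>
  of the squared norms lies strictly between 0 and 1.\<close>

definition bes :: real where "bes = N * (B\<^sup>2 * 2 ^ p) + A"
definition \<theta> :: real where "\<theta> = 1 - A / bes"
definition U2 :: real where "U2 = bes * (N * (B\<^sup>2 * 2 ^ p)\<^sup>2)"
definition c1 :: real where "c1 = sqrt (U2 / A)"
text \<open>The square of \<omega> is the midpoint of \<open>sqrt \<theta>\<close> and 1. Hence
  \<open>sqrt \<theta> ^ n\<close> beats the polynomial volume factors and still leaves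
  \<open>\<omega> ^ n\<close> twice: one factor for summation over \<open>n\<close>, one for decay
  in space. Supports grow by \<open>4 * r\<close> per step, hence the 4 in \<gamma>.\<close>

definition \<omega> :: real where "\<omega> = sqrt ((1 + sqrt \<theta>) / 2)"
definition \<gamma> :: real where "\<gamma> = - ln \<omega> / 4"
definition K :: real where "K = (SOME K. K > 0 \<and> (\<forall>n. (8 * real n + 10) ^ p * (sqrt \<theta> / \<omega>\<^sup>2) ^ n \<le> K))"
text \<open>The factor \<open>exp (7 * \<gamma>)\<close> belongs to the radius
  \<open>(4 * n + 7) * r\<close> in \<open>localised_sum\<close>. In \<open>E\<close> the first term
  bounds the starting function \<open>f i0\<close>, the second the geometric series of
  corrections.\<close>

definition D :: real where "D = N * c1 * B * K * exp (7 * \<gamma>)"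
definition E :: real where "E = B * exp (3 * \<gamma>) + D / bes / (1 - \<omega>)"

lemma bes_pos: "bes > 0" and A_less_bes: "A < bes" and bes_ge: "N * (B\<^sup>2 * 2 ^ p) \<le> bes"
proof -
  have "0 < N * (B\<^sup>2 * 2 ^ p)" using B N by (intro mult_pos_pos) auto
  then show "bes > 0" "A < bes" "N * (B\<^sup>2 * 2 ^ p) \<le> bes" using A by (auto simp: bes_def)
qed

lemma \<theta>: "0 < \<theta>" "\<theta> < 1"
  using A bes_pos A_less_bes by (auto simp: \<theta>_def)

lemma \<omega>: "0 < \<omega>" "\<omega> < 1" "\<omega>\<^sup>2 = (1 + sqrt \<theta>) / 2" "sqrt \<theta> < \<omega>\<^sup>2"
proof -
  have s: "0 < sqrt \<theta>" "sqrt \<theta> < 1" using \<theta> by auto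
  have "0 < 1 + sqrt \<theta>" using s(1) by linarith
  then show "0 < \<omega>" unfolding \<omega>_def by simp
  show "\<omega> < 1" unfolding \<omega>_def using s(2) by simp
  show "\<omega>\<^sup>2 = (1 + sqrt \<theta>) / 2" unfolding \<omega>_def using s by simp
  moreover have "a < (1 + a) / 2" if "a < 1" for a :: real using that by simp
  from this[OF s(2)] have "sqrt \<theta> < (1 + sqrt \<theta>) / 2" .
  ultimately show "sqrt \<theta> < \<omega>\<^sup>2" by metis
qed

lemma \<gamma>: "\<gamma> > 0" "\<omega> = exp (- (4 * \<gamma>))"
  using \<omega>(1,2) by (auto simp: \<gamma>_def)

lemma K: "K > 0" "(8 * real n + 10) ^ p * sqrt \<theta> ^ n \<le> K * (\<omega> ^ n * \<omega> ^ n)"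
proof -
  have x: "0 \<le> sqrt \<theta> / \<omega>\<^sup>2" "sqrt \<theta> / \<omega>\<^sup>2 < 1" using \<omega> \<theta> by auto
  have "\<exists>K. K > 0 \<and> (\<forall>n. (8 * real n + 10) ^ p * (sqrt \<theta> / \<omega>\<^sup>2) ^ n \<le> K)"
    using polynomial_times_geometric_bounded[OF x, of 8 10 p] by auto
  from someI_ex[OF this] have *: "K > 0" "(8 * real n + 10) ^ p * (sqrt \<theta> / \<omega>\<^sup>2) ^ n \<le> K"
    unfolding K_def[symmetric] by auto
  show "K > 0" by (rule *)
  show "(8 * real n + 10) ^ p * sqrt \<theta> ^ n \<le> K * (\<omega> ^ n * \<omega> ^ n)"
    using *(2) \<omega>(1) by (simp add: power_divide field_simps power2_eq_square power_mult_distrib)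
qed

lemma U2_nonneg: "0 \<le> U2" using bes_pos N by (simp add: U2_def)

lemma c1_nonneg: "0 \<le> c1" using U2_nonneg A by (simp add: c1_def)

lemma D_nonneg: "0 \<le> D" using c1_nonneg B N K(1) by (simp add: D_def)

lemma E_pos: "0 < E"
proof -
  have "0 \<le> D / bes / (1 - \<omega>)" using D_nonneg bes_pos \<omega>(2) by simp
  moreover have "0 < B * exp (3 * \<gamma>)" using B by simp
  ultimately show ?thesis by (simp add: E_def)
qed

lemma f_L2: "i \<in> I \<Longrightarrow> f i \<in> L2 M"
  and f_norm: "i \<in> I \<Longrightarrow> sq (f i) \<le> B\<^sup>2 * 2 ^ p"
proof -
  assume i: "i \<in> I"
  let ?v = "vol (z i) r"
  have v: "?v > 0" by (rule ball_pos[OF r])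
  note * = bounded_support_L2[OF f_measurable[OF i] f_bound[OF i] f_support[OF i]]
    bounded_support_integral[OF f_measurable[OF i] f_bound[OF i] f_support[OF i]]
  show "f i \<in> L2 M" by (rule *)
  have "sq (f i) \<le> (B / sqrt ?v)\<^sup>2 * vol (z i) (2 * r)" by (rule *)
  also have "\<dots> \<le> (B / sqrt ?v)\<^sup>2 * (2 ^ p * ?v)"
    by (intro mult_left_mono ball_double[OF r]) auto
  also have "\<dots> = B\<^sup>2 * 2 ^ p" using v by (simp add: power_divide)
  finally show "sq (f i) \<le> B\<^sup>2 * 2 ^ p" .
qed

lemma sum_near:
  assumes J: "finite J" "J \<subseteq> I" and s: "s \<le> 5 * r" and zero: "\<And>i. i \<in> J \<Longrightarrow> s \<le> dist x (z i) \<Longrightarrow> g i = 0"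
  shows "\<exists>J'\<subseteq>J. real (card J') \<le> N \<and> (\<forall>i\<in>J'. dist x (z i) < s) \<and> sum g J = sum (g :: 'i \<Rightarrow> real) J'"
proof (intro exI conjI)
  let ?J' = "{i \<in> J. dist x (z i) < s}"
  show "?J' \<subseteq> J" by auto
  have "card ?J' \<le> card {i \<in> I. dist x (z i) < 5 * r}"
    using J s by (intro card_mono finite_centres) auto
  then show "real (card ?J') \<le> N" using card_centres[of x] by linarith
  show "sum g J = sum g ?J'"
    using J zero by (intro sum.mono_neutral_right) (auto simp: not_less)
qed auto

text \<open>Pointwise at most \<open>N\<close> summands are nonzero, so Cauchy--Schwarz at each
  point loses only the factor \<open>N\<close>.\<close>

lemma bessel:
  assumes J: "finite J" "J \<subseteq> I"
  shows "(\<integral>x. (\<Sum>i\<in>J. c i * f i x)\<^sup>2 \<partial>M) \<le> bes * (\<Sum>i\<in>J. (c i)\<^sup>2)"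
proof -
  have fJ: "f i \<in> L2 M" if "i \<in> J" for i using that J by (intro f_L2) auto
  have "(\<integral>x. (\<Sum>i\<in>J. c i * f i x)\<^sup>2 \<partial>M) \<le> (\<integral>x. N * (\<Sum>i\<in>J. (c i)\<^sup>2 * (f i x)\<^sup>2) \<partial>M)"
  proof (rule integral_mono)
    show "integrable M (\<lambda>x. (\<Sum>i\<in>J. c i * f i x)\<^sup>2)" using fJ by (intro L2_square L2_sum)
    show "integrable M (\<lambda>x. N * (\<Sum>i\<in>J. (c i)\<^sup>2 * (f i x)\<^sup>2))"
      using fJ by (intro integrable_mult_right Bochner_Integration.integrable_sum L2_square)
    fix x
    obtain J' where J': "J' \<subseteq> J" "real (card J') \<le> N"
        "(\<Sum>i\<in>J. c i * f i x) = (\<Sum>i\<in>J'. c i * f i x)"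
      using sum_near[OF J, of "2 * r" x "\<lambda>i. c i * f i x"] f_support J r by auto
    have "(\<Sum>i\<in>J. c i * f i x)\<^sup>2 \<le> (\<Sum>i\<in>J'. (c i * f i x)\<^sup>2) * card J'"
      unfolding J'(3) by (rule sum_squared_le_sum_of_squares)
    also have "\<dots> \<le> (\<Sum>i\<in>J. (c i * f i x)\<^sup>2) * N"
      using J J' by (intro mult_mono sum_mono2 sum_nonneg) auto
    finally show "(\<Sum>i\<in>J. c i * f i x)\<^sup>2 \<le> N * (\<Sum>i\<in>J. (c i)\<^sup>2 * (f i x)\<^sup>2)"
      by (simp add: power_mult_distrib mult.commute)
  qed
  also have "\<dots> = N * (\<Sum>i\<in>J. (c i)\<^sup>2 * sq (f i))"
    using fJ by (subst integral_mult_right_zero, subst Bochner_Integration.integral_sum) (auto intro: L2_square)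
  also have "\<dots> \<le> N * (\<Sum>i\<in>J. (c i)\<^sup>2 * (B\<^sup>2 * 2 ^ p))"
    using f_norm J N by (intro mult_left_mono sum_mono) auto
  also have "\<dots> = (N * (B\<^sup>2 * 2 ^ p)) * (\<Sum>i\<in>J. (c i)\<^sup>2)"
    by (simp add: sum_distrib_left mult_ac)
  also have "\<dots> \<le> bes * (\<Sum>i\<in>J. (c i)\<^sup>2)"
    using bes_ge by (intro mult_right_mono sum_nonneg) auto
  finally show ?thesis .
qed

text \<open>Duality: expanding one factor of \<open>sq u\<close> and applying Cauchy--Schwarz to the
  coefficients bounds the square of \<open>sq u\<close> by the coefficient sum times the right-hand
  side; \<open>riesz_lower\<close> then returns one factor \<open>sq u\<close>, which
  cancels.\<close>

lemma frame_lower: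
  assumes J: "finite J" "J \<subseteq> I" and u: "u = (\<lambda>x. \<Sum>i\<in>J. c i * f i x)"
  shows "A * sq u \<le> (\<Sum>i\<in>J. (ip u (f i))\<^sup>2)"
proof -
  have fJ: "f i \<in> L2 M" if "i \<in> J" for i using that J by (intro f_L2) auto
  have uL: "u \<in> L2 M" unfolding u using fJ by (rule L2_sum)
  let ?n = "\<integral>x. (u x)\<^sup>2 \<partial>M" and ?d = "\<Sum>i\<in>J. (ip u (f i))\<^sup>2"
  have "?n = (\<integral>x. (\<Sum>i\<in>J. c i * f i x) * u x \<partial>M)"
    by (simp add: power2_eq_square flip: u fun_cong[OF u])
  also have "\<dots> = (\<Sum>i\<in>J. c i * ip u (f i))"
    using integral_sum_mult[of J f M u c] fJ uL by (simp add: mult.commute)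
  finally have "?n\<^sup>2 \<le> (\<Sum>i\<in>J. (c i)\<^sup>2) * ?d"
    using Cauchy_Schwarz_ineq_sum[of c "\<lambda>i. ip u (f i)" J] by simp
  then have "A * ?n\<^sup>2 \<le> (A * (\<Sum>i\<in>J. (c i)\<^sup>2)) * ?d"
    using A by (simp add: mult.assoc)
  also have "\<dots> \<le> ?n * ?d"
    using riesz_lower[OF J, of c] unfolding u by (intro mult_right_mono sum_nonneg) auto
  finally have *: "(A * ?n) * ?n \<le> ?d * ?n" by (simp add: power2_eq_square mult_ac)
  have n0: "0 \<le> ?n" by simp
  show ?thesis
  proof (cases "?n = 0")
    case True
    then show ?thesis by (simp add: sum_nonneg)
  next
    case False
    then have "0 < ?n" using n0 by linarith
    then show ?thesis using * by (rule mult_right_le_imp_le[rotated])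
  qed
qed

section \<open>Exponentially localised residual modulo an arbitrary subfamily\<close>

context
  fixes S :: "'i set" and i0 :: 'i
  assumes S: "S \<subseteq> I" and i0: "i0 \<in> I" "i0 \<notin> S"
begin

text \<open>The iterate \<open>hh n\<close> is supported within \<open>(4 * n + 2) * r\<close> of
  \<open>z i0\<close> and each \<open>f i\<close> within \<open>2 * r\<close> of its centre, so all
  other indices of \<open>S\<close> have coefficient 0. The iteration thus agrees with the one over
  all of \<open>S\<close>, but every sum is finite.\<close>

definition Sn :: "nat \<Rightarrow> 'i set" where
  "Sn n = {i \<in> S. dist (z i0) (z i) < (4 * real n + 4) * r}"

text \<open>Richardson iteration for the residual of \<open>f i0\<close> modulo the closed span of the \<open>f i\<close> with
  \<open>i \<in> S\<close>. The supports grow linearly while the corrections \<open>uu\<close> decay geometrically, so the limit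
  decays exponentially.\<close>

primrec hh :: "nat \<Rightarrow> 'a \<Rightarrow> real" where
  "hh 0 = f i0"
| "hh (Suc n) = (\<lambda>x. hh n x - 1 / bes * (\<Sum>i\<in>Sn n. ip (hh n) (f i) * f i x))"

definition uu :: "nat \<Rightarrow> 'a \<Rightarrow> real" where
  "uu n x = (\<Sum>i\<in>Sn n. ip (hh n) (f i) * f i x)"

lemma hh_Suc: "hh (Suc n) x = hh n x - 1 / bes * uu n x"
  by (simp add: uu_def)

lemma finite_Sn: "finite (Sn n)"
  by (rule finite_subset[OF _ finite_centres[of "z i0" "(4 * real n + 4) * r"]]) (use S in \<open>auto simp: Sn_def\<close>)

lemma Sn_subset: "Sn n \<subseteq> I" "Sn n \<subseteq> S"
  using S by (auto simp: Sn_def)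

lemma Sn_mono: "i \<le> n \<Longrightarrow> Sn i \<subseteq> Sn n"
  using r by (auto simp: Sn_def elim!: less_le_trans intro!: mult_right_mono)

lemma fSn_L2: "i \<in> Sn n \<Longrightarrow> f i \<in> L2 M"
  using Sn_subset by (intro f_L2) auto

lemma hh_L2: "hh n \<in> L2 M"
proof (induction n)
  case 0 then show ?case using f_L2[OF i0(1)] by simp
next
  case (Suc n)
  then show ?case unfolding hh.simps by (intro L2_diff L2_cmult L2_sum fSn_L2) auto
qed

lemma uu_L2: "uu n \<in> L2 M"
  unfolding uu_def by (intro L2_sum fSn_L2)

lemma Sn_far:
  assumes "i \<in> Sn n" "(4 * real n + 6) * r \<le> dist x (z i0)"
  shows "2 * r \<le> dist x (z i)"
  using assms dist_triangle[of x "z i0" "z i"] by (simp add: Sn_def dist_commute algebra_simps)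

lemma uu_support:
  assumes "(4 * real n + 6) * r \<le> dist x (z i0)"
  shows "uu n x = 0"
  unfolding uu_def
proof (rule sum.neutral, intro ballI)
  fix i assume "i \<in> Sn n"
  then show "ip (hh n) (f i) * f i x = 0"
    using f_support[of i x] Sn_far[OF _ assms] Sn_subset by auto
qed

lemma hh_support:
  assumes "(4 * real n + 2) * r \<le> dist x (z i0)"
  shows "hh n x = 0"
  using assms
proof (induction n)
  case 0 then show ?case using f_support[OF i0(1)] by simp
next
  case (Suc n)
  then show ?case using uu_support[of n x] r unfolding hh_Suc by (simp add: algebra_simps)
qed

lemma ip_hh_zero:
  assumes i: "i \<in> S" "i \<notin> Sn n"
  shows "ip (hh n) (f i) = 0"
proof -
  have "hh n x * f i x = 0" for x
  proof (rule ccontr)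
    assume "hh n x * f i x \<noteq> 0"
    then have "dist x (z i0) < (4 * real n + 2) * r" "dist x (z i) < 2 * r"
      using hh_support[of n x] f_support[of i x] i S by force+
    then have "dist (z i0) (z i) < (4 * real n + 4) * r"
      using dist_triangle3[of "z i0" "z i" x] by (simp add: algebra_simps)
    then show False using i by (simp add: Sn_def)
  qed
  then have "(\<lambda>x. hh n x * f i x) = (\<lambda>x. 0)" by blast
  then show ?thesis by simp
qed

text \<open>Allows successive corrections to be compared over one common index set.\<close>

lemma uu_extend:
  assumes "finite J" "Sn n \<subseteq> J" "J \<subseteq> S"
  shows "uu n x = (\<Sum>i\<in>J. ip (hh n) (f i) * f i x)"
  unfolding uu_def using assms ip_hh_zero by (intro sum.mono_neutral_left) auto

lemma uu_Suc: "uu (Suc n) x = uu n x + (- 1 / bes) * (\<Sum>i\<in>Sn (Suc n). ip (uu n) (f i) * f i x)"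
proof -
  have "ip (hh (Suc n)) (f i) = ip (hh n) (f i) + (- 1 / bes) * ip (uu n) (f i)" if "i \<in> Sn (Suc n)" for i
  proof -
    have "ip (hh (Suc n)) (f i) = (\<integral>x. hh n x * f i x - 1 / bes * (uu n x * f i x) \<partial>M)"
      unfolding hh_Suc by (simp add: left_diff_distrib)
    also have "\<dots> = ip (hh n) (f i) - 1 / bes * ip (uu n) (f i)"
      using L2_mult_integrable[OF hh_L2 fSn_L2[OF that]] L2_mult_integrable[OF uu_L2 fSn_L2[OF that]]
      by (subst Bochner_Integration.integral_diff) auto
    finally show ?thesis by simp
  qed
  then have "uu (Suc n) x = (\<Sum>i\<in>Sn (Suc n). (ip (hh n) (f i) + (- 1 / bes) * ip (uu n) (f i)) * f i x)"
    unfolding uu_def[of "Suc n"] by (intro sum.cong) auto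
  also have "\<dots> = (\<Sum>i\<in>Sn (Suc n). ip (hh n) (f i) * f i x)
      + (- 1 / bes) * (\<Sum>i\<in>Sn (Suc n). ip (uu n) (f i) * f i x)"
    by (simp only: distrib_right sum.distrib sum_distrib_left mult.assoc)
  also have "(\<Sum>i\<in>Sn (Suc n). ip (hh n) (f i) * f i x) = uu n x"
    using Sn_mono[of n "Suc n"] Sn_subset finite_Sn by (intro uu_extend[symmetric]) auto
  finally show ?thesis .
qed

text \<open>The iterates \<open>hh\<close> have a nonzero limit, so decay has to be measured on the
  corrections. These satisfy the same Richardson recursion and lie in the span of the
  \<open>f i\<close> with \<open>i\<close> in \<open>S\<close>, where \<open>frame_lower\<close>
  applies.\<close>

lemma uu_contract: "sq (uu (Suc n)) \<le> \<theta> * sq (uu n)"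
proof -
  let ?J = "Sn (Suc n)"
  define d where "d i = ip (uu n) (f i)" for i
  define w where "w x = (\<Sum>i\<in>?J. d i * f i x)" for x
  let ?d = "\<Sum>i\<in>?J. (d i)\<^sup>2"
  have J: "finite ?J" "?J \<subseteq> I" using finite_Sn Sn_subset by auto
  have wL: "w \<in> L2 M" unfolding w_def by (intro L2_sum fSn_L2)
  have "ip (uu n) w = ip w (uu n)" by (simp add: mult.commute)
  also have "\<dots> = (\<Sum>i\<in>?J. d i * ip (f i) (uu n))"
    unfolding w_def by (intro integral_sum_mult fSn_L2 uu_L2)
  also have "\<dots> = ?d" by (simp add: d_def power2_eq_square mult.commute)
  finally have uw: "ip (uu n) w = ?d" .
  have ww: "sq w \<le> bes * ?d" unfolding w_def by (rule bessel[OF J])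
  have "sq (uu (Suc n)) = (\<integral>x. (uu n x + (- 1 / bes) * w x)\<^sup>2 \<partial>M)"
    unfolding uu_Suc w_def d_def ..
  also have "\<dots> = sq (uu n) + 2 * (- 1 / bes) * ip (uu n) w
      + (- 1 / bes)\<^sup>2 * sq w"
    by (rule integral_square_add[OF uu_L2 wL])
  also have "\<dots> \<le> sq (uu n) + 2 * (- 1 / bes) * ?d + (- 1 / bes)\<^sup>2 * (bes * ?d)"
    unfolding uw using ww by (intro add_left_mono mult_left_mono) auto
  also have "\<dots> = sq (uu n) - ?d / bes"
    using bes_pos by (simp add: power2_eq_square field_simps)
  also have "\<dots> \<le> sq (uu n) - A * sq (uu n) / bes"
  proof -
    have "A * sq (uu n) \<le> ?d" unfolding d_def
      using uu_extend[of ?J n] Sn_mono[of n "Suc n"] Sn_subset J by (intro frame_lower) auto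
    then show ?thesis using bes_pos by (simp add: divide_right_mono)
  qed
  also have "\<dots> = \<theta> * sq (uu n)" by (simp add: \<theta>_def algebra_simps)
  finally show ?thesis .
qed

lemma uu_0: "sq (uu 0) \<le> U2"
proof -
  have "sq (uu 0) \<le> bes * (\<Sum>i\<in>Sn 0. (ip (f i0) (f i))\<^sup>2)"
    unfolding uu_def hh.simps by (intro bessel finite_Sn Sn_subset)
  also have "\<dots> \<le> bes * (\<Sum>i\<in>Sn 0. (B\<^sup>2 * 2 ^ p)\<^sup>2)"
  proof (intro mult_left_mono sum_mono)
    fix i assume i: "i \<in> Sn 0"
    have "(ip (f i0) (f i))\<^sup>2 \<le> sq (f i0) * sq (f i)"
      by (intro L2_CS2 f_L2 i0 fSn_L2[OF i])
    also have "\<dots> \<le> (B\<^sup>2 * 2 ^ p) * (B\<^sup>2 * 2 ^ p)"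
      using i Sn_subset i0 by (intro mult_mono f_norm) auto
    finally show "(ip (f i0) (f i))\<^sup>2 \<le> (B\<^sup>2 * 2 ^ p)\<^sup>2" by (simp add: power2_eq_square)
  qed (use bes_pos in auto)
  also have "\<dots> = bes * (real (card (Sn 0)) * (B\<^sup>2 * 2 ^ p)\<^sup>2)" by simp
  also have "\<dots> \<le> bes * (N * (B\<^sup>2 * 2 ^ p)\<^sup>2)"
  proof (intro mult_left_mono mult_right_mono)
    have "card (Sn 0) \<le> card {i \<in> I. dist (z i0) (z i) < 5 * r}"
      using S r by (intro card_mono finite_centres) (auto simp: Sn_def)
    then show "real (card (Sn 0)) \<le> N" using card_centres[of "z i0"] by linarith
  qed (use bes_pos in auto)
  finally show ?thesis by (simp add: U2_def)
qed

lemma uu_norm: "sq (uu n) \<le> U2 * \<theta> ^ n"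
proof (induction n)
  case 0 then show ?case using uu_0 by simp
next
  case (Suc n)
  have "sq (uu (Suc n)) \<le> \<theta> * sq (uu n)" by (rule uu_contract)
  also have "\<dots> \<le> \<theta> * (U2 * \<theta> ^ n)" using Suc \<theta> by (intro mult_left_mono) auto
  finally show ?case by (simp add: mult_ac)
qed

text \<open>The coefficients of \<open>uu n\<close> are the inner products themselves, so the Riesz
  lower bound turns norm decay into decay of each coefficient.\<close>

lemma coefficient_decay:
  assumes i: "i \<in> S"
  shows "\<bar>ip (hh n) (f i)\<bar> \<le> c1 * sqrt \<theta> ^ n"
proof (cases "i \<in> Sn n")
  case False
  then have "ip (hh n) (f i) = 0" using i by (rule ip_hh_zero[rotated])
  then show ?thesis using c1_nonneg \<theta>(1) by simp
next
  case True
  have "A * (ip (hh n) (f i))\<^sup>2 \<le> A * (\<Sum>i\<in>Sn n. (ip (hh n) (f i))\<^sup>2)"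
    using A True finite_Sn by (intro mult_left_mono member_le_sum) auto
  also have "\<dots> \<le> sq (uu n)"
    unfolding uu_def by (intro riesz_lower finite_Sn Sn_subset)
  also have "\<dots> \<le> U2 * \<theta> ^ n" by (rule uu_norm)
  finally have "(ip (hh n) (f i))\<^sup>2 \<le> U2 / A * \<theta> ^ n" using A by (simp add: field_simps)
  then have "sqrt ((ip (hh n) (f i))\<^sup>2) \<le> sqrt (U2 / A * \<theta> ^ n)" by (rule real_sqrt_le_mono)
  also have "\<dots> = c1 * sqrt \<theta> ^ n" unfolding c1_def real_sqrt_mult real_sqrt_power ..
  finally show ?thesis unfolding real_sqrt_abs .
qed

definition v0 :: real where "v0 = vol (z i0) r"

definition GG :: "'a \<Rightarrow> real" where "GG x = exp (- \<gamma> * (dist x (z i0) / r)) / sqrt v0"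

lemma v0_pos: "v0 > 0" unfolding v0_def by (rule ball_pos[OF r])

lemma GG_pos: "GG x > 0" using v0_pos by (simp add: GG_def)

text \<open>Moving the normalisation from \<open>z i\<close> to \<open>z i0\<close> costs a factor
  polynomial in \<open>n\<close>. Replacing its square root by the factor itself keeps the exponent
  integral.\<close>

lemma inverse_sqrt_measure:
  assumes "i \<in> Sn n"
  shows "B / sqrt (vol (z i) r) \<le> B * ((8 * real n + 10) ^ p / sqrt v0)"
proof -
  let ?v = "vol (z i) r" and ?c = "(8 * real n + 10) ^ p"
  have v: "?v > 0" by (rule ball_pos[OF r])
  have "v0 \<le> (2 * (4 * real n + 5)) ^ p * ?v" unfolding v0_def
    using assms r by (intro ball_growth) (auto simp: Sn_def dist_commute algebra_simps)
  then have "sqrt v0 \<le> sqrt ?c * sqrt ?v" by (simp flip: real_sqrt_mult)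
  also have "\<dots> \<le> ?c * sqrt ?v"
  proof (intro mult_right_mono)
    have "1 \<le> ?c" by (rule one_le_power) simp
    then have "?c \<le> ?c\<^sup>2" by (simp add: power2_eq_square)
    then show "sqrt ?c \<le> ?c" by (intro real_le_lsqrt) auto
  qed simp
  finally have "1 / sqrt ?v \<le> ?c / sqrt v0" using v v0_pos by (simp add: field_simps)
  then show ?thesis using B mult_left_mono[of "1 / sqrt ?v" "?c / sqrt v0" B] by simp
qed

text \<open>Common form of the size and regularity estimates: g is a value or a difference of values.\<close>

lemma localised_sum:
  assumes g: "\<And>i. i \<in> I \<Longrightarrow> \<bar>g i\<bar> \<le> B / sqrt (vol (z i) r) * t" and t: "t \<ge> 0"
    and zero: "\<And>i. i \<in> I \<Longrightarrow> 3 * r \<le> dist x (z i) \<Longrightarrow> g i = 0"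
  shows "\<bar>\<Sum>i\<in>Sn n. ip (hh n) (f i) * g i\<bar> \<le> D * GG x * t * \<omega> ^ n"
proof (cases "(4 * real n + 7) * r \<le> dist x (z i0)")
  case True
  \<comment> \<open>The radius 3 instead of 2 makes room for differences of values at points up to
    \<open>r\<close> apart; together with the radius of \<open>Sn n\<close> it gives
    \<open>4 * n + 7\<close>.\<close>
  have "ip (hh n) (f i) * g i = 0" if "i \<in> Sn n" for i
  proof -
    have "3 * r \<le> dist x (z i)"
      using True that dist_triangle[of x "z i0" "z i"] by (simp add: Sn_def dist_commute algebra_simps)
    then have "g i = 0" using that Sn_subset(1)[of n] by (intro zero) auto
    then show ?thesis by simp
  qed
  then have "(\<Sum>i\<in>Sn n. ip (hh n) (f i) * g i) = 0" by (intro sum.neutral) auto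
  then show ?thesis using D_nonneg GG_pos[of x] t \<omega>(1) by simp
next
  case False
  obtain J' where J': "J' \<subseteq> Sn n" "real (card J') \<le> N"
      "(\<Sum>i\<in>Sn n. ip (hh n) (f i) * g i) = (\<Sum>i\<in>J'. ip (hh n) (f i) * g i)"
  proof -
    have "ip (hh n) (f i) * g i = 0" if "i \<in> Sn n" "3 * r \<le> dist x (z i)" for i
      using zero[of i] that Sn_subset(1)[of n] by auto
    moreover have "3 * r \<le> 5 * r" using r by simp
    ultimately show ?thesis
      using sum_near[OF finite_Sn Sn_subset(1), where s = "3 * r" and x = x and n1 = n
          and g = "\<lambda>i. ip (hh n) (f i) * g i"] that by blast
  qed
  let ?m = "(c1 * sqrt \<theta> ^ n) * (B * ((8 * real n + 10) ^ p / sqrt v0) * t)"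
  have m0: "0 \<le> ?m" using c1_nonneg \<theta>(1) B t v0_pos by simp
  have "\<bar>\<Sum>i\<in>Sn n. ip (hh n) (f i) * g i\<bar> \<le> (\<Sum>i\<in>J'. \<bar>ip (hh n) (f i)\<bar> * \<bar>g i\<bar>)"
    unfolding J'(3) by (rule order_trans[OF sum_abs]) (simp add: abs_mult)
  also have "\<dots> \<le> (\<Sum>i\<in>J'. ?m)"
  proof (intro sum_mono mult_mono)
    fix i assume "i \<in> J'"
    then have i: "i \<in> Sn n" using J' by auto
    then show "\<bar>ip (hh n) (f i)\<bar> \<le> c1 * sqrt \<theta> ^ n" using Sn_subset by (intro coefficient_decay) auto
    have "\<bar>g i\<bar> \<le> B / sqrt (vol (z i) r) * t" using i Sn_subset by (intro g) auto
    also have "\<dots> \<le> B * ((8 * real n + 10) ^ p / sqrt v0) * t"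
      by (intro mult_right_mono inverse_sqrt_measure[OF i] t)
    finally show "\<bar>g i\<bar> \<le> B * ((8 * real n + 10) ^ p / sqrt v0) * t" .
  qed (use c1_nonneg \<theta>(1) in auto)
  also have "\<dots> = real (card J') * ?m" by simp
  also have "\<dots> \<le> N * ?m" by (rule mult_right_mono[OF J'(2) m0])
  also have "\<dots> = (N * c1 * B * t / sqrt v0) * ((8 * real n + 10) ^ p * sqrt \<theta> ^ n)"
    by (simp add: field_simps)
  also have "\<dots> \<le> (N * c1 * B * t / sqrt v0) * (K * (\<omega> ^ n * \<omega> ^ n))"
    using K(2)[of n] N c1_nonneg B t v0_pos by (intro mult_left_mono) auto
  \<comment> \<open>One of the two factors \<open>\<omega> ^ n\<close> is exchanged for decay in
    space: here the distance is below \<open>(4 * n + 7) * r\<close>, and \<omega> is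
    \<open>exp (- (4 * \<gamma>))\<close>.\<close>
  also have "\<dots> \<le> (N * c1 * B * t / sqrt v0) * (K * (\<omega> ^ n * (exp (7 * \<gamma>) * exp (- \<gamma> * (dist x (z i0) / r)))))"
  proof (intro mult_left_mono)
    have "dist x (z i0) / r < 4 * real n + 7" using False r by (simp add: field_simps)
    then have "\<gamma> * (dist x (z i0) / r) \<le> \<gamma> * (4 * real n + 7)" using \<gamma>(1) by (intro mult_left_mono) auto
    then show "\<omega> ^ n \<le> exp (7 * \<gamma>) * exp (- \<gamma> * (dist x (z i0) / r))"
      unfolding \<gamma>(2) by (simp add: algebra_simps flip: exp_of_nat_mult exp_add)
  qed (use N c1_nonneg B t v0_pos K(1) \<omega>(1) in auto)
  also have "\<dots> = D * GG x * t * \<omega> ^ n" by (simp add: D_def GG_def field_simps)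
  finally show ?thesis .
qed

lemma uu_bound: "\<bar>uu n x\<bar> \<le> D * GG x * \<omega> ^ n"
  unfolding uu_def using localised_sum[of "\<lambda>i. f i x" 1 x n] f_bound f_support[of _ x] r by simp

lemma uu_hoelder:
  assumes "dist x y \<le> r"
  shows "\<bar>uu n x - uu n y\<bar> \<le> D * GG x * (dist x y / r) powr \<eta> * \<omega> ^ n"
proof -
  have "uu n x - uu n y = (\<Sum>i\<in>Sn n. ip (hh n) (f i) * (f i x - f i y))"
    by (simp add: uu_def right_diff_distrib sum_subtractf)
  also have "\<bar>\<dots>\<bar> \<le> D * GG x * (dist x y / r) powr \<eta> * \<omega> ^ n"
  proof (rule localised_sum)
    fix i assume i: "i \<in> I" "3 * r \<le> dist x (z i)"
    then have "2 * r \<le> dist x (z i)" "2 * r \<le> dist y (z i)"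
      using r assms dist_triangle[of x "z i" y] by auto
    then show "f i x - f i y = 0" using f_support i(1) by simp
  qed (use f_hoelder in auto)
  finally show ?thesis .
qed

definition res :: "'a \<Rightarrow> real" where "res x = lim (\<lambda>n. hh n x)"

lemma
  shows hh_res: "(\<lambda>n. hh n x) \<longlonglongrightarrow> res x"
    and res_tail: "\<bar>res x - hh n x\<bar> \<le> D / bes / (1 - \<omega>) * \<omega> ^ n * GG x"
proof -
  have "\<bar>hh (Suc n) x - hh n x\<bar> \<le> (D * GG x / bes) * \<omega> ^ n" for n
    using uu_bound[of n x] bes_pos by (simp add: hh_Suc abs_mult divide_simps del: hh.simps)
  from geometric_increments[of \<omega> "\<lambda>n. hh n x", OF _ _ this] \<omega>
  show "(\<lambda>n. hh n x) \<longlonglongrightarrow> res x" "\<bar>res x - hh n x\<bar> \<le> D / bes / (1 - \<omega>) * \<omega> ^ n * GG x"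
    by (auto simp: res_def field_simps)
qed

lemma f0_GG:
  assumes "\<bar>g\<bar> \<le> B / sqrt v0 * t" "3 * r \<le> dist x (z i0) \<Longrightarrow> g = 0" "t \<ge> 0"
  shows "\<bar>g\<bar> \<le> B * exp (3 * \<gamma>) * (GG x * t)"
proof (cases "3 * r \<le> dist x (z i0)")
  case True
  then show ?thesis using assms GG_pos[of x] B by simp
next
  case False
  then have "\<gamma> * (dist x (z i0) / r) \<le> \<gamma> * 3" using r \<gamma> by (intro mult_left_mono) (auto simp: field_simps)
  then have "1 \<le> exp (3 * \<gamma>) * exp (- \<gamma> * (dist x (z i0) / r))" by (simp flip: exp_add)
  then have "B / sqrt v0 * t * 1 \<le> B / sqrt v0 * t * (exp (3 * \<gamma>) * exp (- \<gamma> * (dist x (z i0) / r)))"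
    using B v0_pos assms(3) by (intro mult_left_mono) auto
  also have "\<dots> = B * exp (3 * \<gamma>) * (GG x * t)" by (simp add: GG_def)
  finally show ?thesis using assms(1) by simp
qed

lemma res_bound: "\<bar>res x\<bar> \<le> E * GG x"
proof -
  have "\<bar>f i0 x\<bar> \<le> B * exp (3 * \<gamma>) * (GG x * 1)"
    using f_bound[OF i0(1), of x] f_support[OF i0(1), of x] r by (intro f0_GG) (auto simp: v0_def)
  then have "\<bar>res x\<bar> \<le> B * exp (3 * \<gamma>) * GG x + D / bes / (1 - \<omega>) * GG x"
    using res_tail[of x 0] by (auto simp: abs_le_iff)
  then show ?thesis by (simp add: E_def algebra_simps)
qed

lemma res_hoelder:
  assumes xy: "dist x y \<le> r"
  shows "\<bar>res x - res y\<bar> \<le> E * GG x * (dist x y / r) powr \<eta>"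
proof -
  let ?t = "(dist x y / r) powr \<eta>"
  have "\<bar>(hh (Suc n) x - hh (Suc n) y) - (hh n x - hh n y)\<bar> \<le> (D * GG x * ?t / bes) * \<omega> ^ n" for n
  proof -
    have "(hh (Suc n) x - hh (Suc n) y) - (hh n x - hh n y) = - (uu n x - uu n y) / bes"
      using bes_pos by (simp add: hh_Suc field_simps del: hh.simps)
    then show ?thesis using uu_hoelder[OF xy, of n] bes_pos by (simp add: divide_right_mono abs_divide)
  qed
  from geometric_increments(2)[of \<omega> "\<lambda>n. hh n x - hh n y", OF _ _ this, of 0]
  have "\<bar>lim (\<lambda>n. hh n x - hh n y) - (f i0 x - f i0 y)\<bar> \<le> D * GG x * ?t / bes / (1 - \<omega>)"
    using \<omega> by simp
  moreover have "lim (\<lambda>n. hh n x - hh n y) = res x - res y"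
    by (intro limI tendsto_diff hh_res)
  moreover have "\<bar>f i0 x - f i0 y\<bar> \<le> B * exp (3 * \<gamma>) * (GG x * ?t)"
  proof (rule f0_GG)
    assume "3 * r \<le> dist x (z i0)"
    then have "2 * r \<le> dist x (z i0)" "2 * r \<le> dist y (z i0)"
      using r xy dist_triangle[of x "z i0" y] by auto
    then show "f i0 x - f i0 y = 0" using f_support i0(1) by simp
  qed (use f_hoelder[OF i0(1)] in \<open>auto simp: v0_def\<close>)
  ultimately have "\<bar>res x - res y\<bar> \<le> B * exp (3 * \<gamma>) * (GG x * ?t) + D * GG x * ?t / bes / (1 - \<omega>)"
    by (auto simp: abs_le_iff)
  then show ?thesis by (simp add: E_def algebra_simps)
qed

lemma res_measurable: "res \<in> borel_measurable M"
  using hh_res L2_measurable[OF hh_L2] by (rule borel_measurable_LIMSEQ_real)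

lemma GG_measurable: "GG \<in> borel_measurable M"
  unfolding borel_measurable_M GG_def
  using v0_pos r by (intro borel_measurable_continuous_onI continuous_intros) auto

lemma GG_integrable: "integrable M GG"
  unfolding GG_def using integrable_exp_dist[of "\<gamma> / r" "z i0"] \<gamma>(1) r by simp

lemma GG_L2: "GG \<in> L2 M"
proof (rule L2_I[OF GG_measurable])
  have "(\<lambda>x. (GG x)\<^sup>2) = (\<lambda>x. exp (- (2 * \<gamma> / r) * dist x (z i0)) / v0)"
    using v0_pos by (auto simp: GG_def power_divide simp flip: exp_double)
  then show "integrable M (\<lambda>x. (GG x)\<^sup>2)"
    using integrable_exp_dist[of "2 * \<gamma> / r" "z i0"] \<gamma>(1) r by simp
qed

lemma res_L2: "res \<in> L2 M"
proof (rule L2_bound[OF L2_cmult[OF GG_L2] res_measurable])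
  show "\<bar>res x\<bar> \<le> \<bar>E * GG x\<bar>" for x
    using res_bound[of x] by linarith
qed

lemma res_integrable: "integrable M res"
proof (rule Bochner_Integration.integrable_bound[OF _ res_measurable])
  show "integrable M (\<lambda>x. E * GG x)" using GG_integrable by simp
  show "AE x in M. norm (res x) \<le> norm (E * GG x)"
    using res_bound by (auto intro: order_trans[OF _ abs_ge_self])
qed

lemma hh_res_L2: "(\<lambda>n. l2n M (\<lambda>x. res x - hh n x)) \<longlonglongrightarrow> 0"
proof (rule Lim_null_comparison)
  let ?C = "D / bes / (1 - \<omega>)"
  have C: "?C \<ge> 0" using D_nonneg bes_pos \<omega>(2) by simp
  show "\<forall>\<^sub>F n in sequentially. norm (l2n M (\<lambda>x. res x - hh n x)) \<le> ?C * \<omega> ^ n * l2n M GG"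
  proof (intro always_eventually allI)
    fix n
    have "l2n M (\<lambda>x. res x - hh n x) \<le> l2n M (\<lambda>x. (?C * \<omega> ^ n) * GG x)"
    proof (rule l2n_mono[OF L2_cmult[OF GG_L2] L2_measurable[OF L2_diff[OF res_L2 hh_L2]]])
      show "\<bar>res x - hh n x\<bar> \<le> \<bar>?C * \<omega> ^ n * GG x\<bar>" for x
        using res_tail[of x n] by linarith
    qed
    also have "\<dots> = ?C * \<omega> ^ n * l2n M GG"
      unfolding l2n_cmult using C \<omega>(1) by (simp only: abs_of_nonneg mult_nonneg_nonneg zero_le_power less_imp_le)
    finally show "norm (l2n M (\<lambda>x. res x - hh n x)) \<le> ?C * \<omega> ^ n * l2n M GG"
      by simp
  qed
  have "(\<lambda>n. ?C * \<omega> ^ n * l2n M GG) \<longlonglongrightarrow> ?C * 0 * l2n M GG"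
    using \<omega> by (intro tendsto_intros LIMSEQ_power_zero) auto
  then show "(\<lambda>n. ?C * \<omega> ^ n * l2n M GG) \<longlonglongrightarrow> 0" by simp
qed

lemma res_orthogonal:
  assumes i: "i \<in> S"
  shows "ip res (f i) = 0"
proof -
  have fL: "f i \<in> L2 M" using i S by (intro f_L2) auto
  have "(\<lambda>n. ip res (f i) - ip (hh n) (f i)) \<longlonglongrightarrow> 0"
  proof (rule Lim_null_comparison)
    show "\<forall>\<^sub>F n in sequentially. norm (ip res (f i) - ip (hh n) (f i)) \<le> l2n M (\<lambda>x. res x - hh n x) * l2n M (f i)"
    proof (intro always_eventually allI)
      fix n
      have "ip res (f i) - ip (hh n) (f i) = ip (\<lambda>x. res x - hh n x) (f i)"
        using L2_mult_integrable[OF res_L2 fL] L2_mult_integrable[OF hh_L2[of n] fL]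
        by (simp add: left_diff_distrib)
      then show "norm (ip res (f i) - ip (hh n) (f i)) \<le> l2n M (\<lambda>x. res x - hh n x) * l2n M (f i)"
        using L2_CS[OF L2_diff[OF res_L2 hh_L2[of n]] fL] by simp
    qed
    show "(\<lambda>n. l2n M (\<lambda>x. res x - hh n x) * l2n M (f i)) \<longlonglongrightarrow> 0"
      using tendsto_mult_right[OF hh_res_L2, of "l2n M (f i)"] by simp
  qed
  moreover have "(\<lambda>n. ip (hh n) (f i)) \<longlonglongrightarrow> 0"
  proof (rule Lim_null_comparison)
    show "\<forall>\<^sub>F n in sequentially. norm (ip (hh n) (f i)) \<le> c1 * sqrt \<theta> ^ n"
      using coefficient_decay[OF i] by simp
    show "(\<lambda>n. c1 * sqrt \<theta> ^ n) \<longlonglongrightarrow> 0"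
      using \<theta> by (intro tendsto_mult_right_zero LIMSEQ_power_zero) auto
  qed
  ultimately have "(\<lambda>n. (ip res (f i) - ip (hh n) (f i)) + ip (hh n) (f i)) \<longlonglongrightarrow> 0 + 0"
    by (rule tendsto_add)
  then show ?thesis by (simp add: LIMSEQ_const_iff)
qed

text \<open>What matters is that the coefficient of \<open>f i0\<close> stays 1 throughout;
  \<open>res_cspan\<close> and \<open>res_lower\<close> both rest on this.\<close>

lemma hh_form: "\<exists>c. \<forall>x. hh n x = f i0 x - (\<Sum>i\<in>Sn n. c i * f i x)"
proof (induction n)
  case 0
  show ?case by (intro exI[of _ "\<lambda>_. 0"]) simp
next
  case (Suc n)
  then obtain c where c: "\<And>x. hh n x = f i0 x - (\<Sum>i\<in>Sn n. c i * f i x)" by blast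
  define d where "d i = (if i \<in> Sn n then c i + 1 / bes * ip (hh n) (f i) else 0)" for i
  have "hh (Suc n) x = f i0 x - (\<Sum>i\<in>Sn (Suc n). d i * f i x)" for x
  proof -
    have "(\<Sum>i\<in>Sn (Suc n). d i * f i x) = (\<Sum>i\<in>Sn n. d i * f i x)"
      using finite_Sn Sn_mono[of n "Suc n"] by (intro sum.mono_neutral_right) (auto simp: d_def)
    also have "\<dots> = (\<Sum>i\<in>Sn n. (c i + 1 / bes * ip (hh n) (f i)) * f i x)"
      by (intro sum.cong) (auto simp: d_def)
    also have "\<dots> = (\<Sum>i\<in>Sn n. c i * f i x) + 1 / bes * uu n x"
      unfolding uu_def by (simp add: distrib_right sum.distrib sum_distrib_left mult.assoc)
    finally show ?thesis unfolding hh_Suc c by simp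
  qed
  then show ?case by blast
qed

lemma res_cspan: "(\<lambda>x. f i0 x - res x) \<in> cspan M (f ` S)"
proof (rule cspan.lim)
  show "(\<lambda>x. f i0 x - res x) \<in> L2 M" by (intro L2_diff f_L2 i0 res_L2)
  show "\<forall>e>0. \<exists>h. h \<in> cspan M (f ` S) \<and> l2n M (\<lambda>x. f i0 x - res x - h x) < e"
  proof (intro allI impI)
    fix e :: real assume "e > 0"
    then obtain n where n: "l2n M (\<lambda>x. res x - hh n x) < e"
      using order_tendstoD(2)[OF hh_res_L2] eventually_happens'[OF sequentially_bot] by blast
    obtain c where c: "\<And>x. hh n x = f i0 x - (\<Sum>i\<in>Sn n. c i * f i x)" using hh_form by blast
    have "(\<lambda>x. f i0 x - res x - (\<Sum>i\<in>Sn n. c i * f i x)) = (\<lambda>x. hh n x - res x)"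
      by (auto simp: c)
    moreover have "(\<lambda>x. \<Sum>i\<in>Sn n. c i * f i x) \<in> cspan M (f ` S)"
      using Sn_subset(2)[of n] by (intro cspan_sum cspan.base) auto
    ultimately show "\<exists>h. h \<in> cspan M (f ` S) \<and> l2n M (\<lambda>x. f i0 x - res x - h x) < e"
      using n by (intro exI[of _ "\<lambda>x. \<Sum>i\<in>Sn n. c i * f i x"]) (simp add: l2n_minus_commute[of M "hh n"])
  qed
qed

text \<open>By \<open>hh_form\<close> the coefficient of \<open>f i0\<close> contributes 1 to the
  coefficient sum, so each iterate has squared norm at least \<open>A\<close>, and this survives the
  limit. Normalising the residual therefore costs only a uniform constant.\<close>

lemma res_lower: "A \<le> sq res"
proof -
  have "sqrt A \<le> l2n M (hh n)" for n
  proof -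
    obtain c where c: "\<And>x. hh n x = f i0 x - (\<Sum>i\<in>Sn n. c i * f i x)" using hh_form by blast
    define d where "d i = (if i = i0 then 1 else - c i)" for i
    have n0: "i0 \<notin> Sn n" using i0 Sn_subset by auto
    have "hh n x = (\<Sum>i\<in>insert i0 (Sn n). d i * f i x)" for x
    proof -
      have "(\<Sum>i\<in>Sn n. d i * f i x) = (\<Sum>i\<in>Sn n. - (c i * f i x))"
        using n0 by (intro sum.cong) (auto simp: d_def)
      then show ?thesis using n0 finite_Sn by (simp add: c d_def sum_negf)
    qed
    moreover have "A * (d i0)\<^sup>2 \<le> A * (\<Sum>i\<in>insert i0 (Sn n). (d i)\<^sup>2)"
      using A finite_Sn by (intro mult_left_mono member_le_sum) auto
    moreover have "A * (\<Sum>i\<in>insert i0 (Sn n). (d i)\<^sup>2)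
        \<le> (\<integral>x. (\<Sum>i\<in>insert i0 (Sn n). d i * f i x)\<^sup>2 \<partial>M)"
      using Sn_subset i0 finite_Sn by (intro riesz_lower) auto
    ultimately have "A \<le> sq (hh n)" by (simp add: d_def)
    then show ?thesis unfolding l2n_def by (rule real_sqrt_le_mono)
  qed
  then have "sqrt A \<le> l2n M res + l2n M (\<lambda>x. res x - hh n x)" for n
    using l2n_triangle[OF res_L2 L2_diff[OF hh_L2[of n] res_L2]] order_trans
    by (fastforce simp: l2n_minus_commute[of M "hh n"])
  moreover have "(\<lambda>n. l2n M res + l2n M (\<lambda>x. res x - hh n x)) \<longlonglongrightarrow> l2n M res + 0"
    by (intro tendsto_intros hh_res_L2)
  ultimately have "sqrt A \<le> l2n M res" by (auto intro: LIMSEQ_le_const)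
  then have "(sqrt A)\<^sup>2 \<le> (l2n M res)\<^sup>2" using A by (intro power_mono) auto
  then show ?thesis using A by (simp add: l2n_square)
qed

end

end

section \<open>The new splines of one level\<close>

lemma sum_bool_times:
  assumes "finite (J :: (bool \<times> 'b) set)"
  shows "(\<Sum>i\<in>J. g i) = (\<Sum>a\<in>{a. (False, a) \<in> J}. g (False, a)) + (\<Sum>b\<in>{b. (True, b) \<in> J}. (g (True, b) :: real))"
proof -
  have eq: "J = Pair False ` {a. (False, a) \<in> J} \<union> Pair True ` {b. (True, b) \<in> J}"
    by (auto simp: image_iff) (metis (full_types))
  have fin: "finite (Pair b ` {a. (b, a) \<in> J})" for b
    using assms by (rule finite_subset[rotated]) auto
  have "(\<Sum>i\<in>J. g i) = (\<Sum>i\<in>Pair False ` {a. (False, a) \<in> J}. g i)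
      + (\<Sum>i\<in>Pair True ` {b. (True, b) \<in> J}. g i)"
    by (subst eq, rule sum.union_disjoint) (use fin in auto)
  then show ?thesis by (simp add: sum.reindex inj_on_def)
qed

context spline
begin

lemma hoe1: "1 \<le> hoe"
proof -
  obtain a :: 'a where "a \<in> net (rr 0)" using net_cover[of "rr 0"] by auto
  then show ?thesis by (rule hoe_ge)
qed

lemma spl_L2: "a \<in> net (rr j) \<Longrightarrow> spl j a \<in> L2 M"
  using bounded_support_L2[OF spl_measurable spl_abs spl_zero] by blast

section \<open>The two-level family and its Riesz bounds\<close>

definition child :: "int \<Rightarrow> 'a \<Rightarrow> 'a" where
  "child k a = (SOME \<gamma>. \<gamma> \<in> net (rr (k + 1)) \<and> dist a \<gamma> < rr (k + 1))"

definition YY :: "int \<Rightarrow> 'a set" where "YY k = net (rr (k + 1)) - child k ` net (rr k)"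

text \<open>The tag distinguishes old from new splines, since a point may belong to the nets of both
  levels.\<close>

definition II :: "int \<Rightarrow> (bool \<times> 'a) set" where
  "II k = {False} \<times> net (rr k) \<union> {True} \<times> YY k"

definition ff :: "int \<Rightarrow> bool \<times> 'a \<Rightarrow> 'a \<Rightarrow> real" where
  "ff k i x = (if fst i then spl (k + 1) (snd i) x else spl k (snd i) x) / sqrt (vol (snd i) (rr k))"

text \<open>\<open>kap\<close> compares a ball of radius \<open>rr k\<close> with one of radius
  \<open>rr (k + 1) / 8\<close>; \<open>N'\<close> bounds the number of fine net points within
  \<open>2 * rr k\<close>, and \<open>N5\<close> counts the centres of both levels within
  \<open>5 * rr k\<close>.\<close>

definition kap :: real where "kap = (32 / \<delta>) ^ p"
definition N' :: real where "N' = (16 / \<delta> + 2) ^ p"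
definition A5 :: real where "A5 = 1 / (kap * (3 + 2 * N' * 6 ^ p))"
definition B5 :: real where "B5 = hoe / \<delta>"
definition N5 :: real where "N5 = 42 ^ p + (40 / \<delta> + 2) ^ p"

lemma child: "child k a \<in> net (rr (k + 1))" "dist a (child k a) < rr (k + 1)"
proof -
  have "\<exists>\<gamma>. \<gamma> \<in> net (rr (k + 1)) \<and> dist a \<gamma> < rr (k + 1)" using net_cover[of "rr (k + 1)" a] by auto
  from someI_ex[OF this] show "child k a \<in> net (rr (k + 1))" "dist a (child k a) < rr (k + 1)"
    unfolding child_def by auto
qed

lemma child_inj: "inj_on (child k) (net (rr k))"
proof (rule inj_onI)
  fix a b assume a: "a \<in> net (rr k)" "b \<in> net (rr k)" "child k a = child k b"
  have "dist a b < 2 * rr (k + 1)"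
    using child(2)[of a k] child(2)[of b k] a(3) dist_triangle2[of a b "child k a"] by simp
  then have "dist a b < rr k" using rr_Suc_le[of k] rr_pos[of k] by linarith
  then show "a = b" using net_separated[of "rr k" a b] a by fastforce
qed

lemma pu_child:
  assumes "a \<in> net (rr k)" "a' \<in> net (rr k)"
  shows "pu (rr k) a' (child k a) = (if a' = a then 1 else 0)"
proof -
  have "rr (k + 1) < rr k / 4" using rr_Suc_le[of k] rr_pos[of k] by linarith
  then have "dist (child k a) a < rr k / 4" using child(2)[of a k] by (simp add: dist_commute)
  then show ?thesis using assms pu_one[of "rr k"] pu_other[of "rr k" a] by auto
qed

lemma YY_net: "b \<in> YY k \<Longrightarrow> b \<in> net (rr (k + 1))"
  by (simp add: YY_def)

lemma kap_pos: "0 < kap" and N'_pos: "0 < N'" and A5_pos: "0 < A5"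
proof -
  show k: "0 < kap" using \<delta> by (simp add: kap_def)
  have "0 < 16 / \<delta> + 2" using \<delta>(1) by (simp add: add_pos_pos)
  then show n: "0 < N'" unfolding N'_def by (rule zero_less_power)
  show "0 < A5" unfolding A5_def using k n by (intro divide_pos_pos mult_pos_pos add_pos_pos) auto
qed

text \<open>On a small ball about a fine net point the combination is constant. The values at
  children give the old coefficients; the values at new points, after subtraction of the old part,
  give the new ones.\<close>

lemma riesz_lower_level:
  assumes J: "finite J" "J \<subseteq> II k"
  shows "A5 * (\<Sum>i\<in>J. (c i)\<^sup>2) \<le> (\<integral>x. (\<Sum>i\<in>J. c i * ff k i x)\<^sup>2 \<partial>M)"
proof -
  define m where "m x = vol x (rr k)" for x
  define w where "w x = vol x (rr (k + 1) / 8)" for x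
  define J0 where "J0 = {a. (False, a) \<in> J}"
  define J1 where "J1 = {b. (True, b) \<in> J}"
  define h where "h a = c (False, a) / sqrt (m a)" for a
  define d where "d b = c (True, b) / sqrt (m b)" for b
  define u where "u x = (\<Sum>a\<in>J0. h a * spl k a x) + (\<Sum>b\<in>J1. d b * spl (k + 1) b x)" for x
  define P where "P \<gamma> = (\<Sum>a\<in>J0. h a * pu (rr k) a \<gamma>)" for \<gamma>
  define e where "e \<gamma> = P \<gamma> + (if \<gamma> \<in> J1 then d \<gamma> else 0)" for \<gamma>
  define Q where "Q = sq u"
  have m_pos: "m x > 0" for x unfolding m_def by (rule ball_pos) simp
  have w_nonneg: "0 \<le> w x" for x by (simp add: w_def)
  have J0: "finite J0" "J0 \<subseteq> net (rr k)"
  proof -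
    have "J0 \<subseteq> snd ` J" by (force simp: J0_def)
    then show "finite J0" using J(1) finite_surj by blast
    show "J0 \<subseteq> net (rr k)" using J(2) by (auto simp: J0_def II_def)
  qed
  have J1: "finite J1" "J1 \<subseteq> YY k" "J1 \<subseteq> net (rr (k + 1))"
  proof -
    have "J1 \<subseteq> snd ` J" by (force simp: J1_def)
    then show "finite J1" using J(1) finite_surj by blast
    show "J1 \<subseteq> YY k" using J(2) by (auto simp: J1_def II_def)
    then show "J1 \<subseteq> net (rr (k + 1))" using YY_net by blast
  qed
  have u_eq: "(\<Sum>i\<in>J. c i * ff k i x) = u x" for x
    unfolding sum_bool_times[OF J(1)] u_def J0_def J1_def h_def d_def m_def by (simp add: ff_def)
  have uL: "u \<in> L2 M"
    unfolding u_def using J0 J1 by (intro L2_add L2_sum spl_L2) auto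
  have u_const: "u x = e \<gamma>" if \<gamma>: "\<gamma> \<in> net (rr (k + 1))" "dist x \<gamma> < rr (k + 1) / 8" for x \<gamma>
  proof -
    have "(\<Sum>a\<in>J0. h a * spl k a x) = P \<gamma>"
      unfolding P_def using J0 spl_near_child[OF _ \<gamma>] by (intro sum.cong) auto
    moreover have "(\<Sum>b\<in>J1. d b * spl (k + 1) b x) = (\<Sum>b\<in>J1. if b = \<gamma> then d \<gamma> else 0)"
      using J1 spl_one[OF \<gamma>] spl_other[OF \<gamma>] by (intro sum.cong) auto
    ultimately show ?thesis using J1(1) by (simp add: u_def e_def sum.delta)
  qed
  \<comment> \<open>The balls of radius \<open>rr (k + 1) / 8\<close> around these points are
    disjoint and \<open>u\<close> equals \<open>e \<gamma>\<close> on them, so \<open>Q\<close>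
    dominates the weighted sum of the squares of \<open>e\<close>.\<close>
  define \<Gamma> where "\<Gamma> = child k ` J0 \<union> J1"
  have \<Gamma>: "finite \<Gamma>" "\<Gamma> \<subseteq> net (rr (k + 1))" using J0 J1 child by (auto simp: \<Gamma>_def)
  have "(\<Sum>\<gamma>\<in>\<Gamma>. (e \<gamma>)\<^sup>2 * w \<gamma>) = (\<integral>x. (\<Sum>\<gamma>\<in>\<Gamma>. (e \<gamma>)\<^sup>2 * indicator (ball \<gamma> (rr (k + 1) / 8)) x) \<partial>M)"
    using emeasure_ball_finite by (subst Bochner_Integration.integral_sum) (auto simp: w_def)
  also have "\<dots> \<le> Q" unfolding Q_def
  proof (rule integral_mono)
    show "integrable M (\<lambda>x. (u x)\<^sup>2)" by (rule L2_square[OF uL])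
    show "integrable M (\<lambda>x. \<Sum>\<gamma>\<in>\<Gamma>. (e \<gamma>)\<^sup>2 * indicator (ball \<gamma> (rr (k + 1) / 8)) x)"
      using emeasure_ball_finite by (intro Bochner_Integration.integrable_sum) auto
    fix x
    have "(\<Sum>\<gamma>\<in>\<Gamma>. (e \<gamma>)\<^sup>2 * indicator (ball \<gamma> (rr (k + 1) / 8)) x)
        = (\<Sum>\<gamma>\<in>\<Gamma>. (u x)\<^sup>2 * indicator (ball \<gamma> (rr (k + 1) / 8)) x)"
      using \<Gamma> u_const by (intro sum.cong) (auto simp: indicator_def dist_commute)
    also have "\<dots> = (u x)\<^sup>2 * real (card {\<gamma> \<in> \<Gamma>. dist x \<gamma> < rr (k + 1) / 8})"
      using \<Gamma>(1) by (simp add: indicator_def dist_commute sum.If_cases Int_def flip: sum_distrib_left)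
    also have "\<dots> \<le> (u x)\<^sup>2 * 1"
    proof (rule mult_left_mono)
      have "\<gamma> = \<gamma>'" if "\<gamma> \<in> \<Gamma>" "\<gamma>' \<in> \<Gamma>" "dist x \<gamma> < rr (k + 1) / 8" "dist x \<gamma>' < rr (k + 1) / 8" for \<gamma> \<gamma>'
      proof (rule ccontr)
        assume "\<gamma> \<noteq> \<gamma>'"
        then have "rr (k + 1) \<le> dist \<gamma> \<gamma>'" using that \<Gamma> by (intro net_separated) auto
        then show False using that dist_triangle3[of \<gamma> \<gamma>' x] rr_pos[of "k + 1"] by linarith
      qed
      then have "card {\<gamma> \<in> \<Gamma>. dist x \<gamma> < rr (k + 1) / 8} \<le> Suc 0"
        using \<Gamma>(1) by (subst card_le_Suc0_iff_eq) auto
      then show "real (card {\<gamma> \<in> \<Gamma>. dist x \<gamma> < rr (k + 1) / 8}) \<le> 1" by simp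
    qed simp
    finally show "(\<Sum>\<gamma>\<in>\<Gamma>. (e \<gamma>)\<^sup>2 * indicator (ball \<gamma> (rr (k + 1) / 8)) x) \<le> (u x)\<^sup>2" by simp
  qed
  also have "(\<Sum>\<gamma>\<in>\<Gamma>. (e \<gamma>)\<^sup>2 * w \<gamma>) = (\<Sum>\<gamma>\<in>child k ` J0. (e \<gamma>)\<^sup>2 * w \<gamma>) + (\<Sum>\<gamma>\<in>J1. (e \<gamma>)\<^sup>2 * w \<gamma>)"
    unfolding \<Gamma>_def using J0 J1 by (intro sum.union_disjoint) (auto simp: YY_def)
  also have "(\<Sum>\<gamma>\<in>child k ` J0. (e \<gamma>)\<^sup>2 * w \<gamma>) = (\<Sum>a\<in>J0. (h a)\<^sup>2 * w (child k a))"
  proof -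
    \<comment> \<open>The triangular structure: at a child every old function except that of its
      parent vanishes, and children carry no new spline.\<close>
    have "e (child k a) = h a" if "a \<in> J0" for a
    proof -
      have "child k a \<notin> J1" using J1 J0 that by (auto simp: YY_def)
      moreover have "P (child k a) = (\<Sum>a'\<in>J0. if a' = a then h a else 0)"
        unfolding P_def using J0(2) that pu_child[of a k] by (intro sum.cong) (auto simp: subset_iff)
      ultimately show ?thesis using J0(1) that by (simp add: e_def sum.delta)
    qed
    then show ?thesis using child_inj inj_on_subset[OF _ J0(2)] by (subst sum.reindex) auto
  qed
  finally have Q1: "(\<Sum>a\<in>J0. (h a)\<^sup>2 * w (child k a)) + (\<Sum>\<gamma>\<in>J1. (e \<gamma>)\<^sup>2 * w \<gamma>) \<le> Q" .
  have n1: "0 \<le> (\<Sum>a\<in>J0. (h a)\<^sup>2 * w (child k a))" "0 \<le> (\<Sum>\<gamma>\<in>J1. (e \<gamma>)\<^sup>2 * w \<gamma>)"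
    using w_nonneg by (auto intro!: sum_nonneg)
  have mw: "m a \<le> kap * w \<gamma>" if "dist a \<gamma> \<le> rr k" for a \<gamma>
  proof -
    have "m a \<le> (2 * (16 / \<delta>)) ^ p * w \<gamma>" unfolding m_def w_def
    proof (rule ball_growth)
      show "dist \<gamma> a + rr k \<le> 16 / \<delta> * (rr (k + 1) / 8)"
        using that \<delta> by (simp add: rr_Suc dist_commute)
    qed (use \<delta> in auto)
    then show ?thesis by (simp add: kap_def)
  qed
  have "rr (k + 1) \<le> rr k" using rr_Suc_le[of k] rr_pos[of k] by linarith
  then have dc: "dist a (child k a) \<le> rr k" for a using child(2)[of a k] by linarith
  have h2: "(\<Sum>a\<in>J0. (h a)\<^sup>2 * m a) \<le> kap * Q"
  proof -
    have "(\<Sum>a\<in>J0. (h a)\<^sup>2 * m a) \<le> (\<Sum>a\<in>J0. (h a)\<^sup>2 * (kap * w (child k a)))"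
      by (intro sum_mono mult_left_mono mw dc) auto
    also have "\<dots> = kap * (\<Sum>a\<in>J0. (h a)\<^sup>2 * w (child k a))" by (simp add: sum_distrib_left mult_ac)
    also have "\<dots> \<le> kap * Q" using Q1 n1 kap_pos by (intro mult_left_mono) auto
    finally show ?thesis .
  qed
  \<comment> \<open>Cauchy--Schwarz with the weights \<open>pu (rr k) a b\<close>, whose sum over
    \<open>a\<close> is at most 1.\<close>
  have P2: "(P b)\<^sup>2 \<le> (\<Sum>a\<in>J0. (h a)\<^sup>2 * pu (rr k) a b)" for b
  proof -
    have nn: "0 \<le> pu (rr k) a b" for a by (rule pu_nonneg) simp
    have "(P b)\<^sup>2 = (\<Sum>a\<in>J0. (h a * sqrt (pu (rr k) a b)) * sqrt (pu (rr k) a b))\<^sup>2"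
      unfolding P_def using nn by (simp add: mult.assoc)
    also have "\<dots> \<le> (\<Sum>a\<in>J0. (h a * sqrt (pu (rr k) a b))\<^sup>2) * (\<Sum>a\<in>J0. (sqrt (pu (rr k) a b))\<^sup>2)"
      by (rule Cauchy_Schwarz_ineq_sum)
    also have "\<dots> = (\<Sum>a\<in>J0. (h a)\<^sup>2 * pu (rr k) a b) * (\<Sum>a\<in>J0. pu (rr k) a b)"
      using nn by (simp add: power_mult_distrib)
    also have "\<dots> \<le> (\<Sum>a\<in>J0. (h a)\<^sup>2 * pu (rr k) a b) * 1"
      using nn J0 by (intro mult_left_mono sum_pu_le_1 sum_nonneg) auto
    finally show ?thesis by simp
  qed
  \<comment> \<open>The column sums for a Schur test: at most \<open>N'\<close> fine points see
    \<open>a\<close>, each with a volume comparable to that at \<open>a\<close>.\<close>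
  have inner: "(\<Sum>b\<in>J1. pu (rr k) a b * m b) \<le> N' * (6 ^ p * m a)" if a: "a \<in> J0" for a
  proof -
    let ?J = "{b \<in> J1. dist a b < 2 * rr k}"
    have "(\<Sum>b\<in>J1. pu (rr k) a b * m b) = (\<Sum>b\<in>?J. pu (rr k) a b * m b)"
    proof (rule sum.mono_neutral_right)
      show "\<forall>b\<in>J1 - ?J. pu (rr k) a b * m b = 0"
      proof
        fix b assume "b \<in> J1 - ?J"
        then have "2 * rr k \<le> dist b a" by (auto simp: dist_commute)
        then have "3 / 2 * rr k \<le> dist b a" using rr_pos[of k] by linarith
        then show "pu (rr k) a b * m b = 0" using pu_zero[of "rr k"] by simp
      qed
    qed (use J1 in auto)
    also have "\<dots> \<le> (\<Sum>b\<in>?J. 1 * (6 ^ p * m a))"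
    proof (intro sum_mono mult_mono)
      fix b assume b: "b \<in> ?J"
      show "pu (rr k) a b \<le> 1" using a J0 by (intro pu_le_1) auto
      have "m b \<le> (2 * 3) ^ p * m a" unfolding m_def using b by (intro ball_growth) auto
      then show "m b \<le> 6 ^ p * m a" by simp
    qed (use m_pos less_imp_le in auto)
    also have "\<dots> = real (card ?J) * (6 ^ p * m a)" by simp
    also have "\<dots> \<le> N' * (6 ^ p * m a)"
    proof (rule mult_right_mono)
      have "2 * rr k = 2 / \<delta> * rr (k + 1)" using \<delta> by (simp add: rr_Suc)
      then have "?J \<subseteq> near (rr (k + 1)) (2 / \<delta> * rr (k + 1)) a" using J1 by (auto simp: near_def)
      then have "card ?J \<le> card (near (rr (k + 1)) (2 / \<delta> * rr (k + 1)) a)" by (intro card_mono) auto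
      moreover have "real (card (near (rr (k + 1)) (2 / \<delta> * rr (k + 1)) a)) \<le> (8 * (2 / \<delta>) + 2) ^ p"
        using \<delta> by (intro card_near) auto
      ultimately show "real (card ?J) \<le> N'" by (simp add: N'_def)
    qed (use m_pos[of a] in simp)
    finally show ?thesis .
  qed
  have "(\<Sum>b\<in>J1. (P b)\<^sup>2 * m b) \<le> (\<Sum>b\<in>J1. (\<Sum>a\<in>J0. (h a)\<^sup>2 * pu (rr k) a b) * m b)"
    using m_pos less_imp_le by (intro sum_mono mult_right_mono P2) auto
  also have "\<dots> = (\<Sum>b\<in>J1. \<Sum>a\<in>J0. (h a)\<^sup>2 * (pu (rr k) a b * m b))"
    by (simp add: sum_distrib_right mult.assoc)
  also have "\<dots> = (\<Sum>a\<in>J0. \<Sum>b\<in>J1. (h a)\<^sup>2 * (pu (rr k) a b * m b))" by (rule sum.swap)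
  also have "\<dots> = (\<Sum>a\<in>J0. (h a)\<^sup>2 * (\<Sum>b\<in>J1. pu (rr k) a b * m b))"
    by (simp add: sum_distrib_left)
  also have "\<dots> \<le> (\<Sum>a\<in>J0. (h a)\<^sup>2 * (N' * (6 ^ p * m a)))"
    by (intro sum_mono mult_left_mono inner) auto
  also have "\<dots> = N' * 6 ^ p * (\<Sum>a\<in>J0. (h a)\<^sup>2 * m a)" by (simp add: sum_distrib_left mult_ac)
  also have "\<dots> \<le> N' * 6 ^ p * (kap * Q)" using h2 N'_pos by (intro mult_left_mono) auto
  finally have Pm: "(\<Sum>b\<in>J1. (P b)\<^sup>2 * m b) \<le> N' * 6 ^ p * (kap * Q)" .
  \<comment> \<open>New coefficients are values minus old contributions,
    \<open>d b = e b - P b\<close>; adding \<open>h2\<close> explains the constant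
    \<open>3 + 2 * N' * 6 ^ p\<close> in \<open>A5\<close>.\<close>
  have d2: "(\<Sum>b\<in>J1. (d b)\<^sup>2 * m b) \<le> 2 * (kap * Q) + 2 * (N' * 6 ^ p * (kap * Q))"
  proof -
    have "(\<Sum>b\<in>J1. (d b)\<^sup>2 * m b) \<le> (\<Sum>b\<in>J1. 2 * ((e b)\<^sup>2 * (kap * w b)) + 2 * ((P b)\<^sup>2 * m b))"
    proof (rule sum_mono)
      fix b assume "b \<in> J1"
      then have "d b = e b - P b" by (simp add: e_def)
      moreover have "(x - y)\<^sup>2 \<le> 2 * x\<^sup>2 + 2 * y\<^sup>2" for x y :: real
        using zero_le_power2[of "x + y"] by (simp add: power2_eq_square algebra_simps)
      ultimately have "(d b)\<^sup>2 \<le> 2 * (e b)\<^sup>2 + 2 * (P b)\<^sup>2" by simp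
      then have "(d b)\<^sup>2 * m b \<le> (2 * (e b)\<^sup>2 + 2 * (P b)\<^sup>2) * m b"
        using m_pos[of b] by (intro mult_right_mono) auto
      also have "\<dots> \<le> 2 * ((e b)\<^sup>2 * (kap * w b)) + 2 * ((P b)\<^sup>2 * m b)"
        using mult_left_mono[OF mw[of b b], of "(e b)\<^sup>2"] less_imp_le[OF rr_pos] by (simp add: algebra_simps)
      finally show "(d b)\<^sup>2 * m b \<le> 2 * ((e b)\<^sup>2 * (kap * w b)) + 2 * ((P b)\<^sup>2 * m b)" .
    qed
    also have "\<dots> = 2 * (kap * (\<Sum>b\<in>J1. (e b)\<^sup>2 * w b)) + 2 * (\<Sum>b\<in>J1. (P b)\<^sup>2 * m b)"
      by (simp add: sum.distrib sum_distrib_left mult_ac)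
    also have "\<dots> \<le> 2 * (kap * Q) + 2 * (N' * 6 ^ p * (kap * Q))"
      using Q1 n1 kap_pos Pm by (intro add_mono mult_left_mono) auto
    finally show ?thesis .
  qed
  have c2: "(\<Sum>i\<in>J. (c i)\<^sup>2) = (\<Sum>a\<in>J0. (h a)\<^sup>2 * m a) + (\<Sum>b\<in>J1. (d b)\<^sup>2 * m b)"
    unfolding sum_bool_times[OF J(1)] J0_def J1_def h_def d_def
    using less_imp_neq[OF m_pos] less_imp_le[OF m_pos] by (simp add: power_divide)
  have "(\<Sum>i\<in>J. (c i)\<^sup>2) \<le> kap * (3 + 2 * N' * 6 ^ p) * Q"
    unfolding c2 using h2 d2 by (simp add: algebra_simps)
  then have "A5 * (\<Sum>i\<in>J. (c i)\<^sup>2) \<le> A5 * (kap * (3 + 2 * N' * 6 ^ p) * Q)"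
    using A5_pos by (intro mult_left_mono) auto
  also have "\<dots> = Q"
  proof -
    have "0 < kap * (3 + 2 * N' * 6 ^ p)" using kap_pos N'_pos by (intro mult_pos_pos add_pos_pos) auto
    moreover have "1 / X * (X * Q) = Q" if "0 < X" for X :: real using that by simp
    ultimately show ?thesis unfolding A5_def by blast
  qed
  finally show ?thesis by (simp add: Q_def u_eq)
qed

lemma riesz_level: "riesz M p A5 B5 N5 \<eta> (rr k) (II k) snd (ff k)"
proof
  have h: "1 \<le> hoe / \<delta>" "1 \<le> 1 / \<delta>" using hoe1 \<delta> by (auto simp: field_simps)
  show "0 < A5" by (rule A5_pos)
  show "1 \<le> B5" using h by (simp add: B5_def)
  show "1 \<le> N5"
  proof -
    have "1 \<le> (40 / \<delta> + 2) ^ p" using h by (intro one_le_power) auto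
    moreover have "0 \<le> (42::real) ^ p" by simp
    ultimately show ?thesis unfolding N5_def by linarith
  qed
  show "0 < rr k" by simp
  fix i :: "bool \<times> 'a" and x y
  assume i: "i \<in> II k"
  define j where "j = (if fst i then k + 1 else k)"
  define v where "v = sqrt (vol (snd i) (rr k))"
  have v: "v > 0" unfolding v_def using ball_pos[of "rr k" "snd i"] by simp
  have n: "snd i \<in> net (rr j)" using i YY_net by (auto simp: II_def j_def)
  have ff: "ff k i = (\<lambda>x. spl j (snd i) x / v)" by (auto simp: ff_def j_def v_def)
  \<comment> \<open>A new spline lives at the finer scale. Measuring it at scale \<open>rr k\<close>
    multiplies its Hoelder constant by \<open>(1 / \<delta>) powr \<eta>\<close>, at most
    \<open>1 / \<delta>\<close>; hence \<open>B5\<close>.\<close>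
  have rj: "rr j \<le> rr k" "rr k \<le> rr j / \<delta>"
    using rr_Suc_le[of k] rr_pos[of k] \<delta> mult_right_mono[of \<delta> 1 "rr k"]
    by (auto simp: j_def rr_Suc[of k] pos_le_divide_eq mult.commute)
  show "ff k i \<in> borel_measurable M" unfolding ff using spl_measurable[OF n] by measurable
  show "\<bar>ff k i x\<bar> \<le> B5 / sqrt (vol (snd i) (rr k))"
  proof -
    have "\<bar>spl j (snd i) x\<bar> / \<bar>v\<bar> \<le> hoe / \<delta> / v"
      using spl_abs[OF n, of x] h v unfolding abs_of_pos[OF v] by (intro divide_right_mono) linarith+
    then show ?thesis unfolding ff v_def[symmetric] B5_def abs_divide .
  qed
  show "ff k i x = 0" if "2 * rr k \<le> dist x (snd i)"
    unfolding ff using spl_zero[OF n, of x] that rj by simp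
  show "\<bar>ff k i x - ff k i y\<bar> \<le> B5 / sqrt (vol (snd i) (rr k)) * (dist x y / rr k) powr \<eta>"
  proof -
    have "\<bar>spl j (snd i) x - spl j (snd i) y\<bar> \<le> hoe * (dist x y / rr j) powr \<eta>" by (rule spl_hoelder[OF n])
    also have "\<dots> \<le> hoe * ((1 / \<delta>) powr \<eta> * (dist x y / rr k) powr \<eta>)"
    proof -
      have "1 / rr j \<le> 1 / \<delta> * (1 / rr k)" using rj(2) \<delta> rr_pos[of k] rr_pos[of j]
        by (simp add: field_simps del: rr_pos)
      then have "dist x y * (1 / rr j) \<le> dist x y * (1 / \<delta> * (1 / rr k))" by (intro mult_left_mono) auto
      then have "dist x y / rr j \<le> 1 / \<delta> * (dist x y / rr k)" by simp
      then have "(dist x y / rr j) powr \<eta> \<le> (1 / \<delta> * (dist x y / rr k)) powr \<eta>"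
        using \<eta> less_imp_le[OF rr_pos[of j]] by (intro powr_mono2) auto
      also have "\<dots> = (1 / \<delta>) powr \<eta> * (dist x y / rr k) powr \<eta>"
        by (rule powr_mult)
      finally show ?thesis using hoe1 by (intro mult_left_mono) auto
    qed
    also have "\<dots> \<le> hoe * (1 / \<delta> * (dist x y / rr k) powr \<eta>)"
    proof (intro mult_left_mono mult_right_mono)
      show "(1 / \<delta>) powr \<eta> \<le> 1 / \<delta>" using powr_mono[of \<eta> 1 "1 / \<delta>"] \<eta> h \<delta> by simp
    qed (use hoe1 in auto)
    finally have "\<bar>spl j (snd i) x - spl j (snd i) y\<bar> / v \<le> B5 * (dist x y / rr k) powr \<eta> / v"
      using v by (intro divide_right_mono) (auto simp: B5_def)
    moreover have "\<bar>ff k i x - ff k i y\<bar> = \<bar>spl j (snd i) x - spl j (snd i) y\<bar> / v"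
      using v by (simp add: ff abs_divide flip: diff_divide_distrib)
    ultimately show ?thesis unfolding v_def[symmetric] by simp
  qed
next
  have sub: "{i \<in> II k. dist x (snd i) < R}
      \<subseteq> Pair False ` near (rr k) R x \<union> Pair True ` near (rr (k + 1)) R x" for x R
    using YY_net by (auto simp: II_def near_def)
  have fin: "finite (Pair False ` near (rr k) R x \<union> Pair True ` near (rr (k + 1)) R x)" for R x
    by simp
  show "finite {i \<in> II k. dist x (snd i) < R}" for x R using sub fin by (rule finite_subset)
  fix x
  have "card {i \<in> II k. dist x (snd i) < 5 * rr k}
      \<le> card (Pair False ` near (rr k) (5 * rr k) x \<union> Pair True ` near (rr (k + 1)) (5 * rr k) x)"
    using sub fin by (intro card_mono) auto
  also have "\<dots> \<le> card (Pair False ` near (rr k) (5 * rr k) x) + card (Pair True ` near (rr (k + 1)) (5 * rr k) x)"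
    by (rule card_Un_le)
  also have "\<dots> \<le> card (near (rr k) (5 * rr k) x) + card (near (rr (k + 1)) (5 * rr k) x)"
    by (intro add_mono card_image_le) auto
  finally have "real (card {i \<in> II k. dist x (snd i) < 5 * rr k})
      \<le> real (card (near (rr k) (5 * rr k) x)) + real (card (near (rr (k + 1)) (5 * rr k) x))"
    by (simp flip: of_nat_add)
  also have "\<dots> \<le> (8 * 5 + 2) ^ p + (8 * (5 / \<delta>) + 2) ^ p"
  proof (rule add_mono)
    show "real (card (near (rr k) (5 * rr k) x)) \<le> (8 * 5 + 2) ^ p" by (rule card_near) auto
    have "5 * rr k = 5 / \<delta> * rr (k + 1)" using \<delta> by (simp add: rr_Suc)
    then show "real (card (near (rr (k + 1)) (5 * rr k) x)) \<le> (8 * (5 / \<delta>) + 2) ^ p"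
      using card_near[of "rr (k + 1)" "5 / \<delta>" x] \<delta> by simp
  qed
  finally show "real (card {i \<in> II k. dist x (snd i) < 5 * rr k}) \<le> N5" by (simp add: N5_def)
next
  show "A5 * (\<Sum>i\<in>J. (c i)\<^sup>2) \<le> (\<integral>x. (\<Sum>i\<in>J. c i * ff k i x)\<^sup>2 \<partial>M)"
    if "finite J" "J \<subseteq> II k" for J c
    using that by (rule riesz_lower_level)
qed

abbreviation earlier :: "int \<Rightarrow> 'a \<Rightarrow> 'a set" where
  "earlier k b \<equiv> {b' \<in> YY k. to_nat_on (YY k) b' < to_nat_on (YY k) b}"

text \<open>The clause with \<open>t\<close> records that the wavelet is a nonzero multiple of the
  new spline modulo earlier functions, so that the spline can be recovered from the
  wavelets.\<close>

definition is_wavelet :: "real \<Rightarrow> real \<Rightarrow> int \<Rightarrow> 'a \<Rightarrow> ('a \<Rightarrow> real) \<Rightarrow> bool" where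
  "is_wavelet E \<gamma> k b \<psi> \<longleftrightarrow> \<psi> \<in> L2 M \<and> integrable M \<psi> \<and>
    (\<forall>x. \<bar>\<psi> x\<bar> \<le> E / sqrt (vol b (rr k)) * exp (- \<gamma> * (dist x b / rr k))) \<and>
    (\<forall>x y. dist x y \<le> rr k \<longrightarrow> \<bar>\<psi> x - \<psi> y\<bar> \<le> E / sqrt (vol b (rr k)) *
      exp (- \<gamma> * (dist x b / rr k)) * (dist x y / rr k) powr \<eta>) \<and>
    (\<forall>a\<in>net (rr k). (\<integral>x. \<psi> x * spl k a x \<partial>M) = 0) \<and>
    (\<forall>b'\<in>earlier k b. (\<integral>x. \<psi> x * spl (k + 1) b' x \<partial>M) = 0) \<and>
    (\<exists>t. t \<noteq> 0 \<and> (\<lambda>x. t * spl (k + 1) b x - \<psi> x) \<in>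
      cspan M (spl k ` net (rr k) \<union> spl (k + 1) ` earlier k b)) \<and>
    (\<integral>x. (\<psi> x)\<^sup>2 \<partial>M) = 1"

text \<open>Gram--Schmidt with respect to the splines at level k followed by an enumeration of the new
  splines at level k + 1.\<close>

lemma wavelets_exist:
  "\<exists>E>0. \<exists>\<gamma>>0. \<forall>k. \<forall>b\<in>YY k. \<exists>\<psi>. is_wavelet E \<gamma> k b \<psi>"
proof -
  \<comment> \<open>Level 0 serves only to name the constants: \<open>E\<close> and \<gamma> depend
    on \<open>p\<close>, \<open>A5\<close>, \<open>B5\<close>, \<open>N5\<close> alone and are
    therefore the same at every level.\<close>
  interpret R: riesz M p A5 B5 N5 \<eta> "rr 0" "II 0" snd "ff 0" by (rule riesz_level)
  have main: "\<exists>\<psi>. is_wavelet (R.E / sqrt A5) R.\<gamma> k b \<psi>" if b: "b \<in> YY k" for k b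
  proof -
    interpret Rk: riesz M p A5 B5 N5 \<eta> "rr k" "II k" snd "ff k" by (rule riesz_level)
    define S where "S = {False} \<times> net (rr k) \<union> {True} \<times> earlier k b"
    have S: "S \<subseteq> II k" "(True, b) \<in> II k" "(True, b) \<notin> S"
      using b by (auto simp: S_def II_def)
    define \<phi> where "\<phi> = Rk.res S (True, b)"
    have G: "R.E * Rk.GG (True, b) x = R.E / sqrt (vol b (rr k)) * exp (- R.\<gamma> * (dist x b / rr k))" for x
      by (simp add: Rk.GG_def[OF S] Rk.v0_def[OF S])
    note \<phi> = Rk.res_L2[OF S] Rk.res_integrable[OF S] Rk.res_bound[OF S, unfolded G]
      Rk.res_hoelder[OF S, unfolded G] Rk.res_orthogonal[OF S] Rk.res_cspan[OF S] Rk.res_lower[OF S]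
    note \<phi> = \<phi>[folded \<phi>_def]
    define n where "n = l2n M \<phi>"
    have n: "sqrt A5 \<le> n" using \<phi>(7) by (simp add: n_def l2n_def)
    have sA: "0 < sqrt A5" using A5_pos by simp
    have n0: "0 < n" using n sA by linarith
    have div_n: "\<bar>a / n\<bar> \<le> R.E / sqrt A5 / c * t" if "\<bar>a\<bar> \<le> R.E / c * t" "0 \<le> c" "0 \<le> t" for a c t
    proof -
      have "\<bar>a / n\<bar> = \<bar>a\<bar> / n" using n0 by (simp add: abs_divide)
      also have "\<dots> \<le> (R.E / c * t) / n" using n0 by (intro divide_right_mono that) auto
      also have "\<dots> \<le> (R.E / c * t) / sqrt A5"
        by (intro divide_left_mono mult_pos_pos n n0 sA) (use that R.E_pos in auto)
      finally show ?thesis by (simp add: mult_ac)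
    qed
    define m where "m i = sqrt (vol (snd i) (rr k))" for i :: "bool \<times> 'a"
    have m: "m i > 0" for i unfolding m_def using ball_pos[of "rr k" "snd i"] by simp
    have ff: "ff k i x = (if fst i then spl (k + 1) (snd i) x else spl k (snd i) x) / m i" for i x
      by (simp add: ff_def m_def)
    show ?thesis
      unfolding is_wavelet_def
    proof (intro exI[of _ "\<lambda>x. 1 / n * \<phi> x"] conjI ballI allI impI)
      show "(\<lambda>x. 1 / n * \<phi> x) \<in> L2 M" by (intro L2_cmult \<phi>)
      show "integrable M (\<lambda>x. 1 / n * \<phi> x)" using \<phi>(2) by simp
      show "\<bar>1 / n * \<phi> x\<bar> \<le> R.E / sqrt A5 / sqrt (vol b (rr k)) * exp (- R.\<gamma> * (dist x b / rr k))" for x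
        using div_n[OF \<phi>(3)[of x]] by simp
      show "\<bar>1 / n * \<phi> x - 1 / n * \<phi> y\<bar> \<le> R.E / sqrt A5 / sqrt (vol b (rr k)) *
        exp (- R.\<gamma> * (dist x b / rr k)) * (dist x y / rr k) powr \<eta>" if "dist x y \<le> rr k" for x y
        using div_n[of "\<phi> x - \<phi> y" "sqrt (vol b (rr k))"
            "exp (- R.\<gamma> * (dist x b / rr k)) * (dist x y / rr k) powr \<eta>"] \<phi>(4)[OF that]
        by (simp add: diff_divide_distrib mult.assoc)
      show "(\<integral>x. 1 / n * \<phi> x * spl k a x \<partial>M) = 0" if "a \<in> net (rr k)" for a
        using \<phi>(5)[of "(False, a)"] that m[of "(False, a)"] by (simp add: ff S_def)
      show "(\<integral>x. 1 / n * \<phi> x * spl (k + 1) b' x \<partial>M) = 0" if "b' \<in> earlier k b" for b'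
        using \<phi>(5)[of "(True, b')"] that m[of "(True, b')"] by (simp add: ff S_def)
      show "(\<integral>x. (1 / n * \<phi> x)\<^sup>2 \<partial>M) = 1"
      proof -
        have "(\<integral>x. (\<phi> x)\<^sup>2 \<partial>M) = n\<^sup>2" unfolding n_def by (rule l2n_square[symmetric])
        then show ?thesis using n0 by (simp add: power_divide)
      qed
      show "\<exists>t. t \<noteq> 0 \<and> (\<lambda>x. t * spl (k + 1) b x - 1 / n * \<phi> x) \<in>
        cspan M (spl k ` net (rr k) \<union> spl (k + 1) ` earlier k b)"
      proof (intro exI conjI)
        show "1 / (n * m (True, b)) \<noteq> 0" using n0 m[of "(True, b)"] by simp
        let ?F = "spl k ` net (rr k) \<union> spl (k + 1) ` earlier k b"
        have "ff k i \<in> cspan M ?F" if "i \<in> S" for i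
        proof -
          have "(if fst i then spl (k + 1) (snd i) else spl k (snd i)) \<in> ?F"
            using that by (auto simp: S_def)
          then have "(\<lambda>x. 1 / m i * (if fst i then spl (k + 1) (snd i) else spl k (snd i)) x) \<in> cspan M ?F"
            by (intro cspan_cmult cspan.base)
          moreover have "(\<lambda>x. 1 / m i * (if fst i then spl (k + 1) (snd i) else spl k (snd i)) x) = ff k i"
            by (auto simp: ff)
          ultimately show ?thesis by simp
        qed
        then have "ff k ` S \<subseteq> cspan M ?F" by (rule image_subsetI)
        then have "(\<lambda>x. ff k (True, b) x - \<phi> x) \<in> cspan M ?F" using \<phi>(6) by (rule cspan_mono)
        then have "(\<lambda>x. 1 / n * (ff k (True, b) x - \<phi> x)) \<in> cspan M ?F" by (rule cspan_cmult)
        then show "(\<lambda>x. 1 / (n * m (True, b)) * spl (k + 1) b x - 1 / n * \<phi> x) \<in> cspan M ?F"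
          by (simp add: ff diff_divide_distrib mult.commute)
      qed
    qed
  qed
  show ?thesis
    by (rule exI[of _ "R.E / sqrt A5"], rule conjI, use R.E_pos A5_pos in simp,
      rule exI[of _ R.\<gamma>]) (use R.\<gamma>(1) main in blast)
qed

end

section \<open>Wavelets\<close>

locale wavelets = spline M p \<delta> \<eta>
  for M :: "'a::metric_space measure" and p :: nat and \<delta> \<eta> :: real +
  fixes E \<gamma> :: real and psi :: "int \<Rightarrow> 'a \<Rightarrow> 'a \<Rightarrow> real"
  assumes E_pos: "0 < E" and \<gamma>_pos: "0 < \<gamma>"
    and psi: "b \<in> YY k \<Longrightarrow> is_wavelet E \<gamma> k b (psi k b)"
begin

lemma
  assumes "b \<in> YY k"
  shows psi_L2: "psi k b \<in> L2 M"
    and psi_integrable: "integrable M (psi k b)"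
    and psi_bound: "\<bar>psi k b x\<bar> \<le> E / sqrt (vol b (rr k)) * exp (- \<gamma> * (dist x b / rr k))"
    and psi_hoelder: "dist x y \<le> rr k \<Longrightarrow>
      \<bar>psi k b x - psi k b y\<bar> \<le> E / sqrt (vol b (rr k)) *
        exp (- \<gamma> * (dist x b / rr k)) * (dist x y / rr k) powr \<eta>"
    and psi_orthogonal_spl: "a \<in> net (rr k) \<Longrightarrow> ip (psi k b) (spl k a) = 0"
    and psi_orthogonal_earlier: "b' \<in> earlier k b \<Longrightarrow>
      ip (psi k b) (spl (k + 1) b') = 0"
    and psi_expansion: "\<exists>t. t \<noteq> 0 \<and> (\<lambda>x. t * spl (k + 1) b x - psi k b x) \<in>
      cspan M (spl k ` net (rr k) \<union> spl (k + 1) ` earlier k b)"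
    and psi_norm: "sq (psi k b) = 1"
  using psi[OF assms] unfolding is_wavelet_def by blast+

section \<open>The multiresolution spaces and orthonormality\<close>

definition VV :: "int \<Rightarrow> ('a \<Rightarrow> real) set" where "VV k = spl k ` net (rr k)"

definition PP :: "int set \<Rightarrow> ('a \<Rightarrow> real) set" where "PP K = (\<Union>k\<in>K. psi k ` YY k)"

lemma VV_L2: "VV k \<subseteq> L2 M" by (auto simp: VV_def spl_L2)

lemma PP_L2: "PP K \<subseteq> L2 M" by (auto simp: PP_def psi_L2)

lemma VV_Suc: "VV k \<subseteq> cspan M (VV (k + 1))"
  unfolding VV_def[of k]
proof (rule image_subsetI)
  fix a assume a: "a \<in> net (rr k)"
  let ?G = "near (rr (k + 1)) (2 * rr k) a"
  have "spl k a = (\<lambda>x. \<Sum>b\<in>?G. pu (rr k) a b * spl (k + 1) b x)"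
    using near_subset_net by (intro ext spl_refine[OF a]) auto
  also have "\<dots> \<in> cspan M (VV (k + 1))"
    by (intro cspan_sum cspan.base) (auto simp: VV_def near_def)
  finally show "spl k a \<in> cspan M (VV (k + 1))" .
qed

lemma VV_mono:
  assumes "j \<le> k"
  shows "VV j \<subseteq> cspan M (VV k)"
  using assms
proof (induction k rule: int_ge_induct)
  case base
  then show ?case by (auto intro: cspan.base)
next
  case (step k)
  show ?case
  proof
    fix g assume "g \<in> VV j"
    then have "g \<in> cspan M (VV k)" using step by blast
    then show "g \<in> cspan M (VV (k + 1))" by (rule cspan_mono[OF VV_Suc])
  qed
qed

lemma psi_cspan:
  assumes b: "b \<in> YY k" and F: "VV k \<union> spl (k + 1) ` insert b (earlier k b) \<subseteq> cspan M F"
  shows "psi k b \<in> cspan M F"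
proof -
  obtain t where t: "(\<lambda>x. t * spl (k + 1) b x - psi k b x) \<in>
      cspan M (spl k ` net (rr k) \<union> spl (k + 1) ` earlier k b)"
    using psi_expansion[OF b] by blast
  have "(\<lambda>x. t * spl (k + 1) b x - psi k b x) \<in> cspan M F"
    by (rule cspan_mono[OF _ t]) (use F in \<open>auto simp: VV_def\<close>)
  moreover have "(\<lambda>x. t * spl (k + 1) b x) \<in> cspan M F"
    using F by (intro cspan_cmult) auto
  ultimately have "(\<lambda>x. t * spl (k + 1) b x - (t * spl (k + 1) b x - psi k b x)) \<in> cspan M F"
    by (rule cspan_diff[rotated])
  then show ?thesis by simp
qed

lemma psi_VV: "b \<in> YY k \<Longrightarrow> psi k b \<in> cspan M (VV (k + 1))"
  using VV_Suc YY_net by (intro psi_cspan) (auto intro: cspan.base simp: VV_def)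

lemma countable_YY: "countable (YY k)"
  using countable_net[of "rr (k + 1)"] by (auto simp: YY_def)

text \<open>The earlier wavelet lies in the closed span of old splines and new splines up to its
  own, and the later wavelet is orthogonal to all of these.\<close>

lemma psi_orthogonal_later:
  assumes "b \<in> YY k" "b' \<in> YY k" "to_nat_on (YY k) b' < to_nat_on (YY k) b"
  shows "ip (psi k b) (psi k b') = 0"
proof (rule cspan_orthogonal)
  let ?F = "VV k \<union> spl (k + 1) ` insert b' (earlier k b')"
  show "?F \<subseteq> L2 M"
    using VV_L2 assms(2) by (auto intro!: spl_L2 YY_net)
  show "psi k b' \<in> cspan M ?F" by (intro psi_cspan assms subsetI cspan.base)
  show "psi k b \<in> L2 M" by (intro psi_L2 assms)
  show "ip (psi k b) f = 0" if "f \<in> ?F" for f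
    using that assms psi_orthogonal_spl psi_orthogonal_earlier by (auto simp: VV_def)
qed

text \<open>A wavelet of level \<open>j\<close> lies in the spline space of level
  \<open>j + 1\<close>, hence in that of level \<open>k\<close>.\<close>

lemma psi_orthogonal_coarser:
  assumes "b \<in> YY k" "b' \<in> YY j" "j < k"
  shows "ip (psi k b) (psi j b') = 0"
proof (rule cspan_orthogonal[OF VV_L2])
  have "VV (j + 1) \<subseteq> cspan M (VV k)" using assms by (intro VV_mono) auto
  then show "psi j b' \<in> cspan M (VV k)" using psi_VV[OF assms(2)] by (rule cspan_mono)
  show "psi k b \<in> L2 M" by (intro psi_L2 assms)
  show "ip (psi k b) f = 0" if "f \<in> VV k" for f
    using that assms psi_orthogonal_spl by (auto simp: VV_def)
qed

lemma psi_orthonormal: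
  assumes b: "b \<in> YY k" and b': "b' \<in> YY j"
  shows "ip (psi k b) (psi j b') = (if (k, b) = (j, b') then 1 else 0)"
proof -
  consider "j < k" | "k < j" | "k = j" "b = b'" | "k = j" "b \<noteq> b'" by force
  then show ?thesis
  proof cases
    case 1
    then show ?thesis using psi_orthogonal_coarser[OF b b'] by simp
  next
    case 2
    then show ?thesis using psi_orthogonal_coarser[OF b' b] by (simp add: mult.commute)
  next
    case 3
    then show ?thesis using psi_norm[OF b] by (simp add: power2_eq_square)
  next
    case 4
    have "to_nat_on (YY k) b \<noteq> to_nat_on (YY k) b'"
      using b b' 4 inj_on_to_nat_on[OF countable_YY, of k] by (auto simp: inj_on_def)
    then have "ip (psi k b) (psi k b') = 0"
      using psi_orthogonal_later[of b k b'] psi_orthogonal_later[of b' k b] b b' 4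
      by (cases "to_nat_on (YY k) b' < to_nat_on (YY k) b") (auto simp: mult.commute)
    then show ?thesis using 4 by simp
  qed
qed

text \<open>Strong induction along the enumeration: \<open>psi_expansion\<close> is solved for the
  spline, which is possible because \<open>t\<close> is nonzero.\<close>

lemma spl_new_cspan:
  assumes "b \<in> YY k"
  shows "spl (k + 1) b \<in> cspan M (VV k \<union> psi k ` YY k)"
  using assms
proof (induction "to_nat_on (YY k) b" arbitrary: b rule: less_induct)
  case less
  let ?F = "VV k \<union> psi k ` YY k"
  obtain t where t: "t \<noteq> 0" "(\<lambda>x. t * spl (k + 1) b x - psi k b x) \<in>
      cspan M (spl k ` net (rr k) \<union> spl (k + 1) ` earlier k b)"
    using psi_expansion[OF less.prems] by blast
  have "(\<lambda>x. t * spl (k + 1) b x - psi k b x) \<in> cspan M ?F"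
    by (rule cspan_mono[OF _ t(2)]) (use less.hyps in \<open>auto simp: VV_def intro: cspan.base\<close>)
  moreover have "psi k b \<in> cspan M ?F" using less.prems by (intro cspan.base) auto
  ultimately have "(\<lambda>x. (t * spl (k + 1) b x - psi k b x) + 1 * psi k b x) \<in> cspan M ?F"
    by (rule cspan.add)
  then have "(\<lambda>x. 1 / t * ((t * spl (k + 1) b x - psi k b x) + 1 * psi k b x)) \<in> cspan M ?F"
    by (rule cspan_cmult)
  moreover have "(\<lambda>x. 1 / t * ((t * spl (k + 1) b x - psi k b x) + 1 * psi k b x)) = spl (k + 1) b"
    using t(1) by auto
  ultimately show ?case by simp
qed

lemma VV_Suc_cspan: "VV (k + 1) \<subseteq> cspan M (VV k \<union> psi k ` YY k)"
  unfolding VV_def[of "k + 1"]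
proof (rule image_subsetI)
  let ?F = "VV k \<union> psi k ` YY k"
  fix b assume b: "b \<in> net (rr (k + 1))"
  show "spl (k + 1) b \<in> cspan M ?F"
  proof (cases "b \<in> YY k")
    case False
    then obtain a where a: "a \<in> net (rr k)" "b = child k a" using b by (auto simp: YY_def)
    define G where "G = near (rr (k + 1)) (2 * rr k) a - {b}"
    have G: "finite G" "b \<notin> G" "insert b G \<subseteq> net (rr (k + 1))"
      using near_subset_net b by (auto simp: G_def)
    have zero: "pu (rr k) a \<gamma> = 0" if "\<gamma> \<in> G - YY k" for \<gamma>
    proof -
      obtain a' where ch: "a' \<in> net (rr k)" "\<gamma> = child k a'"
        using \<open>\<gamma> \<in> G - YY k\<close> G(3) by (auto simp: YY_def)
      then show ?thesis using pu_child[OF ch(1) a(1)] that a G(2) by auto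
    qed
    \<comment> \<open>In the refinement relation of the parent the coefficient of its child
      \<open>b\<close> is 1 and that of every other child is 0, so the child spline is the parent
      spline minus new splines.\<close>
    have eq: "spl k a x = spl (k + 1) b x + (\<Sum>\<gamma>\<in>G \<inter> YY k. pu (rr k) a \<gamma> * spl (k + 1) \<gamma> x)" for x
    proof -
      have "spl k a x = (\<Sum>\<gamma>\<in>insert b G. pu (rr k) a \<gamma> * spl (k + 1) \<gamma> x)"
        using G by (intro spl_refine[OF a(1)]) (auto simp: G_def)
      also have "\<dots> = spl (k + 1) b x + (\<Sum>\<gamma>\<in>G. pu (rr k) a \<gamma> * spl (k + 1) \<gamma> x)"
        using G pu_child[OF a(1) a(1)] a(2) by simp
      also have "(\<Sum>\<gamma>\<in>G. pu (rr k) a \<gamma> * spl (k + 1) \<gamma> x)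
          = (\<Sum>\<gamma>\<in>G \<inter> YY k. pu (rr k) a \<gamma> * spl (k + 1) \<gamma> x)"
        using G zero by (intro sum.mono_neutral_right) auto
      finally show ?thesis .
    qed
    have "(\<lambda>x. spl k a x - (\<Sum>\<gamma>\<in>G \<inter> YY k. pu (rr k) a \<gamma> * spl (k + 1) \<gamma> x)) \<in> cspan M ?F"
      using a by (intro cspan_diff cspan_sum spl_new_cspan cspan.base) (auto simp: VV_def)
    then show ?thesis by (simp add: eq)
  qed (rule spl_new_cspan)
qed

lemma VV_cspan: "VV m \<subseteq> cspan M (VV k \<union> PP {k..})"
proof (cases "k \<le> m")
  case True
  then show ?thesis
  proof (induction m rule: int_ge_induct)
    case base
    then show ?case by (auto intro: cspan.base)
  next
    case (step m)
    have sub: "VV m \<union> psi m ` YY m \<subseteq> cspan M (VV k \<union> PP {k..})"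
      using step by (auto simp: PP_def intro: cspan.base)
    show ?case
    proof
      fix g assume "g \<in> VV (m + 1)"
      then have "g \<in> cspan M (VV m \<union> psi m ` YY m)" using VV_Suc_cspan by blast
      then show "g \<in> cspan M (VV k \<union> PP {k..})" by (rule cspan_mono[OF sub])
    qed
  qed
next
  case False
  have sub: "VV k \<subseteq> cspan M (VV k \<union> PP {k..})" by (auto intro: cspan.base)
  show ?thesis
  proof
    fix g assume "g \<in> VV m"
    then have "g \<in> cspan M (VV k)" using VV_mono[of m k] False by auto
    then show "g \<in> cspan M (VV k \<union> PP {k..})" by (rule cspan_mono[OF sub])
  qed
qed

lemma spl_sum_bounds:
  assumes "finite F" "F \<subseteq> net (rr k)"
  shows "0 \<le> (\<Sum>a\<in>F. spl k a x)" "(\<Sum>a\<in>F. spl k a x) \<le> 1"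
proof -
  show "0 \<le> (\<Sum>a\<in>F. spl k a x)" using assms by (intro sum_nonneg spl_bounds) auto
  let ?F = "F \<union> near (rr k) (2 * rr k) x"
  have sub: "?F \<subseteq> net (rr k)" using assms near_subset_net by auto
  have "(\<Sum>a\<in>F. spl k a x) \<le> (\<Sum>a\<in>?F. spl k a x)"
    using assms(1) sub by (intro sum_mono2) (auto intro!: spl_bounds)
  also have "\<dots> = 1" using assms sub by (intro spl_sum) auto
  finally show "(\<Sum>a\<in>F. spl k a x) \<le> 1" .
qed

text \<open>The constant 1 need not be square-integrable, so orthogonality to it is obtained from
  the finite partial sums of the spline partition of unity: they lie between 0 and 1 and are
  eventually 1 at each point.\<close>

lemma psi_mean_zero:
  assumes b: "b \<in> YY k"
  shows "(\<integral>x. psi k b x \<partial>M) = 0"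
proof -
  define F where "F n = near (rr k) (real n) b" for n
  have F: "finite (F n)" "F n \<subseteq> net (rr k)" for n using near_subset_net by (auto simp: F_def)
  define g where "g n x = (\<Sum>a\<in>F n. 1 * spl k a x) * psi k b x" for n x
  have "(\<integral>x. g n x \<partial>M) = (\<Sum>a\<in>F n. 1 * ip (spl k a) (psi k b))" for n
    unfolding g_def using F by (intro integral_sum_mult spl_L2 psi_L2 b) auto
  also have "(\<Sum>a\<in>F n. 1 * ip (spl k a) (psi k b)) = 0" for n
    using F psi_orthogonal_spl[OF b] by (intro sum.neutral) (auto simp: mult.commute)
  finally have g0: "(\<integral>x. g n x \<partial>M) = 0" for n .
  have "(\<lambda>n. \<integral>x. g n x \<partial>M) \<longlonglongrightarrow> (\<integral>x. psi k b x \<partial>M)"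
  proof (rule integral_dominated_convergence[where w = "\<lambda>x. \<bar>psi k b x\<bar>"])
    show "psi k b \<in> borel_measurable M" using psi_L2[OF b] by (rule L2_measurable)
    then show "g n \<in> borel_measurable M" for n
      unfolding g_def using F spl_measurable[of _ k]
      by (intro borel_measurable_times borel_measurable_sum) auto
    show "integrable M (\<lambda>x. \<bar>psi k b x\<bar>)" using psi_integrable[OF b] by simp
    show "AE x in M. (\<lambda>n. g n x) \<longlonglongrightarrow> psi k b x"
    proof (rule AE_I2)
      fix x
      obtain n0 :: nat where n0: "dist x b + 2 * rr k < real n0" using reals_Archimedean2 by blast
      have "g n x = psi k b x" if "n \<ge> n0" for n
      proof -
        have "near (rr k) (2 * rr k) x \<subseteq> near (rr k) (2 * rr k + dist x b) b"
          by (rule near_subset_near) (auto simp: dist_commute)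
        also have "\<dots> \<subseteq> F n" using n0 that by (auto simp: F_def near_def)
        finally have "(\<Sum>a\<in>F n. spl k a x) = 1" using F by (intro spl_sum)
        then show ?thesis by (simp add: g_def)
      qed
      then show "(\<lambda>n. g n x) \<longlonglongrightarrow> psi k b x"
        by (intro tendsto_eventually) (auto simp: eventually_sequentially)
    qed
    show "AE x in M. norm (g n x) \<le> \<bar>psi k b x\<bar>" for n
    proof (rule AE_I2)
      fix x
      have "\<bar>\<Sum>a\<in>F n. 1 * spl k a x\<bar> \<le> 1" using spl_sum_bounds[OF F[of n], of x] by simp
      then show "norm (g n x) \<le> \<bar>psi k b x\<bar>"
        unfolding g_def by (simp add: abs_mult mult_left_le_one_le)
    qed
  qed
  then show ?thesis unfolding g0 by (simp add: LIMSEQ_const_iff)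
qed

section \<open>Density of the spline spaces in the square-integrable functions\<close>

lemma rr_tendsto_zero: "(\<lambda>n. rr (int n)) \<longlonglongrightarrow> 0"
proof -
  have "rr (int n) = \<delta> ^ n" for n by (simp add: rr_def)
  then show ?thesis using \<delta> by (simp add: LIMSEQ_power_zero)
qed

lemma rr_large: "\<exists>n. \<forall>k\<le>- int n. C < rr k"
proof -
  have "1 < 1 / \<delta>" using \<delta> by simp
  then obtain n where n: "C < (1 / \<delta>) ^ n" using real_arch_pow by blast
  have "C < rr k" if k: "k \<le> - int n" for k
  proof -
    have "(1 / \<delta>) ^ n \<le> (1 / \<delta>) ^ nat (- k)"
      using k \<delta> by (intro power_increasing) auto
    also have "\<dots> = rr k"
      using k by (simp add: rr_def power_int_def power_one_over inverse_eq_divide)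
    finally show ?thesis using n by simp
  qed
  then show ?thesis by blast
qed

lemma VV_union_L2: "(\<Union>m. VV m) \<subseteq> L2 M" using VV_L2 by blast

text \<open>At each level, add the splines whose supporting balls lie in \<open>U\<close>. The sum
  vanishes outside \<open>U\<close>, and at a point of \<open>U\<close> it equals 1 as soon as the
  scale is small.\<close>

lemma indicator_open_cspan:
  assumes U: "open U" "U \<subseteq> ball x0 R"
  shows "(indicator U :: 'a \<Rightarrow> real) \<in> cspan M (\<Union>m. VV m)"
proof (rule cspan_dominated_limit[OF VV_union_L2])
  define F where "F n = {a \<in> near (rr (int n)) R x0. ball a (2 * rr (int n)) \<subseteq> U}" for n
  have F: "finite (F n)" "F n \<subseteq> net (rr (int n))" for n
    by (auto simp: F_def near_def) (auto intro: finite_subset[OF _ finite_near[of "rr (int n)" R x0]] simp: near_def)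
  let ?g = "\<lambda>n x. \<Sum>a\<in>F n. 1 * spl (int n) a x"
  show "?g n \<in> cspan M (\<Union>m. VV m)" for n
    using F[of n] by (intro cspan_sum cspan.base) (auto simp: VV_def)
  show "(\<lambda>x. 1 * indicator (ball x0 R) x) \<in> L2 M" by (rule ball_indicator_L2)
  show "\<bar>?g n x\<bar> \<le> 1 * indicator (ball x0 R) x" for n x
  proof (cases "x \<in> U")
    case True
    then show ?thesis using spl_sum_bounds[OF F[of n], of x] U(2) by (auto simp: indicator_def)
  next
    case False
    have "spl (int n) a x = 0" if "a \<in> F n" for a
      using that False F by (intro spl_zero) (auto simp: F_def dist_commute not_less subset_iff)
    then show ?thesis by simp
  qed
  fix x
  show "(\<lambda>n. ?g n x) \<longlonglongrightarrow> indicator U x"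
  proof (cases "x \<in> U")
    case True
    then obtain e where e: "e > 0" "ball x e \<subseteq> U" using U(1) open_contains_ball by blast
    have "eventually (\<lambda>n. rr (int n) < e / 4) sequentially"
      using order_tendstoD(2)[OF rr_tendsto_zero, of "e / 4"] e by simp
    then have "eventually (\<lambda>n. ?g n x = indicator U x) sequentially"
    proof (rule eventually_mono)
      fix n assume n: "rr (int n) < e / 4"
      have "near (rr (int n)) (2 * rr (int n)) x \<subseteq> F n"
      proof
        fix a assume a: "a \<in> near (rr (int n)) (2 * rr (int n)) x"
        have "ball a (2 * rr (int n)) \<subseteq> ball x e"
        proof
          fix y assume "y \<in> ball a (2 * rr (int n))"
          then show "y \<in> ball x e" using a n dist_triangle[of x y a] by (simp add: near_def)
        qed
        then have b: "ball a (2 * rr (int n)) \<subseteq> U" using e by blast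
        then have "a \<in> U" by auto
        then show "a \<in> F n" using b U(2) a by (auto simp: F_def near_def)
      qed
      then show "?g n x = indicator U x" using spl_sum[OF F] True by simp
    qed
    then show ?thesis by (rule tendsto_eventually)
  next
    case False
    have "spl (int n) a x = 0" if "a \<in> F n" for n a
      using that False F[of n] by (intro spl_zero) (auto simp: F_def dist_commute not_less subset_iff)
    then show ?thesis using False by simp
  qed
qed

text \<open>A Dynkin argument, since a closed span admits differences and disjoint unions but no
  products. Cutting with a ball keeps all indicators square-integrable.\<close>

lemma indicator_cspan:
  assumes "A \<in> sets M"
  shows "(\<lambda>x. indicator (A \<inter> ball x0 R) x :: real) \<in> cspan M (\<Union>m. VV m)"
proof -
  let ?B = "ball x0 R" and ?C = "cspan M (\<Union>m. VV m)"
  have A: "A \<in> sigma_sets UNIV {S :: 'a set. open S}"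
    using assms unfolding sets_M by (simp add: borel_def)
  have B: "(indicator ?B :: 'a \<Rightarrow> real) \<in> ?C" by (rule indicator_open_cspan) auto
  have "Int_stable {S :: 'a set. open S}" "{S :: 'a set. open S} \<subseteq> Pow UNIV"
    by (auto simp: Int_stable_def)
  from this A show ?thesis
  proof (induction rule: sigma_sets_induct_disjoint)
    case (basic A)
    then show ?case using indicator_open_cspan[of "A \<inter> ?B" x0 R] by (auto simp: open_Int)
  next
    case empty
    show ?case using cspan.zero by simp
  next
    case (compl A)
    have "(\<lambda>x. indicator ?B x - indicator (A \<inter> ?B) x :: real) \<in> ?C"
      using cspan_diff[OF B compl(2)] .
    moreover have "(\<lambda>x. indicator ?B x - indicator (A \<inter> ?B) x :: real) = (\<lambda>x. indicator ((UNIV - A) \<inter> ?B) x)"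
      by (auto simp: indicator_def)
    ultimately show ?case by simp
  next
    case (union A)
    show ?case
    proof (rule cspan_dominated_limit[OF VV_union_L2])
      let ?g = "\<lambda>n x. \<Sum>i<n. 1 * (indicator (A i \<inter> ?B) x :: real)"
      show "?g n \<in> ?C" for n using union by (intro cspan_sum) auto
      show "(\<lambda>x. 1 * indicator ?B x) \<in> L2 M" by (rule ball_indicator_L2)
      have g: "?g n x = indicator (\<Union>i<n. A i \<inter> ?B) x" for n x
        unfolding mult_1 using union(1)
        by (intro indicator_UN_disjoint[symmetric]) (auto simp: disjoint_family_on_def)
      show "\<bar>?g n x\<bar> \<le> 1 * indicator ?B x" for n x
        unfolding g by (auto simp: indicator_def)
      show "(\<lambda>n. ?g n x) \<longlonglongrightarrow> indicator ((\<Union>i. A i) \<inter> ?B) x" for x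
        unfolding g using LIMSEQ_indicator_UN[of "\<lambda>i. A i \<inter> ?B" x] by simp
    qed
  qed
qed

text \<open>Simple approximations bounded by twice the absolute value of \<open>f\<close> are cut
  off to growing balls, which leaves that majorant intact.\<close>

lemma L2_cspan_VV:
  assumes f: "f \<in> L2 M"
  shows "f \<in> cspan M (\<Union>m. VV m)"
proof -
  fix x0 :: 'a
  obtain s where s: "\<And>i. simple_function M (s i)" "\<And>x. (\<lambda>i. s i x) \<longlonglongrightarrow> f x"
      "\<And>i x. dist (s i x) 0 \<le> 2 * dist (f x) 0"
    using borel_measurable_implies_sequence_metric[OF L2_measurable[OF f], of 0] by auto
  show ?thesis
  proof (rule cspan_dominated_limit[OF VV_union_L2])
    let ?g = "\<lambda>n x. \<Sum>y\<in>range (s n). y * (indicator (s n -` {y} \<inter> ball x0 (real n)) x)"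
    have fin: "finite (range (s n))" for n using s(1)[of n] by (simp add: simple_function_def)
    have m: "s n -` {y} \<in> sets M" for n y
    proof (cases "y \<in> range (s n)")
      case True
      then show ?thesis using s(1)[of n] by (auto simp: simple_function_def)
    next
      case False
      then have "s n -` {y} = {}" by auto
      then show ?thesis by simp
    qed
    show "?g n \<in> cspan M (\<Union>m. VV m)" for n by (intro cspan_sum indicator_cspan m)
    have "?g n x = (\<Sum>y\<in>{s n x}. y * (indicator (s n -` {y} \<inter> ball x0 (real n)) x))" for n x
      using fin by (intro sum.mono_neutral_right) (auto simp: indicator_def)
    then have g: "?g n x = s n x * indicator (ball x0 (real n)) x" for n x
      by (simp add: indicator_def)
    have "(\<lambda>x. \<bar>f x\<bar>) \<in> L2 M" using f by (intro L2_bound[OF f]) (auto dest: L2_measurable)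
    then show "(\<lambda>x. 2 * \<bar>f x\<bar>) \<in> L2 M" by (rule L2_cmult)
    show "\<bar>?g n x\<bar> \<le> 2 * \<bar>f x\<bar>" for n x
      unfolding g using s(3)[of n x] by (simp add: indicator_def)
    fix x
    obtain n0 :: nat where n0: "dist x0 x < real n0" using reals_Archimedean2 by blast
    have "eventually (\<lambda>n. s n x = ?g n x) sequentially"
      unfolding g eventually_sequentially using n0 by (intro exI[of _ n0]) (auto simp: indicator_def)
    with s(2)[of x] show "(\<lambda>n. ?g n x) \<longlonglongrightarrow> f x" by (rule Lim_transform_eventually)
  qed
qed

end

section \<open>Completeness\<close>

context doubling
begin

text \<open>Far from \<open>x0\<close> there is a ball disjoint from \<open>ball x0 s\<close> with
  at least the fraction \<open>1 / 6 ^ p\<close> of its volume. Both lie in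
  \<open>ball x0 (3 * s)\<close>, so volumes grow geometrically under repetition.\<close>

lemma ball_unbounded:
  assumes unb: "\<not> bounded (UNIV :: 'a set)"
  shows "\<exists>R\<ge>1. C < vol x0 R"
proof -
  define c where "c = (1 / 6 ^ p :: real)"
  have c: "c > 0" by (simp add: c_def)
  have step: "\<exists>R'\<ge>1. (1 + c) * vol x0 R \<le> vol x0 R'" if R: "R \<ge> 1" for R
  proof -
    obtain y where y: "2 * R < dist x0 y"
      using unb unfolding bounded_any_center[where a = x0] by (auto simp: not_le)
    define s where "s = dist x0 y / 2"
    have s: "R < s" "s > 0" "dist x0 y = 2 * s" using y R by (auto simp: s_def)
    have "vol x0 s \<le> (2 * 3) ^ p * vol y s"
      using s by (intro ball_growth) (auto simp: dist_commute)
    then have "c * vol x0 s \<le> vol y s"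
      by (simp add: c_def field_simps)
    then have "(1 + c) * vol x0 s \<le> vol x0 s + vol y s"
      by (simp add: distrib_right)
    also have "\<dots> = measure M (ball x0 s \<union> ball y s)"
    proof (rule measure_Union[symmetric])
      have False if "dist x0 z < s" "dist y z < s" for z
        using that s dist_triangle2[of x0 y z] by linarith
      then show "ball x0 s \<inter> ball y s = {}" by auto
    qed (use emeasure_ball_finite[of x0 s] emeasure_ball_finite[of y s] in auto)
    also have "\<dots> \<le> vol x0 (3 * s)"
    proof (rule measure_mono_fmeasurable)
      have "dist x0 z < 3 * s" if "dist y z < s" for z
        using that s dist_triangle[of x0 z y] by linarith
      moreover have "dist x0 z < 3 * s" if "dist x0 z < s" for z using that s by linarith
      ultimately show "ball x0 s \<union> ball y s \<subseteq> ball x0 (3 * s)" by auto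
    qed auto
    finally have "(1 + c) * vol x0 s \<le> vol x0 (3 * s)" .
    moreover have "(1 + c) * vol x0 R \<le> (1 + c) * vol x0 s"
      using s c by (intro mult_left_mono ball_mono) auto
    moreover have "3 * s \<ge> 1" using s R by linarith
    ultimately show ?thesis by (intro exI[of _ "3 * s"]) linarith
  qed
  define v where "v = vol x0 1"
  have v: "v > 0" unfolding v_def by (rule ball_pos) simp
  have "\<exists>R\<ge>1. (1 + c) ^ n * v \<le> vol x0 R" for n
  proof (induction n)
    case 0
    then show ?case by (intro exI[of _ 1]) (simp add: v_def)
  next
    case (Suc n)
    then obtain R where R: "R \<ge> 1" "(1 + c) ^ n * v \<le> vol x0 R" by blast
    obtain R' where R': "R' \<ge> 1" "(1 + c) * vol x0 R \<le> vol x0 R'"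
      using step[OF R(1)] by blast
    have "(1 + c) * ((1 + c) ^ n * v) \<le> (1 + c) * vol x0 R"
      using R(2) c by (intro mult_left_mono) auto
    then have "(1 + c) ^ Suc n * v \<le> vol x0 R'" using R' by (simp add: mult.assoc)
    then show ?case using R'(1) by blast
  qed
  moreover obtain n where "C / v < (1 + c) ^ n" using real_arch_pow[of "1 + c" "C / v"] c by auto
  ultimately show ?thesis using v by (meson less_le_trans pos_divide_less_eq)
qed

end

section \<open>Completeness of the wavelets\<close>

context wavelets
begin

text \<open>Near \<open>a\<close> the combination equals its coefficient \<open>c a\<close>, so the
  norm controls every coefficient relevant at \<open>x\<close>. The 80 is twice 40, because
  \<open>5 * rr k\<close> is 40 times \<open>rr k / 8\<close>.\<close>

lemma spl_combination_bound:
  assumes J: "finite J" "J \<subseteq> net (rr k)" and v: "v = (\<lambda>x. \<Sum>a\<in>J. c a * spl k a x)"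
    and x: "dist x0 x \<le> 2 * rr k"
  shows "\<bar>v x\<bar> \<le> l2n M v * sqrt (80 ^ p / vol x0 (rr k))"
proof -
  let ?V = "vol x0 (rr k)" and ?C = "l2n M v * sqrt (80 ^ p / vol x0 (rr k))"
  have V: "?V > 0" by (rule ball_pos) simp
  have vL: "v \<in> L2 M" unfolding v using J by (intro L2_sum spl_L2) auto
  have coeff: "\<bar>c a\<bar> \<le> ?C" if a: "a \<in> J" "dist x a < 2 * rr k" for a
  proof -
    let ?w = "vol a (rr k / 8)"
    have w: "?w > 0" by (rule ball_pos) simp
    have "?V \<le> (2 * 40) ^ p * ?w"
    proof (rule ball_growth)
      have "dist a x0 \<le> dist x a + dist x0 x" by (metis dist_commute dist_triangle2)
      then show "dist a x0 + rr k \<le> 40 * (rr k / 8)" using x a(2) by linarith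
    qed auto
    then have Vw: "?V \<le> 80 ^ p * ?w" by simp
    have "(c a)\<^sup>2 * ?w = (\<integral>y. (c a)\<^sup>2 * indicator (ball a (rr k / 8)) y \<partial>M)" by simp
    also have "\<dots> \<le> (\<integral>y. (v y)\<^sup>2 \<partial>M)"
    proof (rule integral_mono)
      show "integrable M (\<lambda>y. (c a)\<^sup>2 * indicator (ball a (rr k / 8)) y)"
        using emeasure_ball_finite by simp
      show "integrable M (\<lambda>y. (v y)\<^sup>2)" by (rule L2_square[OF vL])
      fix y
      show "(c a)\<^sup>2 * indicator (ball a (rr k / 8)) y \<le> (v y)\<^sup>2"
      proof (cases "dist y a < rr k / 8")
        case True
        have an: "a \<in> net (rr k)" using a J by auto
        have "v y = (\<Sum>b\<in>J. if b = a then c a else 0)"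
          unfolding v using J spl_one[OF an True] spl_other[OF an True] by (intro sum.cong) auto
        then have "v y = c a" using a J(1) by (simp add: sum.delta)
        then show ?thesis by (simp add: indicator_def)
      qed (simp add: dist_commute)
    qed
    also have "\<dots> = (l2n M v)\<^sup>2" by (rule l2n_square[symmetric])
    finally have "(c a)\<^sup>2 * ?w \<le> (l2n M v)\<^sup>2" .
    then have "(c a)\<^sup>2 * (80 ^ p * ?w) \<le> (l2n M v)\<^sup>2 * 80 ^ p"
      using mult_right_mono[of "(c a)\<^sup>2 * ?w" "(l2n M v)\<^sup>2" "80 ^ p"] by (simp add: mult_ac)
    moreover have "(c a)\<^sup>2 * ?V \<le> (c a)\<^sup>2 * (80 ^ p * ?w)" using Vw by (intro mult_left_mono) auto
    ultimately have "(c a)\<^sup>2 * ?V \<le> (l2n M v)\<^sup>2 * 80 ^ p" by linarith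
    then have "(c a)\<^sup>2 \<le> (l2n M v)\<^sup>2 * (80 ^ p / ?V)" using V by (simp add: field_simps)
    then have "sqrt ((c a)\<^sup>2) \<le> sqrt ((l2n M v)\<^sup>2 * (80 ^ p / ?V))" by (rule real_sqrt_le_mono)
    then show ?thesis by (simp only: real_sqrt_mult real_sqrt_abs abs_of_nonneg[OF l2n_nonneg])
  qed
  have C0: "0 \<le> ?C" by simp
  have "\<bar>v x\<bar> \<le> (\<Sum>a\<in>J. \<bar>c a\<bar> * \<bar>spl k a x\<bar>)"
    unfolding v by (rule order_trans[OF sum_abs]) (simp add: abs_mult)
  also have "\<dots> \<le> (\<Sum>a\<in>J. ?C * spl k a x)"
  proof (rule sum_mono)
    fix a assume a: "a \<in> J"
    then have n: "a \<in> net (rr k)" using J by auto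
    have "\<bar>c a\<bar> * \<bar>spl k a x\<bar> \<le> ?C * \<bar>spl k a x\<bar>"
    proof (cases "dist x a < 2 * rr k")
      case True
      then show ?thesis using coeff[OF a] by (intro mult_right_mono) auto
    next
      case False
      then show ?thesis using spl_zero[OF n, of x] by simp
    qed
    then show "\<bar>c a\<bar> * \<bar>spl k a x\<bar> \<le> ?C * spl k a x" using spl_bounds[OF n, of x] by simp
  qed
  also have "\<dots> = ?C * (\<Sum>a\<in>J. spl k a x)" by (simp add: sum_distrib_left)
  also have "\<dots> \<le> ?C * 1" using spl_sum_bounds[OF J, of x] C0 by (intro mult_left_mono) auto
  finally show ?thesis by simp
qed

text \<open>For \<open>j \<ge> k\<close> the combination lies in the spline space of level
  \<open>j\<close>, to which the wavelets of level \<open>j\<close> are orthogonal.\<close>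

lemma spl_combination_orthogonal:
  assumes J: "finite J" "J \<subseteq> net (rr k)" and w: "w \<in> cspan M (PP {k..})"
  shows "(\<integral>x. (\<Sum>a\<in>J. c a * spl k a x) * w x \<partial>M) = 0"
proof (rule cspan_orthogonal[OF PP_L2 w])
  let ?v = "\<lambda>x. \<Sum>a\<in>J. c a * spl k a x"
  have v: "?v \<in> cspan M (VV k)" using J by (intro cspan_sum cspan.base) (auto simp: VV_def)
  show "?v \<in> L2 M" using J by (intro L2_sum spl_L2) auto
  fix f assume "f \<in> PP {k..}"
  then obtain j b where f: "k \<le> j" "b \<in> YY j" "f = psi j b" by (auto simp: PP_def)
  have "?v \<in> cspan M (VV j)" using VV_mono[OF f(1)] v by (rule cspan_mono)
  then have "ip (psi j b) ?v = 0"
    by (rule cspan_orthogonal[OF VV_L2 _ psi_L2[OF f(2)]])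
      (use psi_orthogonal_spl[OF f(2)] in \<open>auto simp: VV_def\<close>)
  then show "ip ?v f = 0" by (simp add: f(3) mult.commute)
qed

text \<open>Separates a finite coarse combination, to which the pointwise bound applies, from a
  detail part orthogonal to it.\<close>

lemma VV_PP_approximation:
  assumes g: "g \<in> cspan M (VV k \<union> PP {k..})" and e: "e > 0"
  obtains J c w where "finite J" "J \<subseteq> net (rr k)" "w \<in> cspan M (PP {k..})" "w \<in> L2 M"
    "l2n M (\<lambda>x. g x - ((\<Sum>a\<in>J. c a * spl k a x) + w x)) < e"
proof -
  define F where "F = (\<lambda>(b, j, a). if b then psi j a else spl k a)"
  define I where "I = {False} \<times> {k} \<times> net (rr k) \<union> {True} \<times> Sigma {k..} YY"
  have FI: "F ` I = VV k \<union> PP {k..}"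
  proof -
    have "F ` ({False} \<times> {k} \<times> net (rr k)) = (\<lambda>a. F (False, k, a)) ` net (rr k)" by auto
    moreover have "F ` ({True} \<times> Sigma {k..} YY) = (\<Union>j\<in>{k..}. (\<lambda>b. F (True, j, b)) ` YY j)" by auto
    ultimately show ?thesis unfolding I_def image_Un by (simp add: F_def VV_def PP_def)
  qed
  have FL: "F i \<in> L2 M" if "i \<in> I" for i
  proof -
    have "F i \<in> VV k \<union> PP {k..}" using that FI by blast
    then show ?thesis using VV_L2 PP_L2 by blast
  qed
  obtain J c where J: "finite J" "J \<subseteq> I" "l2n M (\<lambda>x. g x - (\<Sum>i\<in>J. c i * F i x)) < e"
    using cspan_finite_combination[of I F M g e, OF FL _ e] g unfolding FI by blast
  let ?J0 = "{i. (False, i) \<in> J}" and ?J1 = "{i. (True, i) \<in> J}"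
  define w where "w x = (\<Sum>i\<in>?J1. c (True, i) * F (True, i) x)" for x
  have fin: "finite {i. (b, i) \<in> J}" for b
  proof (rule finite_surj[OF J(1), of _ snd], rule subsetI)
    fix i assume "i \<in> {i. (b, i) \<in> J}"
    then have "snd (b, i) \<in> snd ` J" by (intro imageI) simp
    then show "i \<in> snd ` J" by simp
  qed
  have w: "w \<in> cspan M (PP {k..})"
    unfolding w_def using J(2) by (intro cspan_sum cspan.base) (auto simp: I_def F_def PP_def)
  have s0: "?J0 = Pair k ` snd ` ?J0" using J(2) by (force simp: I_def)
  have "(\<Sum>i\<in>?J0. c (False, i) * F (False, i) x) = (\<Sum>a\<in>snd ` ?J0. c (False, k, a) * spl k a x)" for x
    by (subst s0, subst sum.reindex) (auto simp: inj_on_def F_def)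
  then have eq: "(\<Sum>i\<in>J. c i * F i x) = (\<Sum>a\<in>snd ` ?J0. c (False, k, a) * spl k a x) + w x" for x
    unfolding sum_bool_times[OF J(1)] w_def by simp
  show ?thesis
  proof (rule that[of "snd ` ?J0" w "\<lambda>a. c (False, k, a)"])
    show "finite (snd ` ?J0)" using fin by (rule finite_imageI)
    show "snd ` ?J0 \<subseteq> net (rr k)" using J(2) by (auto simp: I_def)
    show "w \<in> L2 M" using PP_L2 w by (rule cspan_L2)
    show "l2n M (\<lambda>x. g x - ((\<Sum>a\<in>snd ` ?J0. c (False, k, a) * spl k a x) + w x)) < e"
      using J(3) by (simp add: eq)
  qed (rule w)
qed

text \<open>The component of a fixed spline at level k tends to 0 as k tends to minus infinity, because
  balls of radius \<open>\<delta> powi k\<close> have arbitrarily large measure.\<close>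

lemma spl_cspan_PP:
  assumes unb: "\<not> bounded (UNIV :: 'a set)" and a0: "a0 \<in> net (rr m)"
  shows "spl m a0 \<in> cspan M (PP UNIV)"
proof (rule cspan.lim)
  let ?s = "spl m a0"
  show sL: "?s \<in> L2 M" using a0 by (rule spl_L2)
  show "\<forall>e>0. \<exists>w. w \<in> cspan M (PP UNIV) \<and> l2n M (\<lambda>x. ?s x - w x) < e"
  proof (intro allI impI)
    fix e :: real assume e: "e > 0"
    define d where "d = e / 3"
    have d: "d > 0" using e by (simp add: d_def)
    define V where "V = vol a0 (2 * rr m)"
    have V: "V > 0" unfolding V_def by (rule ball_pos) simp
    \<comment> \<open>At this volume the pointwise bound makes the inner product of any coarse
      combination \<open>v\<close> with the spline at most \<open>d\<close> times the norm of
      \<open>v\<close>.\<close>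
    obtain R where R: "R \<ge> 1" "80 ^ p * V\<^sup>2 / d\<^sup>2 < vol a0 R"
      using ball_unbounded[OF unb] by blast
    obtain n where n: "\<And>k. k \<le> - int n \<Longrightarrow> R < rr k" using rr_large[of R] by blast
    define k where "k = min m (- int n)"
    have "R < rr k" using n by (simp add: k_def)
    then have "vol a0 R \<le> vol a0 (rr k)" by (intro ball_mono) auto
    with R have mk: "80 ^ p * V\<^sup>2 / d\<^sup>2 < vol a0 (rr k)" (is "_ < ?m") by linarith
    have m: "?m > 0" by (rule ball_pos) simp
    have rmk: "rr m \<le> rr k"
    proof -
      have "m = k + int (nat (m - k))" by (simp add: k_def)
      then have "rr m = \<delta> ^ nat (m - k) * rr k" by (metis rr_add)
      also have "\<dots> \<le> 1 * rr k" using \<delta> by (intro mult_right_mono power_le_one) (auto simp: less_imp_le)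
      finally show ?thesis by simp
    qed
    have "?s \<in> VV m" using a0 by (simp add: VV_def)
    then have "?s \<in> cspan M (VV k \<union> PP {k..})" using VV_cspan by blast
    then obtain J c w where J: "finite J" "J \<subseteq> net (rr k)" and w: "w \<in> cspan M (PP {k..})"
      and wL: "w \<in> L2 M"
      and close: "l2n M (\<lambda>x. ?s x - ((\<Sum>a\<in>J. c a * spl k a x) + w x)) < d"
      using d by (rule VV_PP_approximation)
    define v where "v = (\<lambda>x. \<Sum>a\<in>J. c a * spl k a x)"
    have vL: "v \<in> L2 M" unfolding v_def using J by (intro L2_sum spl_L2) auto
    define r where "r = (\<lambda>x. ?s x - (v x + w x))"
    have rL: "r \<in> L2 M" unfolding r_def using sL vL wL by (intro L2_diff L2_add)
    have rd: "l2n M r < d" using close by (simp add: r_def v_def)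
    let ?C = "l2n M v * sqrt (80 ^ p / ?m)"
    have C0: "0 \<le> ?C" by simp
    have vs: "\<bar>\<integral>x. v x * ?s x \<partial>M\<bar> \<le> (\<integral>x. ?C * indicator (ball a0 (2 * rr m)) x \<partial>M)"
    proof (rule order_trans[OF integral_abs_bound], rule integral_mono)
      show "integrable M (\<lambda>x. \<bar>v x * ?s x\<bar>)" using vL sL by (intro integrable_abs L2_mult_integrable)
      show "integrable M (\<lambda>x. ?C * indicator (ball a0 (2 * rr m)) x)"
        using emeasure_ball_finite by simp
      fix x
      show "\<bar>v x * ?s x\<bar> \<le> ?C * indicator (ball a0 (2 * rr m)) x"
      proof (cases "dist a0 x < 2 * rr m")
        case True
        then have "\<bar>v x\<bar> \<le> ?C" using rmk by (intro spl_combination_bound[OF J v_def]) auto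
        then have "\<bar>v x\<bar> * \<bar>?s x\<bar> \<le> ?C * 1" using spl_abs[OF a0, of x] C0 by (intro mult_mono) auto
        then show ?thesis using True by (simp add: abs_mult)
      next
        case False
        then show ?thesis using spl_zero[OF a0, of x] by (simp add: dist_commute)
      qed
    qed
    also have "\<dots> = l2n M v * (sqrt (80 ^ p / ?m) * V)" by (simp add: V_def)
    also have "\<dots> \<le> l2n M v * d"
    proof (intro mult_left_mono)
      have "80 ^ p / ?m * V\<^sup>2 \<le> d\<^sup>2" using mk m d by (simp add: field_simps)
      then have "sqrt (80 ^ p / ?m * V\<^sup>2) \<le> sqrt (d\<^sup>2)" by (rule real_sqrt_le_mono)
      then show "sqrt (80 ^ p / ?m) * V \<le> d"
        using V d by (simp only: real_sqrt_mult real_sqrt_abs abs_of_pos)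
    qed simp
    finally have vs: "\<bar>\<integral>x. v x * ?s x \<partial>M\<bar> \<le> l2n M v * d" .
    \<comment> \<open>Since \<open>v\<close> is the spline minus \<open>w\<close> minus the error
      \<open>r\<close>, and \<open>v\<close> is orthogonal to \<open>w\<close>, only two terms of
      size \<open>d * l2n M v\<close> remain. Hence the norm of \<open>v\<close> is at most
      \<open>2 * d\<close>, and with the error \<open>d\<close> the total is
      \<open>e = 3 * d\<close>.\<close>
    have "(l2n M v)\<^sup>2 = (\<integral>x. v x * ?s x - v x * w x - v x * r x \<partial>M)"
      unfolding l2n_square by (simp add: r_def power2_eq_square algebra_simps)
    also have "\<dots> = ip v ?s - ip v w - ip v r"
      using L2_mult_integrable[OF vL sL] L2_mult_integrable[OF vL wL] L2_mult_integrable[OF vL rL]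
      by simp
    also have "ip v w = 0"
      unfolding v_def using J w by (rule spl_combination_orthogonal)
    also have "(ip v ?s) - 0 - ip v r \<le> l2n M v * d + l2n M v * l2n M r"
      using vs L2_CS[OF vL rL] by linarith
    also have "\<dots> \<le> l2n M v * d + l2n M v * d"
      using rd by (intro add_left_mono mult_left_mono) auto
    finally have "l2n M v * l2n M v \<le> l2n M v * (2 * d)" by (simp add: power2_eq_square mult_ac)
    then have v2: "l2n M v \<le> 2 * d"
      using d l2n_nonneg[of M v] by (cases "l2n M v = 0") (auto simp: mult_le_cancel_left)
    have "l2n M (\<lambda>x. ?s x - w x) = l2n M (\<lambda>x. r x + v x)" by (simp add: r_def algebra_simps)
    also have "\<dots> \<le> l2n M r + l2n M v" by (rule l2n_triangle[OF rL vL])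
    also have "\<dots> < d + 2 * d" using rd v2 by linarith
    finally have "l2n M (\<lambda>x. ?s x - w x) < e" by (simp add: d_def)
    moreover have "w \<in> cspan M (PP UNIV)"
      by (rule cspan_mono[OF _ w]) (auto simp: PP_def intro!: cspan.base)
    ultimately show "\<exists>w. w \<in> cspan M (PP UNIV) \<and> l2n M (\<lambda>x. ?s x - w x) < e" by blast
  qed
qed

lemma complete_unbounded:
  assumes unb: "\<not> bounded (UNIV :: 'a set)" and f: "f \<in> L2 M"
  shows "f \<in> cspan M (PP UNIV)"
proof (rule cspan_mono[OF _ L2_cspan_VV[OF f]])
  show "(\<Union>m. VV m) \<subseteq> cspan M (PP UNIV)"
    using spl_cspan_PP[OF unb] by (auto simp: VV_def)
qed

text \<open>With a single net point the only spline of level \<open>k0\<close> is the constant 1.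
  The coarse part of an approximation is then a constant, and dropping it cannot increase the error
  for functions of mean 0.\<close>

lemma complete_bounded:
  assumes single: "net (rr k0) = {a0}"
    and f: "f \<in> L2 M" and mean: "(\<integral>x. f x \<partial>M) = 0"
  shows "f \<in> cspan M (PP {k0..})"
proof (rule cspan.lim[OF f], intro allI impI)
  fix e :: real assume e: "e > 0"
  have one: "spl k0 a0 x = 1" for x
    using spl_sum[of "{a0}" k0 x] near_subset_net[of "rr k0"] single by auto
  have oneL: "(\<lambda>x. 1) \<in> L2 M"
  proof -
    have "spl k0 a0 = (\<lambda>x. 1)" by (rule ext) (rule one)
    then show ?thesis using spl_L2[of a0 k0] single by simp
  qed
  have "f \<in> cspan M (VV k0 \<union> PP {k0..})"
    by (rule cspan_mono[OF _ L2_cspan_VV[OF f]]) (use VV_cspan in blast)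
  then obtain J c w where J: "finite J" "J \<subseteq> net (rr k0)" and w: "w \<in> cspan M (PP {k0..})"
    and wL: "w \<in> L2 M"
    and close: "l2n M (\<lambda>x. f x - ((\<Sum>a\<in>J. c a * spl k0 a x) + w x)) < e"
    using e by (rule VV_PP_approximation)
  define C where "C = (\<Sum>a\<in>J. c a)"
  have C: "(\<Sum>a\<in>J. c a * spl k0 a x) = C" for x
    unfolding C_def using J single by (intro sum.cong) (auto simp: one)
  have "(\<integral>x. (\<Sum>a\<in>{a0}. 1 * spl k0 a x) * w x \<partial>M) = 0"
    using w single by (intro spl_combination_orthogonal) auto
  then have "(\<integral>x. w x \<partial>M) = 0" by (simp add: one)
  then have "(\<integral>x. (f x - w x) * 1 \<partial>M) = 0"
    using L2_mult_integrable[OF f oneL] L2_mult_integrable[OF wL oneL] mean by simp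
  \<comment> \<open>Pythagoras: \<open>f - w\<close> has mean 0 and is thus orthogonal to the
    constant \<open>C\<close>.\<close>
  then have "(\<integral>x. (f x - w x)\<^sup>2 \<partial>M) \<le> (\<integral>x. ((f x - w x) + (- C) * 1)\<^sup>2 \<partial>M)"
    using integral_square_add[OF L2_diff[OF f wL] oneL, of "- C"] by simp
  then have "l2n M (\<lambda>x. f x - w x) \<le> l2n M (\<lambda>x. f x - ((\<Sum>a\<in>J. c a * spl k0 a x) + w x))"
    unfolding l2n_def C by (intro real_sqrt_le_mono) (simp add: algebra_simps)
  with close w show "\<exists>h. h \<in> cspan M (PP {k0..}) \<and> l2n M (\<lambda>x. f x - h x) < e"
    by (intro exI[of _ w]) linarith
qed

lemma psi_L20:
  assumes "b \<in> YY k"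
  shows "has_bochner_integral M (psi k b) 0" "psi k b \<in> L20_functions M"
proof -
  show "has_bochner_integral M (psi k b) 0"
    using psi_integrable[OF assms] psi_mean_zero[OF assms] by (simp add: has_bochner_integral_iff)
  then show "psi k b \<in> L20_functions M"
    using psi_L2[OF assms] by (simp add: L20_functions_def)
qed

lemma complete_L20:
  obtains K where "if bounded (UNIV :: 'a set) then (\<exists>k0. K = {k0..}) \<and> (\<forall>k\<in>K. finite (YY k)) else K = UNIV"
    "\<And>f. f \<in> L20_functions M \<Longrightarrow> f \<in> cspan M (PP K)"
proof (cases "bounded (UNIV :: 'a set)")
  case False
  then show ?thesis
    using complete_unbounded by (intro that[of UNIV]) (auto simp: L20_functions_def)
next
  case True
  fix x0 :: 'a
  obtain R where R: "\<And>x. dist x0 x \<le> R"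
    using True unfolding bounded_any_center[where a = x0] by auto
  \<comment> \<open>A scale above \<open>2 * R\<close> exceeds all distances, so separation leaves
    only one net point.\<close>
  obtain n where n: "2 * R < rr (- int n)" using rr_large[of "2 * R"] by blast
  define k0 where "k0 = - int n"
  obtain a0 where a0: "a0 \<in> net (rr k0)" using net_cover[of "rr k0" x0] by auto
  have "b \<in> {a0}" if "b \<in> net (rr k0)" for b
  proof (rule ccontr)
    assume "b \<notin> {a0}"
    then have "rr k0 \<le> dist b a0" using that a0 by (intro net_separated) auto
    then show False using n R[of b] R[of a0] dist_triangle3[of b a0 x0] by (simp add: k0_def)
  qed
  then have "net (rr k0) \<subseteq> {a0}" by (rule subsetI)
  then have single: "net (rr k0) = {a0}" using a0 by blast
  have "finite (YY k)" for k
  proof (rule finite_subset[OF _ finite_near])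
    show "YY k \<subseteq> near (rr (k + 1)) (R + 1) x0"
      using YY_net R by (force simp: near_def intro: le_less_trans)
  qed simp
  then show ?thesis
    using True complete_bounded[OF single]
    by (intro that[of "{k0..}"]) (auto simp: L20_functions_def has_bochner_integral_iff)
qed

end

section \<open>Choice of parameters and assembly\<close>

lemma doubling_measure_locale:
  fixes M :: "'a::metric_space measure"
  assumes "doubling_measure M"
  obtains p where "doubling M p"
proof -
  obtain C where C: "\<And>x r. r > 0 \<Longrightarrow> emeasure M (ball x (2 * r)) \<le> ennreal C * emeasure M (ball x r)"
    and sets: "sets M = sets borel"
    and ball: "\<And>x r. r > 0 \<Longrightarrow> 0 < emeasure M (ball x r) \<and> emeasure M (ball x r) < \<infinity>"
    using assms unfolding doubling_measure_def by blast
  obtain p where p: "C < 2 ^ p" using real_arch_pow[of 2 C] by auto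
  have fin: "emeasure M (ball x r) < \<infinity>" for x r
    using ball[of r x] by (cases "r > 0") (auto simp: ball_empty)
  have em: "emeasure M (ball x r) = ennreal (measure M (ball x r))" for x r
    using fin[of x r] by (intro emeasure_eq_ennreal_measure) auto
  have "doubling M p"
  proof
    show "0 < measure M (ball x r)" if "r > 0" for x r
      using ball[OF that, of x] unfolding em by simp
    show "measure M (ball x (2 * r)) \<le> 2 ^ p * measure M (ball x r)" if "r > 0" for x r
    proof -
      have "ennreal (measure M (ball x (2 * r))) \<le> ennreal C * ennreal (measure M (ball x r))"
        using C[OF that, of x] by (simp only: em)
      also have "\<dots> \<le> ennreal (2 ^ p) * ennreal (measure M (ball x r))"
        using p by (intro mult_right_mono ennreal_leI) auto
      also have "\<dots> = ennreal (2 ^ p * measure M (ball x r))" by (simp add: ennreal_mult del: ennreal_power)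
      finally show ?thesis by (subst (asm) ennreal_le_iff) auto
    qed
  qed (use sets fin in auto)
  then show ?thesis by (rule that)
qed

text \<open>The requirement amounts to \<open>\<delta> powr (1 - \<eta>) \<le> 1 / clip\<close>,
  solvable because \<open>clip\<close> does not depend on \<delta> and \<eta> is below 1.\<close>

lemma (in doubling) scale_exists:
  assumes \<eta>: "0 < \<eta>" "\<eta> < 1"
  obtains \<delta> where "spline M p \<delta> \<eta>"
proof -
  have c: "clip \<ge> 5" by (rule clip_ge[of 1]) simp
  define \<delta> where "\<delta> = min (1 / 64) ((1 / clip) powr (1 / (1 - \<eta>)))"
  have \<delta>: "0 < \<delta>" "\<delta> \<le> 1 / 64" using c by (auto simp: \<delta>_def)
  have "\<delta> powr (1 - \<eta>) \<le> ((1 / clip) powr (1 / (1 - \<eta>))) powr (1 - \<eta>)"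
    using \<delta> \<eta> by (intro powr_mono2) (auto simp: \<delta>_def)
  also have "\<dots> = 1 / clip" using \<eta> c by (simp add: powr_powr)
  finally have "clip * \<delta> powr (1 - \<eta>) \<le> 1" using c by (simp add: field_simps)
  then have "clip * \<delta> powr (1 - \<eta>) * \<delta> powr \<eta> \<le> 1 * \<delta> powr \<eta>" by (intro mult_right_mono) auto
  moreover have "\<delta> powr (1 - \<eta>) * \<delta> powr \<eta> = \<delta>" using \<delta> by (simp flip: powr_add)
  ultimately have "clip * \<delta> \<le> \<delta> powr \<eta>" by (simp add: mult.assoc)
  then have "spline M p \<delta> \<eta>" using \<delta> \<eta> by unfold_locales
  then show ?thesis by (rule that)
qed

lemma (in spline) wavelets_locale:
  obtains E \<gamma> psi where "wavelets M p \<delta> \<eta> E \<gamma> psi"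
proof -
  obtain E \<gamma> where pos: "E > 0" "\<gamma> > 0"
    and ex: "\<And>k b. b \<in> YY k \<Longrightarrow> \<exists>\<psi>. is_wavelet E \<gamma> k b \<psi>"
    using wavelets_exist by blast
  define psi where "psi k b = (SOME \<psi>. is_wavelet E \<gamma> k b \<psi>)" for k b
  have psi: "is_wavelet E \<gamma> k b (psi k b)" if "b \<in> YY k" for k b
    unfolding psi_def using ex[OF that] by (rule someI_ex)
  have "wavelets M p \<delta> \<eta> E \<gamma> psi"
    by unfold_locales (use pos psi in blast)+
  then show ?thesis by (rule that)
qed

theorem corollary6p13:
  fixes M :: "'a::metric_space measure" and \<eta> :: real
  assumes "doubling_space TYPE('a)"
    and "doubling_measure M"
    and "0 \<le> \<eta>" and "\<eta> < 1"
  shows "\<exists>\<rho> \<delta> K A y \<psi>. exponential_localization \<rho> \<and>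
    wavelet_basis M \<rho> \<delta> K A y \<psi> \<and> hoelder_wavelets M \<rho> \<delta> K A y \<psi> \<eta>"
proof -
  obtain p where "doubling M p" using doubling_measure_locale[OF assms(2)] .
  then interpret doubling M p .
  \<comment> \<open>The construction needs a positive exponent, and \<eta> may be 0. An exponent
    between \<eta> and 1 suffices: the relative distances are at most 1, so the bound with the
    larger exponent is the stronger one.\<close>
  define \<eta>' where "\<eta>' = (1 + \<eta>) / 2"
  have \<eta>': "0 < \<eta>'" "\<eta>' < 1" "\<eta> \<le> \<eta>'" using assms by (auto simp: \<eta>'_def)
  obtain \<delta> where "spline M p \<delta> \<eta>'" using scale_exists[OF \<eta>'(1,2)] .
  then interpret spline M p \<delta> \<eta>' .
  obtain E \<gamma> psi where "wavelets M p \<delta> \<eta>' E \<gamma> psi" by (rule wavelets_locale)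
  then interpret wavelets M p \<delta> \<eta>' E \<gamma> psi .
  obtain K where K: "if bounded (UNIV :: 'a set) then (\<exists>k0. K = {k0..}) \<and> (\<forall>k\<in>K. finite (YY k)) else K = UNIV"
    and complete: "\<And>f. f \<in> L20_functions M \<Longrightarrow> f \<in> cspan M (PP K)"
    using complete_L20 by blast
  define \<rho> where "\<rho> t = exp (- \<gamma> * t)" for t :: real
  \<comment> \<open>Points are renamed by natural numbers through the enumeration of
    \<open>YY k\<close>, as the index sets in \<open>wavelet_basis\<close> demand.\<close>
  define A where "A k = to_nat_on (YY k) ` YY k" for k
  define y where "y k n = from_nat_into (YY k) n" for k n
  define \<psi> where "\<psi> k n = psi k (y k n)" for k n
  have y_to: "y k (to_nat_on (YY k) b) = b" if "b \<in> YY k" for k b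
    unfolding y_def using countable_YY that by (rule from_nat_into_to_nat_on)
  have yY: "y k n \<in> YY k" if "n \<in> A k" for k n
    using that y_to by (auto simp: A_def)
  have y_inj: "y k n = y k n' \<longleftrightarrow> n = n'" if "n \<in> A k" "n' \<in> A k" for k n n'
    using that y_to by (auto simp: A_def)
  have \<rho>: "0 \<le> \<rho> t \<and> \<rho> t \<le> 1" if "t \<ge> 0" for t
    using that \<gamma>_pos by (simp add: \<rho>_def)
  have anti: "antimono_on {0..} \<rho>"
    using \<gamma>_pos by (intro monotone_onI) (auto simp: \<rho>_def)
  have image: "(\<lambda>(k, n). \<psi> k n) ` Sigma K A = PP K"
  proof (rule equalityI)
    show "(\<lambda>(k, n). \<psi> k n) ` Sigma K A \<subseteq> PP K" using yY by (auto simp: PP_def \<psi>_def)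
    show "PP K \<subseteq> (\<lambda>(k, n). \<psi> k n) ` Sigma K A"
    proof
      fix g assume "g \<in> PP K"
      then obtain k b where g: "k \<in> K" "b \<in> YY k" "g = psi k b" by (auto simp: PP_def)
      then show "g \<in> (\<lambda>(k, n). \<psi> k n) ` Sigma K A"
        by (intro image_eqI[of _ _ "(k, to_nat_on (YY k) b)"]) (auto simp: \<psi>_def y_to A_def)
    qed
  qed
  have basis: "orthonormal_basis_L20 M (Sigma K A) (\<lambda>(k, n). \<psi> k n)"
    unfolding orthonormal_basis_L20_def
  proof (intro conjI ballI allI impI)
    fix i assume "i \<in> Sigma K A"
    then show "(case i of (k, n) \<Rightarrow> \<psi> k n) \<in> L20_functions M"
      using psi_L20(2) yY by (auto simp: \<psi>_def)
  next
    fix i j assume i: "i \<in> Sigma K A" and j: "j \<in> Sigma K A"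
    obtain k n l m where ij: "i = (k, n)" "j = (l, m)" by (cases i, cases j) auto
    have nm: "n \<in> A k" "m \<in> A l" using i j ij by auto
    have "(\<integral>x. \<psi> k n x * \<psi> l m x \<partial>M) = (if (k, y k n) = (l, y l m) then 1 else 0)"
      unfolding \<psi>_def by (rule psi_orthonormal[OF yY[OF nm(1)] yY[OF nm(2)]])
    also have "\<dots> = (if i = j then 1 else 0)" using nm y_inj by (auto simp: ij)
    finally show "(\<integral>x. (case i of (k, n) \<Rightarrow> \<psi> k n) x * (case j of (k, n) \<Rightarrow> \<psi> k n) x \<partial>M) = (if i = j then 1 else 0)"
      by (simp add: ij)
  next
    fix f and e :: real assume f: "f \<in> L20_functions M" and e: "e > 0"
    have L: "(case i of (k, n) \<Rightarrow> \<psi> k n) \<in> L2 M" if "i \<in> Sigma K A" for i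
      using that psi_L2 yY by (auto simp: \<psi>_def)
    have fc: "f \<in> cspan M ((\<lambda>(k, n). \<psi> k n) ` Sigma K A)"
      unfolding image by (rule complete[OF f])
    obtain J c where "finite J" "J \<subseteq> Sigma K A"
      "l2n M (\<lambda>x. f x - (\<Sum>i\<in>J. c i * (case i of (k, n) \<Rightarrow> \<psi> k n) x)) < e"
      using cspan_finite_combination[OF L fc e] by blast
    then show "\<exists>J c. finite J \<and> J \<subseteq> Sigma K A \<and>
        sqrt (\<integral>x. (f x - (\<Sum>i\<in>J. c i * (case i of (k, n) \<Rightarrow> \<psi> k n) x))\<^sup>2 \<partial>M) < e"
      unfolding l2n_def by blast
  qed
  have "wavelet_basis M \<rho> \<delta> K A y \<psi>"
    unfolding wavelet_basis_def
  proof (intro conjI)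
    show "\<forall>t\<ge>0. 0 \<le> \<rho> t \<and> \<rho> t \<le> 1" using \<rho> by blast
    show "if bounded (UNIV :: 'a set) then (\<exists>k0. K = {k0..}) \<and> (\<forall>k\<in>K. finite (A k)) else K = UNIV"
      using K by (auto simp: A_def)
    show "\<forall>k\<in>K. \<forall>n\<in>A k. has_bochner_integral M (\<psi> k n) 0"
      unfolding \<psi>_def using psi_L20(1) yY by blast
    show "\<exists>C>0. \<forall>k\<in>K. \<forall>n\<in>A k. \<forall>x. \<bar>\<psi> k n x\<bar>
        \<le> C / sqrt (measure M (ball (y k n) (\<delta> powi k))) * \<rho> (dist x (y k n) / \<delta> powi k)"
      using E_pos psi_bound yY unfolding \<psi>_def \<rho>_def rr_def by blast
  qed (use \<delta> anti basis in auto)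
  moreover have "hoelder_wavelets M \<rho> \<delta> K A y \<psi> \<eta>"
    unfolding hoelder_wavelets_def
  proof (intro exI[of _ E] conjI ballI allI impI E_pos)
    fix k n and x x' :: 'a assume n: "n \<in> A k" and d: "dist x x' \<le> \<delta> powi k"
    let ?D = "E / sqrt (measure M (ball (y k n) (\<delta> powi k))) * \<rho> (dist x (y k n) / \<delta> powi k)"
    have t: "0 \<le> dist x x' / \<delta> powi k" "dist x x' / \<delta> powi k \<le> 1"
      using d \<delta> by (auto simp: divide_simps)
    have "\<bar>\<psi> k n x - \<psi> k n x'\<bar> \<le> ?D * (dist x x' / \<delta> powi k) powr \<eta>'"
      using psi_hoelder[OF yY[OF n], of x x'] d unfolding \<psi>_def \<rho>_def rr_def by simp
    also have "\<dots> \<le> ?D * (dist x x' / \<delta> powi k) powr \<eta>"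
      using powr_mono'[OF \<eta>'(3) t] E_pos by (intro mult_left_mono) (auto simp: \<rho>_def)
    finally show "\<bar>\<psi> k n x - \<psi> k n x'\<bar> \<le> ?D * (dist x x' / \<delta> powi k) powr \<eta>" .
  qed
  moreover have "exponential_localization \<rho>"
    unfolding exponential_localization_def \<rho>_def using \<gamma>_pos by blast
  ultimately show ?thesis by blast
qed

end
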